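(* For every integer $n$ with $62 < n < 121$ and $n \notin \{64, 65, 67, 69, 73, 74\}$, there exists a 4-regular matchstick graph with exactly $n$ vertices.
   Context: A matchstick graph is a finite graph drawn in the Euclidean plane such that vertices are distinct points, every edge is a straight line segment of length 1 between its endpoints, and edges do not cross or overlap (two edges intersect at most in a common endpoint). A matchstick graph is 4-regular if every vertex has degree exactly 4. *)

theory Defs
  imports "HOL-Analysis.Analysis"
begin

definition matchstick_graph :: "complex set \<Rightarrow> complex set set \<Rightarrow> bool" where
  "matchstick_graph V E \<longleftrightarrow>
     finite V \<and>
     (\<forall>e\<in>E. \<exists>u v. e = {u, v} \<and> u \<in> V \<and> v \<in> V \<and> u \<noteq> v \<and> dist u v = 1) \<and>
     (\<forall>u v x y. {u, v} \<in> E \<longrightarrow> {x, y} \<in> E \<longrightarrow> {u, v} \<noteq> {x, y} \<longrightarrow>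
        closed_segment u v \<inter> closed_segment x y \<subseteq> {u, v} \<inter> {x, y})"

definition degree :: "complex set set \<Rightarrow> complex \<Rightarrow> nat" where
  "degree E v = card {e \<in> E. v \<in> e}"

definition four_regular :: "complex set \<Rightarrow> complex set set \<Rightarrow> bool" where
  "four_regular V E \<longleftrightarrow> (\<forall>v\<in>V. degree E v = 4)"

end

theory Submission
  imports Defs "HOL-Library.Numeral_Type"
begin

text \<open>A matchstick graph in a closed half-plane whose vertices have degree 2 on the boundary line and 4
  elsewhere, except for one apex of degree 2 off the line, yields together with its mirror image a tile:
  all degrees are 4 except at two vertices. Three tiles placed along the sides of a triangle form a
  4-regular matchstick graph, provided the tiles are thin enough near their ends. Tiles with 22, 30, 31,
  33, 34, 35, 36 and 37 vertices, where also two tiles in a row may serve as a side, give all required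
  numbers of vertices except 66, 68 and 70. These three arise from one quarter by reflection in two
  perpendicular lines.

  The half-graphs were found by computer. As rigid frameworks with as many edges as degrees of freedom
  they are isolated solutions of the system of edge length equations; Brouwer's fixed point theorem,
  applied to a simplified Newton iteration, shows that an exact solution lies close to the approximate
  one, so close that all incidences and separations can be read off from integer approximations.\<close>

subsection \<open>Matchstick graphs\<close>

text \<open>The systems of equations are square by construction. Share every edge equally between
  its endpoints: a vertex with both coordinates free has degree 4 and accounts for two edges, a
  vertex with one coordinate frozen has degree 2 and accounts for one. So each half-graph or quarter
  has as many edges as unknowns. Freezing a coordinate at 0 also puts the vertex exactly on its
  mirror line, which no estimate with rounding errors could establish. The obstacle afterwards is
  that the length of a tile is known only up to an interval, so a triangle must be built from sides
  of uncertain length. Therefore a tile is confined to a convex region that depends only on its true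
  length and on one slope, and the angles of the triangle are estimated through the law of cosines
  at the ends of the intervals.\<close>

lemma matchstick_graph_iff:
  "matchstick_graph V E \<longleftrightarrow> finite V \<and>
     (\<forall>e\<in>E. \<exists>u v. e = {u, v} \<and> u \<in> V \<and> v \<in> V \<and> dist u v = 1) \<and>
     (\<forall>e\<in>E. \<forall>f\<in>E. e \<noteq> f \<longrightarrow> convex hull e \<inter> convex hull f \<subseteq> e \<inter> f)" (is "?L = ?R")
proof
  assume L: ?L
  show ?R
  proof (intro conjI ballI impI)
    show "finite V" using L by (simp add: matchstick_graph_def)
  next
    fix e assume "e \<in> E"
    then obtain u v where "e = {u, v}" "u \<in> V" "v \<in> V" "dist u v = 1"
      using L unfolding matchstick_graph_def by meson
    then show "\<exists>u v. e = {u, v} \<and> u \<in> V \<and> v \<in> V \<and> dist u v = 1" by blast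
  next
    fix e f assume ef: "e \<in> E" "f \<in> E" "e \<noteq> f"
    obtain u v where e: "e = {u, v}" using L ef(1) unfolding matchstick_graph_def by meson
    obtain x y where f: "f = {x, y}" using L ef(2) unfolding matchstick_graph_def by meson
    have "closed_segment u v \<inter> closed_segment x y \<subseteq> {u, v} \<inter> {x, y}"
      using L ef unfolding matchstick_graph_def e f by simp
    then show "convex hull e \<inter> convex hull f \<subseteq> e \<inter> f"
      unfolding e f segment_convex_hull .
  qed
next
  assume R: ?R
  show ?L
    unfolding matchstick_graph_def
  proof (intro conjI ballI allI impI)
    show "finite V" using R by simp
  next
    fix e assume "e \<in> E"
    then obtain u v where uv: "e = {u, v}" "u \<in> V" "v \<in> V" "dist u v = 1" using R by meson
    then have "u \<noteq> v" by auto
    with uv show "\<exists>u v. e = {u, v} \<and> u \<in> V \<and> v \<in> V \<and> u \<noteq> v \<and> dist u v = 1" by blast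
  next
    fix u v x y assume "{u, v} \<in> E" "{x, y} \<in> E" "{u, v} \<noteq> {x, y}"
    then show "closed_segment u v \<inter> closed_segment x y \<subseteq> {u, v} \<inter> {x, y}"
      using R unfolding segment_convex_hull by meson
  qed
qed

lemma matchstick_graph_edgeE:
  assumes "matchstick_graph V E" "e \<in> E"
  obtains u v where "e = {u, v}" "u \<in> V" "v \<in> V" "dist u v = 1"
  using assms unfolding matchstick_graph_iff by meson

text \<open>Convex hulls of edges do not depend on an order of the endpoints and commute with
  isometries. Unions, images and reflections can thus be treated without naming endpoints.\<close>

lemma matchstick_graph_hulls:
  assumes "matchstick_graph V E" "e \<in> E" "f \<in> E" "e \<noteq> f"
  shows "convex hull e \<inter> convex hull f \<subseteq> e \<inter> f"
  using assms unfolding matchstick_graph_iff by meson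

lemma matchstick_graph_edge_subset:
  assumes "matchstick_graph V E" "e \<in> E"
  shows "e \<subseteq> V"
  using matchstick_graph_edgeE[OF assms] by blast

lemma matchstick_graph_finite_edges:
  assumes "matchstick_graph V E"
  shows "finite E"
proof (rule finite_subset)
  show "E \<subseteq> Pow V" using matchstick_graph_edge_subset[OF assms] by blast
  show "finite (Pow V)" using assms by (simp add: matchstick_graph_def)
qed

lemma matchstick_graph_infinite_hull:
  assumes "matchstick_graph V E" "e \<in> E"
  shows "infinite (convex hull e)"
proof -
  obtain u v where e: "e = {u, v}" and "dist u v = 1"
    using assms by (rule matchstick_graph_edgeE)
  then have "u \<noteq> v" by auto
  then show ?thesis
    using finite_closed_segment[of u v] unfolding e segment_convex_hull by simp
qed

section \<open>Degrees, and unions of graphs that meet only in vertices\<close>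

lemma degree_nonzeroD:
  assumes "degree E v \<noteq> 0"
  obtains e where "e \<in> E" "v \<in> e"
proof -
  have "{e \<in> E. v \<in> e} \<noteq> {}" using assms unfolding degree_def by (metis card.empty)
  then show ?thesis using that by blast
qed

lemma degree_eq_0:
  assumes "matchstick_graph V E" "v \<notin> V"
  shows "degree E v = 0"
proof -
  have "{e \<in> E. v \<in> e} = {}" using matchstick_graph_edge_subset[OF assms(1)] assms(2) by blast
  then show ?thesis unfolding degree_def by (simp only: card.empty)
qed

text \<open>An isolated vertex could lie inside an edge without violating the definition. A vertex
  of positive degree cannot: it is an endpoint of some edge \<open>f\<close>, and \<open>f\<close>
  meets \<open>e\<close> only in common endpoints. This is why nonzero degrees are assumed when
  graphs are glued.\<close>

lemma vertex_in_hull: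
  assumes "matchstick_graph V E" "e \<in> E" "v \<in> convex hull e" "degree E v \<noteq> 0"
  shows "v \<in> e"
proof -
  obtain f where f: "f \<in> E" "v \<in> f" using assms(4) by (rule degree_nonzeroD)
  show ?thesis
  proof (cases "e = f")
    case False
    have "v \<in> convex hull f" using f(2) by (rule hull_inc)
    with False show ?thesis using matchstick_graph_hulls[OF assms(1,2) f(1)] assms(3) by blast
  qed (use f in simp)
qed

text \<open>By \<open>vertex_in_hull\<close>, a common vertex that lies on two edges is an endpoint
  of both. Hence it is enough to know that edges of different graphs meet in common vertices, a
  condition that can be read off from regions containing the graphs.\<close>

lemma
  assumes G1: "matchstick_graph V1 E1" and G2: "matchstick_graph V2 E2"
    and meet: "\<And>e f. e \<in> E1 \<Longrightarrow> f \<in> E2 \<Longrightarrow> convex hull e \<inter> convex hull f \<subseteq> V1 \<inter> V2"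
    and deg1: "\<And>v. v \<in> V1 \<Longrightarrow> degree E1 v \<noteq> 0" and deg2: "\<And>v. v \<in> V2 \<Longrightarrow> degree E2 v \<noteq> 0"
  shows matchstick_graph_union: "matchstick_graph (V1 \<union> V2) (E1 \<union> E2)"
    and degree_union: "degree (E1 \<union> E2) v = degree E1 v + degree E2 v"
proof -
  have cross: "convex hull e \<inter> convex hull f \<subseteq> e \<inter> f" if "e \<in> E1" "f \<in> E2" for e f
    using meet[OF that] vertex_in_hull[OF G1 that(1)] vertex_in_hull[OF G2 that(2)] deg1 deg2
    by blast
  then show "matchstick_graph (V1 \<union> V2) (E1 \<union> E2)"
    unfolding matchstick_graph_iff
  proof (intro conjI ballI impI)
    show "finite (V1 \<union> V2)" using G1 G2 by (simp add: matchstick_graph_def)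
  next
    fix e assume "e \<in> E1 \<union> E2"
    then show "\<exists>u v. e = {u, v} \<and> u \<in> V1 \<union> V2 \<and> v \<in> V1 \<union> V2 \<and> dist u v = 1"
      using matchstick_graph_edgeE[OF G1, of e] matchstick_graph_edgeE[OF G2, of e] by blast
  next
    fix e f assume ef: "e \<in> E1 \<union> E2" "f \<in> E1 \<union> E2" "e \<noteq> f"
    have "convex hull e \<inter> convex hull f \<subseteq> e \<inter> f" if "e \<in> E1" "f \<in> E1"
      using matchstick_graph_hulls[OF G1 that ef(3)] .
    moreover have "convex hull e \<inter> convex hull f \<subseteq> e \<inter> f" if "e \<in> E2" "f \<in> E2"
      using matchstick_graph_hulls[OF G2 that ef(3)] .
    moreover have "convex hull e \<inter> convex hull f \<subseteq> e \<inter> f" if "e \<in> E2" "f \<in> E1"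
      using cross[OF that(2,1)] by blast
    ultimately show "convex hull e \<inter> convex hull f \<subseteq> e \<inter> f"
      using cross[of e f] ef(1,2) by blast
  qed
  \<comment> \<open>A shared edge would place its infinitely many points in the finite set
    \<open>V1\<close>. So the edge sets are disjoint and degrees add.\<close>
  have "e \<notin> E2" if "e \<in> E1" for e
  proof
    assume "e \<in> E2"
    then have "convex hull e \<subseteq> V1" using meet[OF that, of e] by blast
    then show False
      using matchstick_graph_infinite_hull[OF G1 that] G1 finite_subset
      unfolding matchstick_graph_iff by meson
  qed
  then have "{e \<in> E1. v \<in> e} \<inter> {e \<in> E2. v \<in> e} = {}" by blast
  moreover have "{e \<in> E1 \<union> E2. v \<in> e} = {e \<in> E1. v \<in> e} \<union> {e \<in> E2. v \<in> e}" by blast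
  ultimately show "degree (E1 \<union> E2) v = degree E1 v + degree E2 v"
    unfolding degree_def
    using matchstick_graph_finite_edges[OF G1] matchstick_graph_finite_edges[OF G2]
    by (simp add: card_Un_disjoint)
qed

section \<open>Plane isometries acting on matchstick graphs\<close>

locale plane_isometry =
  fixes f g :: "complex \<Rightarrow> complex" and a :: complex
  assumes lin: "linear g" and norm_g: "\<And>z. norm (g z) = norm z" and f_eq: "\<And>z. f z = a + g z"
begin

lemma dist_f: "dist (f x) (f y) = dist x y"
  using norm_g[of "x - y"] by (simp add: f_eq dist_norm linear_diff[OF lin])

lemma inj_f: "inj f"
proof (rule injI)
  fix x y assume "f x = f y"
  then have "dist x y = 0" using dist_f[of x y] by simp
  then show "x = y" by simp
qed

lemma hull_f: "convex hull (f ` S) = f ` (convex hull S)"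
proof -
  have "f ` T = (\<lambda>x. a + x) ` g ` T" for T by (auto simp: f_eq)
  then show ?thesis
    by (simp add: convex_hull_translation convex_hull_linear_image[OF lin])
qed

lemma matchstick_graph_image:
  assumes "matchstick_graph V E"
  shows "matchstick_graph (f ` V) ((`) f ` E)"
  unfolding matchstick_graph_iff
proof (intro conjI ballI impI)
  show "finite (f ` V)" using assms by (simp add: matchstick_graph_def)
next
  fix e assume "e \<in> (`) f ` E"
  then obtain d where "d \<in> E" "e = f ` d" by blast
  then obtain u v where "e = f ` {u, v}" "u \<in> V" "v \<in> V" "dist u v = 1"
    using matchstick_graph_edgeE[OF assms] by metis
  then show "\<exists>u v. e = {u, v} \<and> u \<in> f ` V \<and> v \<in> f ` V \<and> dist u v = 1"
    by (intro exI[of _ "f u"] exI[of _ "f v"]) (simp add: dist_f)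
next
  fix e e' assume "e \<in> (`) f ` E" "e' \<in> (`) f ` E" "e \<noteq> e'"
  then obtain d d' where d: "e = f ` d" "e' = f ` d'" "d \<in> E" "d' \<in> E" "d \<noteq> d'" by blast
  then have "convex hull d \<inter> convex hull d' \<subseteq> d \<inter> d'"
    using matchstick_graph_hulls[OF assms] by blast
  then show "convex hull e \<inter> convex hull e' \<subseteq> e \<inter> e'"
    unfolding d hull_f image_Int[OF inj_f, symmetric] by (rule image_mono)
qed

lemma degree_image: "degree ((`) f ` E) (f v) = degree E v"
proof -
  have "{e \<in> (`) f ` E. f v \<in> e} = (`) f ` {e \<in> E. f v \<in> f ` e}" by blast
  also have "\<dots> = (`) f ` {e \<in> E. v \<in> e}" by (simp only: inj_image_mem_iff[OF inj_f])
  finally have "{e \<in> (`) f ` E. f v \<in> e} = (`) f ` {e \<in> E. v \<in> e}" .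
  moreover have "inj_on ((`) f) {e \<in> E. v \<in> e}"
    by (rule inj_onI) (simp only: inj_image_eq_iff[OF inj_f])
  ultimately show ?thesis unfolding degree_def by (simp add: card_image)
qed

end

lemma plane_isometry_rotation: "cmod u = 1 \<Longrightarrow> plane_isometry (\<lambda>z. a + u * z) (\<lambda>z. u * z) a"
  by unfold_locales (auto simp: norm_mult algebra_simps)

lemma plane_isometry_reflection:
  "cmod u = 1 \<Longrightarrow> plane_isometry (\<lambda>z. a + u * cnj z) (\<lambda>z. u * cnj z) a"
  by unfold_locales (auto simp: norm_mult algebra_simps)

lemma plane_isometry_cnj: "plane_isometry cnj cnj 0"
  by unfold_locales (auto simp: algebra_simps)

subsection \<open>Reflection in the real axis\<close>

definition mirror :: "complex set \<Rightarrow> complex set" where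
  "mirror V = V \<union> cnj ` V"

definition mirror_edges :: "complex set set \<Rightarrow> complex set set" where
  "mirror_edges E = E \<union> (`) cnj ` E"

text \<open>Since every edge has an endpoint strictly above the axis, no edge lies along the axis
  and overlaps its own mirror image. Nonzero degrees are included so that the graph can be glued to
  its image.\<close>

definition upper_graph :: "complex set \<Rightarrow> complex set set \<Rightarrow> bool" where
  "upper_graph V E \<longleftrightarrow> matchstick_graph V E \<and> (\<forall>v\<in>V. 0 \<le> Im v \<and> degree E v \<noteq> 0) \<and>
     (\<forall>e\<in>E. \<exists>v\<in>e. 0 < Im v)"

lemma closed_segment_real_axis:
  assumes "0 < Im u" "0 \<le> Im v" "z \<in> closed_segment u v" "Im z \<le> 0"
  shows "z = v \<and> Im v = 0"
proof -
  obtain t where t: "0 \<le> t" "t \<le> 1" "z = (1 - t) *\<^sub>R u + t *\<^sub>R v"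
    using assms(3) unfolding closed_segment_def by blast
  have "Im z = (1 - t) * Im u + t * Im v" using t by simp
  moreover have "0 \<le> (1 - t) * Im u" "0 \<le> t * Im v" using assms t by simp_all
  ultimately have "(1 - t) * Im u = 0" "t * Im v = 0" using assms(4) by linarith+
  then have "t = 1" "Im v = 0" using assms(1) by auto
  then show ?thesis using t by simp
qed

lemma upper_graph_hull:
  assumes "upper_graph V E" "e \<in> E" "z \<in> convex hull e" "Im z \<le> 0"
  shows "z \<in> V \<and> Im z = 0"
proof -
  obtain u where u: "u \<in> e" "0 < Im u" using assms(1,2) unfolding upper_graph_def by blast
  obtain x y where xy: "e = {x, y}" "x \<in> V" "y \<in> V"
    using assms(1,2) matchstick_graph_edgeE unfolding upper_graph_def by metis
  then obtain v where e: "e = {u, v}" "u \<in> V" "v \<in> V" "0 < Im u"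
    using u by blast
  then have "0 \<le> Im v" using assms(1) unfolding upper_graph_def by blast
  then show ?thesis
    using closed_segment_real_axis[OF e(4)] assms(3,4) e(1,3) unfolding segment_convex_hull by blast
qed

lemma upper_graph_hull_nonneg:
  assumes "upper_graph V E" "e \<in> E" "z \<in> convex hull e"
  shows "0 \<le> Im z"
  using upper_graph_hull[OF assms] by force

context
  fixes V E
  assumes up: "upper_graph V E"
begin

lemma matchstick_graph_mirror: "matchstick_graph (mirror V) (mirror_edges E)"
  and degree_mirror: "degree (mirror_edges E) v = degree E v + degree E (cnj v)"
proof -
  interpret plane_isometry cnj cnj 0 by (rule plane_isometry_cnj)
  have G: "matchstick_graph V E" using up unfolding upper_graph_def by blast
  \<comment> \<open>A common point of an edge and a reflected edge has nonnegative and nonpositive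
    imaginary part. It lies on the axis, is a vertex there, and is its own mirror image.\<close>
  have meet: "convex hull e \<inter> convex hull f \<subseteq> V \<inter> cnj ` V" if ef: "e \<in> E" "f \<in> (`) cnj ` E" for e f
  proof
    fix z assume z: "z \<in> convex hull e \<inter> convex hull f"
    obtain d where d: "f = cnj ` d" "d \<in> E" using ef by blast
    have w: "cnj z \<in> convex hull d" using z unfolding d hull_f by auto
    then have "Im z \<le> 0" using upper_graph_hull_nonneg[OF up d(2) w] by simp
    then have *: "z \<in> V" "Im z = 0" using upper_graph_hull[OF up ef(1)] z by blast+
    then have "cnj z = z" by (simp add: complex_eq_iff)
    then show "z \<in> V \<inter> cnj ` V" using * by (metis IntI imageI)
  qed
  have deg: "degree E v \<noteq> 0" if "v \<in> V" for v using up that unfolding upper_graph_def by blast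
  have deg': "degree ((`) cnj ` E) v \<noteq> 0" if "v \<in> cnj ` V" for v
    using that deg degree_image by auto
  show "matchstick_graph (mirror V) (mirror_edges E)"
    unfolding mirror_def mirror_edges_def
    by (rule matchstick_graph_union[OF G matchstick_graph_image[OF G] meet deg deg'])
  have "degree ((`) cnj ` E) v = degree E (cnj v)" using degree_image[of E "cnj v"] by simp
  then show "degree (mirror_edges E) v = degree E v + degree E (cnj v)"
    unfolding mirror_edges_def
    using degree_union[OF G matchstick_graph_image[OF G] meet deg deg'] by simp
qed

lemma degree_mirror_axis: "Im v = 0 \<Longrightarrow> degree (mirror_edges E) v = 2 * degree E v"
proof -
  assume "Im v = 0"
  then have "cnj v = v" by (simp add: complex_eq_iff)
  then show ?thesis by (simp add: degree_mirror)
qed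

lemma degree_mirror_off_axis:
  assumes "Im v > 0"
  shows "degree (mirror_edges E) v = degree E v" "degree (mirror_edges E) (cnj v) = degree E v"
proof -
  have "cnj v \<notin> V"
  proof
    assume "cnj v \<in> V"
    then have "0 \<le> Im (cnj v)" using up unfolding upper_graph_def by blast
    then show False using assms by simp
  qed
  then have "degree E (cnj v) = 0" using up degree_eq_0 unfolding upper_graph_def by blast
  then show "degree (mirror_edges E) v = degree E v" "degree (mirror_edges E) (cnj v) = degree E v"
    by (simp_all add: degree_mirror)
qed

end

lemma card_mirror:
  assumes fin: "finite V" and nonneg: "\<And>v. v \<in> V \<Longrightarrow> 0 \<le> Im v"
  shows "card (mirror V) = card V + card {v \<in> V. Im v \<noteq> 0}"
proof -
  have "mirror V = V \<union> cnj ` {v \<in> V. Im v \<noteq> 0}"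
  proof -
    have "cnj v = v" if "Im v = 0" for v using that by (simp add: complex_eq_iff)
    then have "cnj ` V \<subseteq> V \<union> cnj ` {v \<in> V. Im v \<noteq> 0}" by force
    then show ?thesis unfolding mirror_def by blast
  qed
  moreover have "cnj v \<notin> V" if "v \<in> V" "Im v \<noteq> 0" for v
    using nonneg[of v] nonneg[of "cnj v"] that by auto
  then have "V \<inter> cnj ` {v \<in> V. Im v \<noteq> 0} = {}" by blast
  moreover have "card (cnj ` {v \<in> V. Im v \<noteq> 0}) = card {v \<in> V. Im v \<noteq> 0}"
    by (intro card_image inj_onI) simp
  ultimately show ?thesis using fin by (simp add: card_Un_disjoint)
qed

subsection \<open>Tiles and triangles of tiles\<close>

text \<open>\<open>K\<close> is a container for the drawing: whether two links may be joined is
  decided by their containers alone. The ends have degree 2 because each is shared with another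
  link, which raises its degree to 4.\<close>

definition link :: "nat \<Rightarrow> complex \<Rightarrow> complex \<Rightarrow> complex set \<Rightarrow> complex set \<Rightarrow> complex set set \<Rightarrow> bool" where
  "link m p q K V E \<longleftrightarrow> matchstick_graph V E \<and> card V = m \<and> p \<in> V \<and> q \<in> V \<and> p \<noteq> q \<and>
     (\<forall>v\<in>V. degree E v = (if v = p \<or> v = q then 2 else 4)) \<and> (\<forall>e\<in>E. convex hull e \<subseteq> K)"

lemma link_degree:
  assumes "link m p q K V E"
  shows "degree E v = (if v \<in> V then if v = p \<or> v = q then 2 else 4 else 0)"
proof (cases "v \<in> V")
  case True
  then show ?thesis using assms unfolding link_def by simp
next
  case False
  then have "degree E v = 0" using assms degree_eq_0[of V E v] unfolding link_def by blast
  then show ?thesis using False by simp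
qed

lemma link_vertices:
  assumes "link m p q K V E"
  shows "V \<subseteq> K"
proof
  fix v assume "v \<in> V"
  then have "degree E v \<noteq> 0" using assms by (simp add: link_degree)
  then obtain e where "e \<in> E" "v \<in> e" by (rule degree_nonzeroD)
  moreover from this have "v \<in> convex hull e" by (simp add: hull_inc)
  ultimately show "v \<in> K" using assms unfolding link_def by blast
qed

text \<open>Every vertex lies on an edge and hence in its container. So if the containers meet in
  common vertices only, their intersection is exactly the set of common vertices.\<close>

lemma
  assumes L1: "link m1 p1 q1 K1 V1 E1" and L2: "link m2 p2 q2 K2 V2 E2"
    and meet: "K1 \<inter> K2 \<subseteq> V1 \<inter> V2"
  shows matchstick_graph_union_link: "matchstick_graph (V1 \<union> V2) (E1 \<union> E2)"
    and degree_union_link: "degree (E1 \<union> E2) v = degree E1 v + degree E2 v"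
    and Int_link: "V1 \<inter> V2 = K1 \<inter> K2"
    and card_union_link: "card (V1 \<union> V2) + card (K1 \<inter> K2) = m1 + m2"
proof -
  have G: "matchstick_graph V1 E1" "matchstick_graph V2 E2" using L1 L2 unfolding link_def by auto
  have deg: "degree E1 v \<noteq> 0" if "v \<in> V1" for v using that by (simp add: link_degree[OF L1])
  have deg': "degree E2 v \<noteq> 0" if "v \<in> V2" for v using that by (simp add: link_degree[OF L2])
  have hull: "convex hull e \<inter> convex hull f \<subseteq> V1 \<inter> V2" if "e \<in> E1" "f \<in> E2" for e f
    using L1 L2 that meet unfolding link_def by blast
  show "matchstick_graph (V1 \<union> V2) (E1 \<union> E2)"
    by (rule matchstick_graph_union[OF G hull deg deg'])
  show "degree (E1 \<union> E2) v = degree E1 v + degree E2 v"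
    by (rule degree_union[OF G hull deg deg'])
  show *: "V1 \<inter> V2 = K1 \<inter> K2" using link_vertices[OF L1] link_vertices[OF L2] meet by blast
  have "finite V1" "finite V2" using G by (simp_all add: matchstick_graph_def)
  then show "card (V1 \<union> V2) + card (K1 \<inter> K2) = m1 + m2"
    using card_Un_Int[of V1 V2] L1 L2 * unfolding link_def by simp
qed

lemma link_chain:
  assumes L1: "link m1 p q K1 V1 E1" and L2: "link m2 q r K2 V2 E2"
    and meet: "K1 \<inter> K2 \<subseteq> {q}"
  shows "link (m1 + m2 - 1) p r (K1 \<union> K2) (V1 \<union> V2) (E1 \<union> E2)"
proof -
  have in1: "p \<in> V1" "q \<in> V1" "p \<noteq> q" and in2: "q \<in> V2" "r \<in> V2" "q \<noteq> r"
    using L1 L2 unfolding link_def by auto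
  have sub: "K1 \<inter> K2 \<subseteq> V1 \<inter> V2" using meet in1 in2 by blast
  have int: "V1 \<inter> V2 = {q}" using Int_link[OF L1 L2 sub] meet in1 in2 by blast
  have K: "K1 \<inter> K2 = {q}" using int Int_link[OF L1 L2 sub] by simp
  have "p \<notin> V2" "r \<notin> V1" using int in1 in2 by (metis IntI singletonD)+
  have deg: "degree (E1 \<union> E2) v = (if v = p \<or> v = r then 2 else 4)" if "v \<in> V1 \<union> V2" for v
    unfolding degree_union_link[OF L1 L2 sub] link_degree[OF L1] link_degree[OF L2]
    using that int in1 in2 \<open>p \<notin> V2\<close> \<open>r \<notin> V1\<close> by auto
  show ?thesis
    unfolding link_def
  proof (intro conjI ballI)
    show "matchstick_graph (V1 \<union> V2) (E1 \<union> E2)" by (rule matchstick_graph_union_link[OF L1 L2 sub])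
    show "card (V1 \<union> V2) = m1 + m2 - 1" using card_union_link[OF L1 L2 sub] unfolding K by simp
    show "p \<in> V1 \<union> V2" "r \<in> V1 \<union> V2" using in1 in2 by blast+
    show "p \<noteq> r" using \<open>p \<notin> V2\<close> in2 by blast
    show "degree (E1 \<union> E2) v = (if v = p \<or> v = r then 2 else 4)" if "v \<in> V1 \<union> V2" for v
      by (rule deg[OF that])
    show "convex hull e \<subseteq> K1 \<union> K2" if "e \<in> E1 \<union> E2" for e
      using that L1 L2 unfolding link_def by blast
  qed
qed

lemma link_close:
  assumes L1: "link m1 p q K1 V1 E1" and L2: "link m2 q p K2 V2 E2"
    and meet: "K1 \<inter> K2 \<subseteq> {p, q}"
  shows "matchstick_graph (V1 \<union> V2) (E1 \<union> E2)" "four_regular (V1 \<union> V2) (E1 \<union> E2)"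
    "card (V1 \<union> V2) = m1 + m2 - 2"
proof -
  have in1: "p \<in> V1" "q \<in> V1" "p \<noteq> q" and in2: "q \<in> V2" "p \<in> V2"
    using L1 L2 unfolding link_def by auto
  have sub: "K1 \<inter> K2 \<subseteq> V1 \<inter> V2" using meet in1 in2 by blast
  have int: "V1 \<inter> V2 = {p, q}" using Int_link[OF L1 L2 sub] meet in1 in2 by blast
  show "matchstick_graph (V1 \<union> V2) (E1 \<union> E2)" by (rule matchstick_graph_union_link[OF L1 L2 sub])
  have "degree (E1 \<union> E2) v = 4" if "v \<in> V1 \<union> V2" for v
    unfolding degree_union_link[OF L1 L2 sub] link_degree[OF L1] link_degree[OF L2]
    using that int by auto
  then show "four_regular (V1 \<union> V2) (E1 \<union> E2)" unfolding four_regular_def by blast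
  show "card (V1 \<union> V2) = m1 + m2 - 2"
    using card_union_link[OF L1 L2 sub] in1(3) unfolding Int_link[OF L1 L2 sub, symmetric] int by simp
qed

lemma (in plane_isometry) link_image:
  assumes "link m p q K V E"
  shows "link m (f p) (f q) (f ` K) (f ` V) ((`) f ` E)"
proof -
  have f: "f v = f w \<longleftrightarrow> v = w" for v w using inj_f by (simp add: inj_eq)
  show ?thesis
    unfolding link_def
  proof (intro conjI ballI)
    show "matchstick_graph (f ` V) ((`) f ` E)"
      using assms matchstick_graph_image unfolding link_def by blast
    have "card (f ` V) = card V" by (rule card_image) (meson inj_f inj_on_subset subset_UNIV)
    then show "card (f ` V) = m" using assms unfolding link_def by simp
    show "f p \<in> f ` V" "f q \<in> f ` V" "f p \<noteq> f q"
      using assms unfolding link_def f by auto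
  next
    fix v assume "v \<in> f ` V"
    then obtain w where w: "v = f w" "w \<in> V" by blast
    then have "degree E w = (if w = p \<or> w = q then 2 else 4)"
      using assms unfolding link_def by blast
    then show "degree ((`) f ` E) v = (if v = f p \<or> v = f q then 2 else 4)"
      unfolding w(1) degree_image f .
  next
    fix e assume "e \<in> (`) f ` E"
    then obtain d where d: "e = f ` d" "d \<in> E" by blast
    then have "convex hull d \<subseteq> K" using assms unfolding link_def by blast
    then show "convex hull e \<subseteq> f ` K" unfolding d hull_f by (rule image_mono)
  qed
qed

text \<open>The slope 10 below the base is a generous choice; together with the slope
  \<open>s \<ge> 0\<close> above, it confines the region to the strip between the perpendiculars at
  the ends of the base. On the outer side of a triangle the corners require no more than
  that.\<close>

definition tile_region :: "real \<Rightarrow> real \<Rightarrow> complex set" where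
  "tile_region s d = {z. Im z \<le> s * Re z \<and> Im z \<le> s * (d - Re z) \<and>
     - Im z \<le> 10 * Re z \<and> - Im z \<le> 10 * (d - Re z)}"

lemma convex_tile_region: "convex (tile_region s d)"
proof -
  have "tile_region s d = {z. Complex (- s) 1 \<bullet> z \<le> 0} \<inter> {z. Complex s 1 \<bullet> z \<le> s * d} \<inter>
      {z. Complex (- 10) (- 1) \<bullet> z \<le> 0} \<inter> {z. Complex 10 (- 1) \<bullet> z \<le> 10 * d}"
    unfolding tile_region_def inner_complex_def by (auto simp: algebra_simps)
  then show ?thesis by (simp add: convex_Int convex_halfspace_le)
qed

lemma tile_region_bounds:
  assumes "z \<in> tile_region s d" "0 \<le> s"
  shows "0 \<le> Re z" "Re z \<le> d"
proof -
  have "0 \<le> (s + 10) * Re z" "0 \<le> (s + 10) * (d - Re z)"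
    using assms unfolding tile_region_def by (auto simp: algebra_simps)
  then show "0 \<le> Re z" "Re z \<le> d" using assms(2) by (simp_all add: zero_le_mult_iff)
qed

text \<open>The two vertices of degree 2 of a tile are the ends \<open>0\<close> and \<open>d\<close> of its base; \<open>s\<close> bounds the
  slope under which it rises from them on the side that faces the interior of a triangle of tiles.\<close>

definition tile :: "real \<Rightarrow> nat \<Rightarrow> real \<Rightarrow> real \<Rightarrow> bool" where
  "tile s m a b \<longleftrightarrow> 0 < a \<and> (\<exists>d V E. a \<le> d \<and> d \<le> b \<and> link m 0 (complex_of_real d) (tile_region s d) V E)"

lemma link_mono: "link m p q K V E \<Longrightarrow> K \<subseteq> K' \<Longrightarrow> link m p q K' V E"
  unfolding link_def by blast

text \<open>Allows certified lengths to be rounded outward to hundredths, so that the triangle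
  conditions become inequalities between short decimals.\<close>

lemma tile_weaken:
  assumes "tile s m a b" "s = s'" "0 < a'" "a' \<le> a" "b \<le> b'"
  shows "tile s' m a' b'"
proof -
  obtain d V E where "a \<le> d" "d \<le> b" "link m 0 (complex_of_real d) (tile_region s d) V E"
    using assms(1) unfolding tile_def by blast
  then have "a' \<le> d" "d \<le> b'" "link m 0 (complex_of_real d) (tile_region s' d) V E"
    using assms by simp_all
  with assms(3) show ?thesis unfolding tile_def by blast
qed

lemma tile_chain:
  assumes T1: "tile s m1 a1 b1" and T2: "tile s m2 a2 b2" and s: "0 \<le> s"
  shows "tile s (m1 + m2 - 1) (a1 + a2) (b1 + b2)"
proof -
  obtain d1 V1 E1 where 1: "a1 \<le> d1" "d1 \<le> b1" "link m1 0 (complex_of_real d1) (tile_region s d1) V1 E1"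
    using T1 unfolding tile_def by blast
  obtain d2 V2 E2 where 2: "a2 \<le> d2" "d2 \<le> b2" "link m2 0 (complex_of_real d2) (tile_region s d2) V2 E2"
    using T2 unfolding tile_def by blast
  have pos: "0 < d1" "0 < d2" using T1 T2 1 2 unfolding tile_def by auto
  define f where "f z = complex_of_real d1 + 1 * z" for z
  interpret plane_isometry f "\<lambda>z. 1 * z" "complex_of_real d1"
    unfolding f_def by (rule plane_isometry_rotation) simp
  let ?K1 = "tile_region s d1" and ?K2 = "f ` tile_region s d2"
  have f: "f 0 = complex_of_real d1" "f (complex_of_real d2) = complex_of_real (d1 + d2)"
    by (simp_all add: f_def)
  \<comment> \<open>The regions occupy adjacent strips, so a common point lies on the line between
    them, where the slope conditions leave only the shared end.\<close>
  have "?K1 \<inter> ?K2 \<subseteq> {complex_of_real d1}"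
  proof
    fix z assume z: "z \<in> ?K1 \<inter> ?K2"
    then obtain w where w: "w \<in> tile_region s d2" "z = complex_of_real d1 + w" by (auto simp: f_def)
    have "Re z \<le> d1" "0 \<le> Re w" using tile_region_bounds z w s by blast+
    then have "Re z = d1" using w by simp
    moreover have "Im z \<le> 0" "- Im z \<le> 0" using z \<open>Re z = d1\<close> unfolding tile_region_def by auto
    ultimately show "z \<in> {complex_of_real d1}" by (simp add: complex_eq_iff)
  qed
  then have L: "link (m1 + m2 - 1) 0 (complex_of_real (d1 + d2)) (?K1 \<union> ?K2) (V1 \<union> f ` V2) (E1 \<union> (`) f ` E2)"
    using link_chain[OF 1(3) link_image[OF 2(3), unfolded f]] by simp
  have "?K1 \<union> ?K2 \<subseteq> tile_region s (d1 + d2)"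
  proof
    fix z assume "z \<in> ?K1 \<union> ?K2"
    then consider "z \<in> ?K1" | w where "w \<in> tile_region s d2" "z = complex_of_real d1 + w"
      by (auto simp: f_def)
    then show "z \<in> tile_region s (d1 + d2)"
    proof cases
      case 1
      have "0 \<le> s * d2" using s pos by simp
      with 1 pos show ?thesis unfolding tile_region_def by (auto simp: algebra_simps)
    next
      case 2
      have "0 \<le> s * d1" using s pos by simp
      with 2 pos show ?thesis unfolding tile_region_def by (auto simp: algebra_simps)
    qed
  qed
  then have "link (m1 + m2 - 1) 0 (complex_of_real (d1 + d2)) (tile_region s (d1 + d2)) (V1 \<union> f ` V2) (E1 \<union> (`) f ` E2)"
    by (rule link_mono[OF L])
  moreover have "a1 + a2 \<le> d1 + d2" "d1 + d2 \<le> b1 + b2" "0 < a1 + a2"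
    using 1 2 T1 T2 unfolding tile_def by auto
  ultimately show ?thesis unfolding tile_def by blast
qed

text \<open>Two tiles along the sides of an angle meet only in its apex if the angle exceeds
  \<open>2 arctan s\<close>; \<open>c\<close> is the cosine and \<open>t\<close> the sine of the angle.\<close>

lemma tile_corner:
  assumes z: "z \<in> tile_region s d" and w: "w \<in> tile_region s d'" and s: "0 \<le> s"
    and eq: "z = Complex c t * (complex_of_real d' - w)"
    and ct: "c\<^sup>2 + t\<^sup>2 = 1" "0 < t" "c * (1 + s\<^sup>2) < 1 - s\<^sup>2" and "s < 1"
  shows "z = 0"
proof -
  \<comment> \<open>In either tile, the distance from the corner measured along the base and the
    height above the base towards the interior of the angle.\<close>
  define x y x' y' where "x = Re z" and "y = Im z" and "x' = d' - Re w" and "y' = Im w"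
  have le: "0 \<le> x" "0 \<le> x'" "y \<le> s * x" "y' \<le> s * x'"
    using z w s tile_region_bounds(1)[OF z s] tile_region_bounds(2)[OF w s]
    unfolding tile_region_def x_def y_def x'_def y'_def by auto
  have x: "x = c * x' + t * y'" and y: "y = t * x' - c * y'"
    using arg_cong[OF eq, of Re] arg_cong[OF eq, of Im] unfolding x_def y_def x'_def y'_def
    by (simp_all add: algebra_simps)
  have "c * x + t * y = (c\<^sup>2 + t\<^sup>2) * x'" "t * x - c * y = (c\<^sup>2 + t\<^sup>2) * y'"
    unfolding x y by algebra+
  then have x': "x' = c * x + t * y" and y': "y' = t * x - c * y" using ct(1) by simp_all
  have s2: "0 < 1 - s\<^sup>2" using s \<open>s < 1\<close> by (simp add: abs_square_less_1)
  \<comment> \<open>For \<open>c > 0\<close> this says that the tangent \<open>t / c\<close> of the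
    angle exceeds \<open>2 * s / (1 - s\<^sup>2)\<close>, the tangent of \<open>2 arctan s\<close>.
    It follows from the comparison of cosines by squaring.\<close>
  have *: "2 * s * c < t * (1 - s\<^sup>2)"
  proof (cases "c \<le> 0")
    case True
    have "s * c \<le> 0" using s True by (simp add: mult_nonneg_nonpos)
    moreover have "0 < t * (1 - s\<^sup>2)" using ct(2) s2 by simp
    ultimately show ?thesis by linarith
  next
    case False
    have "(c * (1 + s\<^sup>2))\<^sup>2 < (1 - s\<^sup>2)\<^sup>2"
      using False ct(3) by (intro power_strict_mono) auto
    moreover have "(t * (1 - s\<^sup>2))\<^sup>2 - (2 * s * c)\<^sup>2 = (c\<^sup>2 + t\<^sup>2) * (1 - s\<^sup>2)\<^sup>2 - (c * (1 + s\<^sup>2))\<^sup>2"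
      by algebra
    ultimately have "(2 * s * c)\<^sup>2 < (t * (1 - s\<^sup>2))\<^sup>2" using ct(1) by simp
    then show ?thesis by (rule power_less_imp_less_base) (use ct(2) s2 in simp)
  qed
  have le': "(t - s * c) * x \<le> (c + s * t) * y"
    using le(4) unfolding x' y' by (simp add: algebra_simps)
  \<comment> \<open>If \<open>c + s * t\<close> is positive, the two slope bounds combine to make a
    positive multiple of \<open>x\<close> nonpositive. Otherwise \<open>c \<le> 0\<close>; then
    \<open>x' \<ge> 0\<close> forces \<open>y \<ge> 0\<close>, and the bound in the second tile
    alone gives \<open>x = 0\<close>.\<close>
  have "x = 0 \<and> y = 0"
  proof (cases "0 < c + s * t")
    case True
    then have "(c + s * t) * y \<le> (c + s * t) * (s * x)" using le(3) by (intro mult_left_mono) auto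
    then have "(t * (1 - s\<^sup>2) - 2 * s * c) * x \<le> 0" using le' by (simp add: algebra_simps power2_eq_square)
    then have "x = 0" using * le(1) by (simp add: mult_le_0_iff)
    then show ?thesis using le(3) le' True by (simp add: zero_le_mult_iff)
  next
    case False
    have "0 \<le> s * t" using s ct(2) by simp
    then have c: "c \<le> 0" using False by linarith
    have "0 \<le> - c * x" using c le(1) by (intro mult_nonneg_nonneg) simp_all
    then have "0 \<le> t * y" using le(2) unfolding x' by linarith
    then have y0: "0 \<le> y" using ct(2) by (simp add: zero_le_mult_iff)
    then have "(c + s * t) * y \<le> 0" using False by (intro mult_nonpos_nonneg) auto
    moreover have "s * c \<le> 0" using s c by (simp add: mult_nonneg_nonpos)
    then have "0 < t - s * c" using ct(2) by linarith
    ultimately have "x = 0" using le' le(1) by (smt (verit) mult_pos_pos)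
    then show ?thesis using le(3) y0 by simp
  qed
  then show ?thesis unfolding x_def y_def by (simp add: complex_eq_iff)
qed

text \<open>The angle conditions state, with denominators cleared, that the cosine given by the law
  of cosines is below \<open>(1 - s\<^sup>2) / (1 + s\<^sup>2)\<close>, the cosine of
  \<open>2 arctan s\<close>. The worst case over the intervals is taken: adjacent sides enter the
  squares with their upper and the product with their lower ends, the opposite side enters with its
  lower end.\<close>

lemma ex_triangle_of_tiles:
  assumes T: "tile s m1 a1 b1" "tile s m2 a2 b2" "tile s m3 a3 b3" and s: "0 \<le> s" "s < 1"
    and angles:
      "(b1\<^sup>2 + b3\<^sup>2 - a2\<^sup>2) * (1 + s\<^sup>2) < 2 * a1 * a3 * (1 - s\<^sup>2)"
      "(b1\<^sup>2 + b2\<^sup>2 - a3\<^sup>2) * (1 + s\<^sup>2) < 2 * a1 * a2 * (1 - s\<^sup>2)"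
      "(b2\<^sup>2 + b3\<^sup>2 - a1\<^sup>2) * (1 + s\<^sup>2) < 2 * a2 * a3 * (1 - s\<^sup>2)"
  shows "\<exists>V E. matchstick_graph V E \<and> four_regular V E \<and> card V = m1 + m2 + m3 - 3"
proof -
  obtain d1 V1 E1 where 1: "a1 \<le> d1" "d1 \<le> b1" "link m1 0 (complex_of_real d1) (tile_region s d1) V1 E1"
    using T unfolding tile_def by blast
  obtain d2 V2 E2 where 2: "a2 \<le> d2" "d2 \<le> b2" "link m2 0 (complex_of_real d2) (tile_region s d2) V2 E2"
    using T unfolding tile_def by blast
  obtain d3 V3 E3 where 3: "a3 \<le> d3" "d3 \<le> b3" "link m3 0 (complex_of_real d3) (tile_region s d3) V3 E3"
    using T unfolding tile_def by blast
  have a: "0 < a1" "0 < a2" "0 < a3" using T unfolding tile_def by auto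
  then have pos: "0 < d1" "0 < d2" "0 < d3" using 1 2 3 by auto
  have s2: "0 < 1 - s\<^sup>2" using s by (simp add: abs_square_less_1)
  have ang: "(d\<^sup>2 + d'\<^sup>2 - e\<^sup>2) * (1 + s\<^sup>2) < 2 * d * d' * (1 - s\<^sup>2)"
    if "(b\<^sup>2 + b'\<^sup>2 - c\<^sup>2) * (1 + s\<^sup>2) < 2 * a * a' * (1 - s\<^sup>2)"
      "0 < a" "a \<le> d" "d \<le> b" "0 < a'" "a' \<le> d'" "d' \<le> b'" "0 < c" "c \<le> e" for a b d a' b' d' c e :: real
  proof -
    have "d\<^sup>2 \<le> b\<^sup>2" "d'\<^sup>2 \<le> b'\<^sup>2" "c\<^sup>2 \<le> e\<^sup>2" using that by (auto intro!: power_mono)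
    then have "(d\<^sup>2 + d'\<^sup>2 - e\<^sup>2) * (1 + s\<^sup>2) \<le> (b\<^sup>2 + b'\<^sup>2 - c\<^sup>2) * (1 + s\<^sup>2)"
      by (intro mult_right_mono) auto
    also have "\<dots> < 2 * (a * a') * (1 - s\<^sup>2)" using that(1) by (simp add: mult.assoc)
    also have "\<dots> \<le> 2 * (d * d') * (1 - s\<^sup>2)"
      using that s2 by (intro mult_right_mono mult_left_mono mult_mono) auto
    finally show ?thesis by (simp add: mult.assoc)
  qed
  note A1 = ang[OF angles(1) a(1) 1(1,2) a(3) 3(1,2) a(2) 2(1)]
    and A2 = ang[OF angles(2) a(1) 1(1,2) a(2) 2(1,2) a(3) 3(1)]
    and A3 = ang[OF angles(3) a(2) 2(1,2) a(3) 3(1,2) a(1) 1(1)]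
  \<comment> \<open>The abscissa of the third corner \<open>R\<close> when the first side runs from
    \<open>0\<close> to \<open>d1\<close> on the real axis.\<close>
  define x where "x = (d1\<^sup>2 + d3\<^sup>2 - d2\<^sup>2) / (2 * d1)"
  \<comment> \<open>As the bound on the cosines is at most 1, the angle conditions contain the
    triangle inequalities. The difference of the two sides is the product in Heron's formula, whose
    factors are then positive.\<close>
  have "(d1\<^sup>2 + d3\<^sup>2 - d2\<^sup>2)\<^sup>2 < (2 * d1 * d3)\<^sup>2"
  proof -
    have lt: "e < d" if "e * (1 + s\<^sup>2) < d * (1 - s\<^sup>2)" "0 < d" for d e :: real
    proof (rule ccontr)
      assume "\<not> e < d"
      then have "d * (1 + s\<^sup>2) \<le> e * (1 + s\<^sup>2)" by (intro mult_right_mono) auto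
      then have "2 * (d * s\<^sup>2) < 0" using that(1) by (simp add: algebra_simps)
      then show False using that(2) by (simp add: mult_less_0_iff)
    qed
    have "(d1 - d3)\<^sup>2 < d2\<^sup>2" "(d1 - d2)\<^sup>2 < d3\<^sup>2" "(d2 - d3)\<^sup>2 < d1\<^sup>2"
      using lt[OF A1] lt[OF A2] lt[OF A3] pos by (auto simp: power2_diff)
    then have "\<bar>d1 - d3\<bar> < d2" "\<bar>d1 - d2\<bar> < d3" "\<bar>d2 - d3\<bar> < d1"
      using pos by (auto simp: abs_le_square_iff[symmetric] not_le[symmetric] abs_of_pos dest!: iffD1)
    then have "0 < (d1 + d3 - d2) * (d1 + d3 + d2)" "0 < (d2 + d1 - d3) * (d2 - d1 + d3)"
      using pos by (auto intro!: mult_pos_pos)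
    then have "0 < ((d1 + d3 - d2) * (d1 + d3 + d2)) * ((d2 + d1 - d3) * (d2 - d1 + d3))" by simp
    moreover have "((d1 + d3 - d2) * (d1 + d3 + d2)) * ((d2 + d1 - d3) * (d2 - d1 + d3))
        = (2 * d1 * d3)\<^sup>2 - (d1\<^sup>2 + d3\<^sup>2 - d2\<^sup>2)\<^sup>2" by algebra
    ultimately show ?thesis by simp
  qed
  then have x_less: "x\<^sup>2 < d3\<^sup>2"
    using pos unfolding x_def by (simp add: power_divide power_mult_distrib divide_less_eq mult.commute)
  define y where "y = sqrt (d3\<^sup>2 - x\<^sup>2)"
  have y: "0 < y" "x\<^sup>2 + y\<^sup>2 = d3\<^sup>2" using x_less unfolding y_def by simp_all
  have x2: "2 * d1 * x = d1\<^sup>2 + d3\<^sup>2 - d2\<^sup>2" using pos unfolding x_def by simp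
  have d2: "(d1 - x)\<^sup>2 + y\<^sup>2 = d2\<^sup>2" using y(2) x2 by (simp add: power2_diff algebra_simps)
  \<comment> \<open>The tiles run counterclockwise, from \<open>0\<close> to \<open>Q\<close>, from
    \<open>Q\<close> to \<open>R\<close> and from \<open>R\<close> to \<open>0\<close>. The interior
    is then always to the left, on the thin side of the tile.\<close>
  define Q R where "Q = complex_of_real d1" and "R = Complex x y"
  define u v where "u = (R - Q) / d2" and "v = - R / d3"
  have "(cmod (R - Q))\<^sup>2 = d2\<^sup>2" "(cmod R)\<^sup>2 = d3\<^sup>2"
    using d2 y(2) unfolding Q_def R_def cmod_power2 by (simp_all add: power2_commute)
  then have "cmod (R - Q) = d2" "cmod R = d3" using pos by (auto simp: power2_eq_iff_nonneg)
  then have uv: "cmod u = 1" "cmod v = 1" using pos unfolding u_def v_def by (simp_all add: norm_divide)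
  define f g where "f z = Q + u * z" and "g z = R + v * z" for z
  interpret f: plane_isometry f "\<lambda>z. u * z" Q
    unfolding f_def by (rule plane_isometry_rotation[OF uv(1)])
  interpret g: plane_isometry g "\<lambda>z. v * z" R
    unfolding g_def by (rule plane_isometry_rotation[OF uv(2)])
  have fg: "f 0 = Q" "f (complex_of_real d2) = R" "g 0 = R" "g (complex_of_real d3) = 0"
    using pos by (simp_all add: f_def g_def u_def v_def)
  let ?K1 = "tile_region s d1" and ?K2 = "f ` tile_region s d2" and ?K3 = "g ` tile_region s d3"
  note L1 = 1(3)[folded Q_def] and L2 = f.link_image[OF 2(3), unfolded fg] and L3 = g.link_image[OF 3(3), unfolded fg]
  have cos: "c / (d * d') * (1 + s\<^sup>2) < 1 - s\<^sup>2" if "2 * c * (1 + s\<^sup>2) < 2 * d * d' * (1 - s\<^sup>2)" "0 < d" "0 < d'"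
    for c d d' :: real using that by (simp add: divide_less_eq mult.commute mult.left_commute)
  have P: "?K3 \<inter> ?K1 \<subseteq> {0}"
  proof
    fix z assume "z \<in> ?K3 \<inter> ?K1"
    then obtain w where w: "w \<in> tile_region s d3" "z = R + v * w" and z: "z \<in> tile_region s d1"
      by (auto simp: g_def)
    have "z = Complex (x / d3) (y / d3) * (complex_of_real d3 - w)"
      using pos unfolding w(2) v_def R_def by (simp add: complex_eq_iff field_simps)
    moreover have "(x / d3)\<^sup>2 + (y / d3)\<^sup>2 = 1" using y(2) pos by (simp add: power_divide add_divide_distrib[symmetric])
    moreover have "x / d3 * (1 + s\<^sup>2) < 1 - s\<^sup>2"
      using cos[of "d1 * x" d1 d3] A1 pos unfolding x2[symmetric] by (simp add: mult.assoc)
    ultimately have "z = 0" using y(1) pos s(2)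
      by (intro tile_corner[OF z w(1) s(1), where c = "x / d3" and t = "y / d3"]) simp_all
    then show "z \<in> {0}" by simp
  qed
  have Qc: "?K1 \<inter> ?K2 \<subseteq> {Q}"
  proof
    fix z assume "z \<in> ?K1 \<inter> ?K2"
    then obtain w where w: "w \<in> tile_region s d2" "z = Q + u * w" and z: "z \<in> tile_region s d1"
      by (auto simp: f_def)
    have u: "u * cnj u = 1" using uv(1) by (simp add: complex_norm_square[symmetric])
    have "Complex ((d1 - x) / d2) (y / d2) = - cnj u"
      unfolding u_def R_def Q_def using pos by (simp add: complex_eq_iff field_simps)
    moreover have "w = u * cnj u * w" unfolding u by simp
    ultimately have "w = Complex ((d1 - x) / d2) (y / d2) * (complex_of_real d1 - z)"
      unfolding w(2) Q_def by (simp add: algebra_simps)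
    moreover have "((d1 - x) / d2)\<^sup>2 + (y / d2)\<^sup>2 = 1" using d2 pos by (simp add: power_divide add_divide_distrib[symmetric])
    moreover have "2 * (d1 * (d1 - x)) = d1\<^sup>2 + d2\<^sup>2 - d3\<^sup>2" using x2 by (simp add: algebra_simps power2_eq_square)
    then have "(d1 - x) / d2 * (1 + s\<^sup>2) < 1 - s\<^sup>2"
      using cos[of "d1 * (d1 - x)" d1 d2] A2 pos by simp
    ultimately have "w = 0" using y(1) pos s(2)
      by (intro tile_corner[OF w(1) z s(1), where c = "(d1 - x) / d2" and t = "y / d2"]) simp_all
    then show "z \<in> {Q}" using w by simp
  qed
  have Rc: "?K2 \<inter> ?K3 \<subseteq> {R}"
  proof
    fix z assume "z \<in> ?K2 \<inter> ?K3"
    then obtain w where w: "w \<in> tile_region s d2" "z = Q + u * w" by (auto simp: f_def)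
    obtain w' where w': "w' \<in> tile_region s d3" "z = R + v * w'"
      using \<open>z \<in> ?K2 \<inter> ?K3\<close> by (auto simp: g_def)
    have v: "v * cnj v = 1" using uv(2) by (simp add: complex_norm_square[symmetric])
    have "u * complex_of_real d2 = R - Q" using pos unfolding u_def by simp
    then have "v * w' = - u * (complex_of_real d2 - w)"
      using w(2) w'(2) by algebra
    then have "(v * cnj v) * w' = - (cnj v * u) * (complex_of_real d2 - w)"
      by algebra
    then have "w' = - (cnj v * u) * (complex_of_real d2 - w)" unfolding v by simp
    moreover have "- (cnj v * u) = Complex ((d3\<^sup>2 - x * d1) / (d2 * d3)) (d1 * y / (d2 * d3))"
      unfolding u_def v_def R_def Q_def y(2)[symmetric] using pos
      by (simp add: complex_eq_iff field_simps power2_eq_square)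
    ultimately have "w' = Complex ((d3\<^sup>2 - x * d1) / (d2 * d3)) (d1 * y / (d2 * d3)) * (complex_of_real d2 - w)"
      by simp
    moreover have "((d3\<^sup>2 - x * d1) / (d2 * d3))\<^sup>2 + (d1 * y / (d2 * d3))\<^sup>2 = 1"
    proof -
      have "(d3\<^sup>2 - x * d1)\<^sup>2 + (d1 * y)\<^sup>2 = (d2 * d3)\<^sup>2"
        unfolding power_mult_distrib d2[symmetric] y(2)[symmetric] by algebra
      then show ?thesis using pos by (simp add: power_divide add_divide_distrib[symmetric])
    qed
    moreover have e: "2 * (d3\<^sup>2 - x * d1) = d2\<^sup>2 + d3\<^sup>2 - d1\<^sup>2" using x2 by (simp add: algebra_simps power2_eq_square)
    have "(d3\<^sup>2 - x * d1) / (d2 * d3) * (1 + s\<^sup>2) < 1 - s\<^sup>2"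
      by (rule cos) (simp_all only: e A3 pos)
    ultimately have "w' = 0" using y(1) pos s(2)
      by (intro tile_corner[OF w'(1) w(1) s(1), where c = "(d3\<^sup>2 - x * d1) / (d2 * d3)" and t = "d1 * y / (d2 * d3)"]) simp_all
    then show "z \<in> {R}" using w' by simp
  qed
  have L: "link (m1 + m2 - 1) 0 R (?K1 \<union> ?K2) (V1 \<union> f ` V2) (E1 \<union> (`) f ` E2)"
    by (rule link_chain[OF L1 L2 Qc])
  have "(?K1 \<union> ?K2) \<inter> ?K3 \<subseteq> {0, R}" using P Rc by blast
  note C = link_close[OF L L3 this]
  \<comment> \<open>Keeps the truncated subtraction in \<open>m1 + m2 - 1\<close> exact.\<close>
  have "0 < m1" using 1(3) unfolding link_def matchstick_graph_def by (auto simp: card_gt_0_iff)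
  then have "m1 + m2 - 1 + m3 - 2 = m1 + m2 + m3 - 3" by simp
  with C show ?thesis by metis
qed

subsection \<open>Existence of configurations near approximate ones\<close>

text \<open>Brouwer's theorem on a cube, transported from vectors to functions on \<open>nat\<close>
  by an enumeration \<open>h\<close> of the index type. The enumeration is chosen in the proof,
  hence continuity is assumed for every \<open>h\<close>. Arguments beyond \<open>CARD('n)\<close>
  repeat some coordinate of the vector and so obey the same bound.\<close>

lemma brouwer_indexed:
  fixes \<Psi> :: "(nat \<Rightarrow> real) \<Rightarrow> nat \<Rightarrow> real"
  assumes "0 \<le> \<delta>"
    and cont: "\<And>k (h :: nat \<Rightarrow> 'n::finite). continuous_on UNIV (\<lambda>v :: real^'n. \<Psi> (\<lambda>j. v $ h j) k)"
    and bound: "\<And>y k. \<forall>j. \<bar>y j\<bar> \<le> \<delta> \<Longrightarrow> k < CARD('n) \<Longrightarrow> \<bar>\<Psi> y k\<bar> \<le> \<delta>"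
  shows "\<exists>y. (\<forall>j. \<bar>y j\<bar> \<le> \<delta>) \<and> (\<forall>k<CARD('n). \<Psi> y k = y k)"
proof -
  obtain h where h: "bij_betw h {0..<CARD('n)} (UNIV :: 'n set)"
    using ex_bij_betw_nat_finite[OF finite_class.finite_UNIV] by blast
  define g where "g = inv_into {0..<CARD('n)} h"
  have g: "g i < CARD('n)" "h (g i) = i" for i
    using h bij_betw_inv_into_right[OF h, of i] bij_betwE[OF bij_betw_inv_into[OF h]]
    unfolding g_def by auto
  define S :: "(real^'n) set" where "S = cbox (\<chi> i. - \<delta>) (\<chi> i. \<delta>)"
  have S: "v \<in> S \<longleftrightarrow> (\<forall>i. \<bar>v $ i\<bar> \<le> \<delta>)" for v
    unfolding S_def mem_box_cart by (auto simp: abs_le_iff minus_le_iff)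
  define f where "f v = (\<chi> i. \<Psi> (\<lambda>j. v $ h j) (g i))" for v :: "real^'n"
  have "continuous_on S f"
    unfolding f_def by (intro continuous_on_vec_lambda continuous_on_subset[OF cont]) simp
  moreover have "f \<in> S \<rightarrow> S" using bound g(1) by (auto simp: S f_def)
  moreover have "0 \<in> S" using assms(1) by (simp add: S)
  ultimately obtain v where v: "v \<in> S" "f v = v"
    using brouwer[of S f] unfolding S_def by (metis compact_cbox convex_box(1) empty_iff)
  define y where "y j = v $ h j" for j
  have "\<forall>j. \<bar>y j\<bar> \<le> \<delta>" using v(1) unfolding S y_def by simp
  moreover have "\<Psi> y k = y k" if "k < CARD('n)" for k
  proof -
    have "g (h k) = k" unfolding g_def using h that by (simp add: bij_betw_def)
    then have "f v $ h k = \<Psi> y k" unfolding f_def y_def by simp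
    then show ?thesis unfolding v(2) y_def by simp
  qed
  ultimately show ?thesis by (intro exI[of _ y]) simp
qed

text \<open>A vertex is given by approximate coordinates in units of \<open>10\<^sup>-\<^sup>7\<close>, each with a row of an
  approximate inverse of the Jacobian of the squared edge lengths, in units of \<open>10\<^sup>-\<^sup>2\<close>. The
  exact coordinates are sought in the form \<open>q + C y\<close> with a small vector \<open>y\<close>; a fixed point of
  \<open>y \<mapsto> y - F (q + C y)\<close>, where \<open>F\<close> measures the errors of the edge lengths, solves
  \<open>F (q + C y) = 0\<close>. A coordinate with an empty row remains fixed.\<close>

type_synonym coord = "int \<times> int list"
type_synonym vertex = "coord \<times> coord"

text \<open>The shorter list counts as padded with zeros, so rows may omit trailing zeros and a
  fixed coordinate may have an empty row.\<close>

fun ladd :: "int list \<Rightarrow> int list \<Rightarrow> int list" where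
  "ladd [] ys = ys"
| "ladd (x # xs) [] = x # xs"
| "ladd (x # xs) (y # ys) = (x + y) # ladd xs ys"

definition lscale :: "int \<Rightarrow> int list \<Rightarrow> int list" where
  "lscale c = map (\<lambda>x. c * x)"

definition sum_abs :: "int list \<Rightarrow> int" where
  "sum_abs xs = sum_list (map abs xs)"

fun dot :: "int list \<Rightarrow> (nat \<Rightarrow> real) \<Rightarrow> real" where
  "dot [] y = 0"
| "dot (x # xs) y = x * y 0 + dot xs (\<lambda>i. y (Suc i))"

lemma dot_ladd: "dot (ladd xs ys) y = dot xs y + dot ys y"
  by (induction xs ys arbitrary: y rule: ladd.induct) (simp_all add: algebra_simps)

lemma dot_lscale: "dot (lscale c xs) y = c * dot xs y"
  by (induction xs arbitrary: y) (simp_all add: lscale_def algebra_simps)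

lemma dot_replicate: "dot (replicate k 0 @ [c]) y = c * y k"
  by (induction k arbitrary: y) simp_all

lemma sum_abs_simps: "sum_abs [] = 0" "sum_abs (x # xs) = \<bar>x\<bar> + sum_abs xs"
  by (simp_all add: sum_abs_def)

lemma abs_dot_le:
  assumes "\<forall>j. \<bar>y j\<bar> \<le> \<delta>"
  shows "\<bar>dot xs y\<bar> \<le> real_of_int (sum_abs xs) * \<delta>"
  using assms
proof (induction xs arbitrary: y)
  case (Cons x xs)
  have "\<bar>x * y 0\<bar> \<le> \<bar>x\<bar> * \<delta>" using Cons.prems by (simp add: abs_mult mult_left_mono)
  moreover have "\<bar>dot xs (\<lambda>i. y (Suc i))\<bar> \<le> real_of_int (sum_abs xs) * \<delta>"
    by (rule Cons.IH) (use Cons.prems in simp)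
  ultimately show ?case by (simp add: sum_abs_simps algebra_simps)
qed (simp add: sum_abs_def)

lemma continuous_on_dot:
  fixes h :: "nat \<Rightarrow> 'n::finite"
  shows "continuous_on UNIV (\<lambda>v :: real^'n. dot xs (\<lambda>j. v $ h j))"
  by (induction xs arbitrary: h) (auto intro!: continuous_intros)

definition coordinate :: "coord \<Rightarrow> (nat \<Rightarrow> real) \<Rightarrow> real" where
  "coordinate c y = real_of_int (fst c) / 10 ^ 7 + dot (snd c) y / 100"

definition position :: "vertex \<Rightarrow> (nat \<Rightarrow> real) \<Rightarrow> complex" where
  "position v y = Complex (coordinate (fst v) y) (coordinate (snd v) y)"

text \<open>The inequality says that the fixed point map sends the cube of radius \<open>10\<^sup>-\<^sup>6\<close> into itself, in units
  of \<open>1 / (2 * 10\<^sup>1\<^sup>6)\<close>: its terms bound the constant, the linear and the quadratic part of the edge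
  length error.\<close>

definition newton_edge :: "nat \<Rightarrow> vertex \<Rightarrow> vertex \<Rightarrow> bool" where
  "newton_edge k v w =
    (let dx = fst (fst v) - fst (fst w); dy = fst (snd v) - fst (snd w);
         rx = ladd (snd (fst v)) (lscale (- 1) (snd (fst w)));
         ry = ladd (snd (snd v)) (lscale (- 1) (snd (snd w)));
         res = ladd (ladd (lscale dx rx) (lscale dy ry)) (replicate k 0 @ [- 1000000000])
     in 100 * \<bar>dx * dx + dy * dy - 100000000000000\<bar> + 20 * sum_abs res + (sum_abs rx)\<^sup>2 + (sum_abs ry)\<^sup>2
          \<le> 20000000000)"

fun newton_edges :: "vertex list \<Rightarrow> nat \<Rightarrow> (nat \<times> nat) list \<Rightarrow> bool" where
  "newton_edges vs k [] = True"
| "newton_edges vs k (e # es) = (newton_edge k (vs ! fst e) (vs ! snd e) \<and> newton_edges vs (Suc k) es)"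

definition newton_check :: "vertex list \<Rightarrow> (nat \<times> nat) list \<Rightarrow> bool" where
  "newton_check vs es \<longleftrightarrow> newton_edges vs 0 es \<and>
     list_all (\<lambda>v. sum_abs (snd (fst v)) \<le> 10000 \<and> sum_abs (snd (snd v)) \<le> 10000) vs"

lemma newton_edges_nth:
  "newton_edges vs k es \<Longrightarrow> m < length es \<Longrightarrow> newton_edge (k + m) (vs ! fst (es ! m)) (vs ! snd (es ! m))"
proof (induction es arbitrary: k m)
  case (Cons e es)
  show ?case
  proof (cases m)
    case (Suc l)
    then show ?thesis using Cons.IH[of "Suc k" l] Cons.prems by simp
  qed (use Cons.prems in simp)
qed simp

text \<open>With half the error of the squared length as \<open>F\<close>, the gradient of an edge
  is its difference vector, so the linear part of component \<open>k\<close> has the coefficients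
  \<open>dx * rx + dy * ry\<close>. In the unit \<open>10^7 * 10^2\<close> of these products the
  identity matrix has entries \<open>10^9\<close>; \<open>res\<close> is thus row \<open>k\<close>
  of the deviation of Jacobian times approximate inverse from the identity.\<close>

lemma newton_edge_bound:
  assumes edge: "newton_edge k v w" and y: "\<forall>j. \<bar>y j\<bar> \<le> 1 / 10 ^ 6"
  shows "\<bar>y k - ((dist (position v y) (position w y))\<^sup>2 - 1) / 2\<bar> \<le> 1 / 10 ^ 6"
proof -
  define dx where "dx = fst (fst v) - fst (fst w)"
  define dy where "dy = fst (snd v) - fst (snd w)"
  define rx where "rx = ladd (snd (fst v)) (lscale (- 1) (snd (fst w)))"
  define ry where "ry = ladd (snd (snd v)) (lscale (- 1) (snd (snd w)))"
  define res where "res = ladd (ladd (lscale dx rx) (lscale dy ry)) (replicate k 0 @ [- 1000000000])"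
  define L where "L = dx * dx + dy * dy - 100000000000000"
  have "100 * \<bar>L\<bar> + 20 * sum_abs res + (sum_abs rx)\<^sup>2 + (sum_abs ry)\<^sup>2 \<le> 20000000000" (is "?lhs \<le> _")
    using edge unfolding newton_edge_def Let_def dx_def dy_def rx_def ry_def res_def L_def .
  then have "real_of_int ?lhs \<le> real_of_int 20000000000" by (simp only: of_int_le_iff)
  then have ineq: "100 * \<bar>real_of_int L\<bar> + 20 * real_of_int (sum_abs res) + (real_of_int (sum_abs rx))\<^sup>2
      + (real_of_int (sum_abs ry))\<^sup>2 \<le> 20000000000"
    by simp
  define a b where "a = dot rx y" and "b = dot ry y"
  have d: "(dist (position v y) (position w y))\<^sup>2 = (dx / 10 ^ 7 + a / 100)\<^sup>2 + (dy / 10 ^ 7 + b / 100)\<^sup>2"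
    unfolding dist_norm cmod_power2 position_def coordinate_def a_def b_def rx_def ry_def dx_def dy_def
    by (simp add: dot_ladd dot_lscale diff_divide_distrib add_divide_distrib algebra_simps)
  have "dot res y = dx * a + dy * b - 10 ^ 9 * y k"
    unfolding res_def a_def b_def by (simp add: dot_ladd dot_lscale dot_replicate)
  then have yk: "y k = (dx * a + dy * b - dot res y) / 10 ^ 9" by simp
  have eq: "y k - ((dist (position v y) (position w y))\<^sup>2 - 1) / 2
      = - (L / 200000000000000) - dot res y / 1000000000 - (a\<^sup>2 + b\<^sup>2) / 20000"
    unfolding d yk L_def by (simp add: power2_eq_square field_simps)
  have res: "\<bar>dot res y\<bar> \<le> real_of_int (sum_abs res) / 1000000" using abs_dot_le[OF y, of res] by simp
  have sq: "(dot r y)\<^sup>2 \<le> (real_of_int (sum_abs r))\<^sup>2 / 1000000000000" for r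
  proof -
    have "\<bar>dot r y\<bar>\<^sup>2 \<le> (real_of_int (sum_abs r) / 1000000)\<^sup>2"
      using abs_dot_le[OF y, of r] by (intro power_mono) simp_all
    then show ?thesis by (simp add: power_divide)
  qed
  note facts = ineq abs_le_D1[OF res] abs_le_D2[OF res] sq[of rx, folded a_def] sq[of ry, folded b_def]
    zero_le_power2[of a] zero_le_power2[of b] abs_ge_self[of "real_of_int L"] abs_ge_minus_self[of "real_of_int L"]
  define e where "e = - (L / 200000000000000) - dot res y / 1000000000 - (a\<^sup>2 + b\<^sup>2) / 20000"
  have "e \<le> 1 / 1000000" using facts unfolding e_def by argo
  moreover have "- e \<le> 1 / 1000000" using facts unfolding e_def by argo
  ultimately show ?thesis unfolding eq e_def[symmetric] by (simp add: abs_le_iff)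
qed

text \<open>The unknowns \<open>y\<close> are indexed by the edges, hence a type \<open>'n\<close>
  with one element per edge. That component \<open>k\<close> is a fixed point means that edge
  \<open>k\<close> has length exactly 1.\<close>

lemma newton_check_solution:
  assumes check: "newton_check vs es" and len: "length es = CARD('n::finite)"
  shows "\<exists>y. (\<forall>j. \<bar>y j\<bar> \<le> 1 / 10 ^ 6) \<and>
    (\<forall>(i, j)\<in>set es. dist (position (vs ! i) y) (position (vs ! j) y) = 1)"
proof -
  define F where "F y k = ((dist (position (vs ! fst (es ! k)) y) (position (vs ! snd (es ! k)) y))\<^sup>2 - 1) / 2" for y k
  have cont: "continuous_on UNIV (\<lambda>v :: real^'n. v $ h k - F (\<lambda>j. v $ h j) k)" for h :: "nat \<Rightarrow> 'n" and k
    unfolding F_def position_def coordinate_def dist_norm cmod_power2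
    by (intro continuous_intros continuous_on_dot) simp_all
  have bound: "\<bar>y k - F y k\<bar> \<le> 1 / 10 ^ 6" if "\<forall>j. \<bar>y j\<bar> \<le> 1 / 10 ^ 6" "k < CARD('n)" for y k
    unfolding F_def
  proof (rule newton_edge_bound)
    show "newton_edge k (vs ! fst (es ! k)) (vs ! snd (es ! k))"
      using newton_edges_nth[of vs 0 es k] check that(2) unfolding newton_check_def len by simp
  qed (rule that(1))
  have "\<exists>y. (\<forall>j. \<bar>y j\<bar> \<le> 1 / 10 ^ 6) \<and> (\<forall>k<CARD('n). y k - F y k = y k)"
    by (rule brouwer_indexed[OF _ cont bound]) simp_all
  then obtain y where y: "\<forall>j. \<bar>y j\<bar> \<le> 1 / 10 ^ 6" "\<And>k. k < CARD('n) \<Longrightarrow> y k - F y k = y k" by blast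
  have "dist (position (vs ! i) y) (position (vs ! j) y) = 1" if ij: "(i, j) \<in> set es" for i j
  proof -
    obtain k where k: "k < length es" "es ! k = (i, j)"
      using ij unfolding in_set_conv_nth by (elim exE conjE)
    have "k < CARD('n)" using k(1) by (simp only: len)
    then have "y k - F y k = y k" by (rule y(2))
    then have "F y k = 0" by linarith
    then have "(dist (position (vs ! i) y) (position (vs ! j) y))\<^sup>2 = 1\<^sup>2"
      unfolding F_def k(2) fst_conv snd_conv by simp
    then show ?thesis by (rule power2_eq_imp_eq) simp_all
  qed
  then have "\<forall>(i, j)\<in>set es. dist (position (vs ! i) y) (position (vs ! j) y) = 1" by auto
  with y(1) show ?thesis by (intro exI[of _ y] conjI)
qed

subsection \<open>Checking approximate configurations\<close>

type_synonym ipoint = "int \<times> int"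

text \<open>Coarse coordinates are in units of \<open>10\<^sup>-\<^sup>4\<close> and differ from the exact ones by at most 2 units,
  which accounts for the margins 2 and 4 in the checks below.\<close>

definition coarse :: "vertex \<Rightarrow> ipoint" where
  "coarse v = (fst (fst v) div 1000, fst (snd v) div 1000)"

definition approx :: "ipoint \<Rightarrow> complex \<Rightarrow> bool" where
  "approx a z \<longleftrightarrow> \<bar>10000 * Re z - real_of_int (fst a)\<bar> \<le> 2 \<and> \<bar>10000 * Im z - real_of_int (snd a)\<bar> \<le> 2"

text \<open>Rounding down costs less than one coarse unit. A row sum of at most 10000 limits the
  displacement to \<open>10000 * 10^-2 * 10^-6 = 10^-4\<close>, which is one more unit.\<close>

lemma approx_coordinate:
  assumes "\<forall>j. \<bar>y j\<bar> \<le> 1 / 10 ^ 6" "sum_abs (snd c) \<le> 10000"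
  shows "\<bar>10000 * coordinate c y - real_of_int (fst c div 1000)\<bar> \<le> 2"
proof -
  have "real_of_int (sum_abs (snd c)) \<le> real_of_int 10000" using assms(2) by (simp only: of_int_le_iff)
  then have dot: "\<bar>dot (snd c) y\<bar> \<le> 1 / 100" using abs_dot_le[OF assms(1), of "snd c"] by simp
  have "1000 * (fst c div 1000) \<le> fst c" "fst c < 1000 * (fst c div 1000) + 1000" by linarith+
  then have "real_of_int (1000 * (fst c div 1000)) \<le> real_of_int (fst c)"
    "real_of_int (fst c) < real_of_int (1000 * (fst c div 1000) + 1000)"
    by (simp_all only: of_int_le_iff of_int_less_iff)
  then have q: "1000 * real_of_int (fst c div 1000) \<le> real_of_int (fst c)"
    "real_of_int (fst c) < 1000 * real_of_int (fst c div 1000) + 1000" by simp_all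
  have "10000 * coordinate c y = real_of_int (fst c) / 1000 + 100 * dot (snd c) y"
    unfolding coordinate_def by simp
  then show ?thesis using dot q unfolding abs_le_iff by linarith
qed

lemma approx_position:
  assumes "\<forall>j. \<bar>y j\<bar> \<le> 1 / 10 ^ 6" "sum_abs (snd (fst v)) \<le> 10000" "sum_abs (snd (snd v)) \<le> 10000"
  shows "approx (coarse v) (position v y)"
  unfolding approx_def coarse_def position_def complex.sel fst_conv snd_conv
  using approx_coordinate[OF assms(1,2)] approx_coordinate[OF assms(1,3)] by blast

section \<open>Integer certificates for disjoint and for diverging segments\<close>

definition ipoint_apart :: "ipoint \<Rightarrow> ipoint \<Rightarrow> bool" where
  "ipoint_apart a b \<longleftrightarrow> \<bar>fst a - fst b\<bar> > 4 \<or> \<bar>snd a - snd b\<bar> > 4"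

definition idot :: "ipoint \<Rightarrow> complex \<Rightarrow> real" where
  "idot d z = Complex (real_of_int (fst d)) (real_of_int (snd d)) \<bullet> z"

definition below :: "ipoint \<Rightarrow> ipoint \<Rightarrow> ipoint \<Rightarrow> bool" where
  "below d a b \<longleftrightarrow> fst d * (fst b - fst a) + snd d * (snd b - snd a) > 4 * (\<bar>fst d\<bar> + \<bar>snd d\<bar>)"

definition separated :: "ipoint \<Rightarrow> ipoint \<Rightarrow> ipoint \<Rightarrow> ipoint \<Rightarrow> ipoint \<Rightarrow> bool" where
  "separated d a b a' b' \<longleftrightarrow>
    (if below d a a' then below d a b' \<and> below d b a' \<and> below d b b'
     else below d a' a \<and> below d a' b \<and> below d b' a \<and> below d b' b)"

definition inormal :: "ipoint \<Rightarrow> ipoint \<Rightarrow> ipoint" where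
  "inormal a b = (snd a - snd b, fst b - fst a)"

definition idiff :: "ipoint \<Rightarrow> ipoint \<Rightarrow> ipoint" where
  "idiff a b = (fst a - fst b, snd a - snd b)"

text \<open>The test for two edges from \<open>v\<close> to \<open>a\<close> and to
  \<open>b\<close>. Both have length 1, so \<open>v\<close> projects to the midpoint of
  \<open>a\<close> and \<open>b\<close>, and the direction from \<open>b\<close> to \<open>a\<close>
  separates them unless the edges nearly coincide.\<close>

definition diverging :: "ipoint \<Rightarrow> ipoint \<Rightarrow> ipoint \<Rightarrow> bool" where
  "diverging v a b \<longleftrightarrow> below (idiff a b) v a \<and> below (idiff a b) b v"

text \<open>Two disjoint segments are separated by a line parallel to one of them or, if they are
  collinear, perpendicular to them.\<close>

fun edge_pair_ok :: "((nat \<times> ipoint) \<times> (nat \<times> ipoint)) \<Rightarrow> ((nat \<times> ipoint) \<times> (nat \<times> ipoint)) \<Rightarrow> bool" where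
  "edge_pair_ok ((i, a), (j, b)) ((k, c), (l, d)) =
    (if i = k then diverging a b d else if i = l then diverging a b c
     else if j = k then diverging b a d else if j = l then diverging b a c
     else separated (inormal a b) a b c d \<or> separated (inormal c d) a b c d \<or> separated (idiff a b) a b c d)"

fun all_pairs :: "('a \<Rightarrow> 'a \<Rightarrow> bool) \<Rightarrow> 'a list \<Rightarrow> bool" where
  "all_pairs P [] = True"
| "all_pairs P (x # xs) = (list_all (P x) xs \<and> all_pairs P xs)"

lemma all_pairs_nth:
  "all_pairs P xs \<Longrightarrow> i < j \<Longrightarrow> j < length xs \<Longrightarrow> P (xs ! i) (xs ! j)"
proof (induction xs arbitrary: i j)
  case (Cons x xs)
  obtain l where l: "j = Suc l" using Cons.prems(2) by (cases j) auto
  show ?case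
  proof (cases i)
    case 0
    then show ?thesis using Cons.prems l by (simp add: list_all_length)
  next
    case (Suc k)
    then show ?thesis using Cons.prems l Cons.IH[of k l] by simp
  qed
qed simp

text \<open>The direction \<open>d\<close> is an exact integer vector, even if it was computed from
  rounded points. Only the two points carry errors, and their difference is off by at most 4 in each
  coordinate, weighted by the entries of \<open>d\<close>.\<close>

lemma below_imp_less:
  assumes "below d a b" "approx a z" "approx b w"
  shows "idot d z < idot d w"
proof -
  have err: "real_of_int k * (10000 * r' - 10000 * r) \<ge> real_of_int (k * (n' - n)) - 4 * \<bar>real_of_int k\<bar>"
    if "\<bar>10000 * r - real_of_int n\<bar> \<le> 2" "\<bar>10000 * r' - real_of_int n'\<bar> \<le> 2" for k n n' :: int and r r' :: real
  proof -
    define e where "e = (10000 * r' - 10000 * r) - real_of_int (n' - n)"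
    have "\<bar>e\<bar> \<le> 4" using that unfolding e_def by simp
    then have "\<bar>real_of_int k * e\<bar> \<le> \<bar>real_of_int k\<bar> * 4" by (simp add: abs_mult mult_left_mono)
    then show ?thesis unfolding e_def by (simp add: algebra_simps abs_le_iff)
  qed
  have "real_of_int (4 * (\<bar>fst d\<bar> + \<bar>snd d\<bar>)) < real_of_int (fst d * (fst b - fst a) + snd d * (snd b - snd a))"
    using assms(1) unfolding below_def by (simp only: of_int_less_iff)
  then have "0 < real_of_int (fst d) * (10000 * Re w - 10000 * Re z) + real_of_int (snd d) * (10000 * Im w - 10000 * Im z)"
    using err[of "Re z" "fst a" "Re w" "fst b" "fst d"] err[of "Im z" "snd a" "Im w" "snd b" "snd d"]
      assms(2,3) unfolding approx_def by simp
  then have "0 < 10000 * (idot d w - idot d z)"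
    unfolding idot_def inner_complex_def by (simp add: algebra_simps)
  then show ?thesis by simp
qed

lemma separated_segments:
  assumes "idot d a < idot d a'" "idot d a < idot d b'" "idot d b < idot d a'" "idot d b < idot d b'"
  shows "closed_segment a b \<inter> closed_segment a' b' = {}"
proof -
  define m where "m = max (idot d a) (idot d b)"
  define m' where "m' = min (idot d a') (idot d b')"
  have "closed_segment a b \<subseteq> {z. idot d z \<le> m}"
    unfolding idot_def by (rule closed_segment_subset) (auto simp: m_def idot_def convex_halfspace_le)
  moreover have "closed_segment a' b' \<subseteq> {z. idot d z \<ge> m'}"
    unfolding idot_def by (rule closed_segment_subset) (auto simp: m'_def idot_def convex_halfspace_ge)
  moreover have "m < m'" using assms unfolding m_def m'_def by simp
  ultimately show ?thesis by force
qed

text \<open>Going away from \<open>v\<close>, the linear functional strictly increases on one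
  segment and strictly decreases on the other.\<close>

lemma diverging_segments:
  assumes "idot d v < idot d a" "idot d b < idot d v"
  shows "closed_segment v a \<inter> closed_segment v b \<subseteq> {v}"
proof
  fix z assume z: "z \<in> closed_segment v a \<inter> closed_segment v b"
  obtain s where s: "0 \<le> s" "z = (1 - s) *\<^sub>R v + s *\<^sub>R a" using z unfolding closed_segment_def by blast
  obtain t where t: "0 \<le> t" "z = (1 - t) *\<^sub>R v + t *\<^sub>R b" using z unfolding closed_segment_def by blast
  have "idot d z = idot d v + s * (idot d a - idot d v)"
    unfolding s(2) idot_def by (simp add: inner_add_right algebra_simps)
  moreover have "idot d z = idot d v + t * (idot d b - idot d v)"
    unfolding t(2) idot_def by (simp add: inner_add_right algebra_simps)
  moreover have "t * (idot d b - idot d v) \<le> 0" using t(1) assms(2) by (simp add: mult_nonneg_nonpos)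
  ultimately have "s * (idot d a - idot d v) \<le> 0" by linarith
  then have "s = 0" using s(1) assms(1) by (simp add: mult_le_0_iff)
  then show "z \<in> {v}" using s(2) by simp
qed

lemma separated_imp_disjoint:
  assumes "separated n a b a' b'" "approx a z" "approx b w" "approx a' z'" "approx b' w'"
  shows "closed_segment z w \<inter> closed_segment z' w' = {}"
proof (cases "below n a a'")
  case True
  then have "below n a b'" "below n b a'" "below n b b'" using assms(1) unfolding separated_def by auto
  then show ?thesis
    by (intro separated_segments[OF below_imp_less[OF True assms(2,4)] below_imp_less[OF _ assms(2,5)]
      below_imp_less[OF _ assms(3,4)] below_imp_less[OF _ assms(3,5)]])
next
  case False
  then have "below n a' a" "below n a' b" "below n b' a" "below n b' b"
    using assms(1) unfolding separated_def by auto
  then have "closed_segment z' w' \<inter> closed_segment z w = {}"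
    by (intro separated_segments[OF below_imp_less[OF _ assms(4,2)] below_imp_less[OF _ assms(4,3)]
      below_imp_less[OF _ assms(5,2)] below_imp_less[OF _ assms(5,3)]])
  then show ?thesis by (simp only: Int_commute)
qed

lemma diverging_imp:
  assumes "diverging a b c" "approx a z" "approx b w" "approx c w'"
  shows "closed_segment z w \<inter> closed_segment z w' \<subseteq> {z}"
proof -
  have "below (idiff b c) a b" "below (idiff b c) c a" using assms(1) unfolding diverging_def by auto
  then show ?thesis
    by (intro diverging_segments[OF below_imp_less[OF _ assms(2,3)] below_imp_less[OF _ assms(4,2)]])
qed

lemma edge_pair_ok_imp:
  assumes ok: "edge_pair_ok ((i, a), (j, b)) ((k, c), (l, d))"
    and appr: "approx a (p i)" "approx b (p j)" "approx c (p k)" "approx d (p l)"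
  shows "closed_segment (p i) (p j) \<inter> closed_segment (p k) (p l) \<subseteq> {p i, p j} \<inter> {p k, p l}"
proof -
  consider (ik) "i = k" "diverging a b d" | (il) "i = l" "diverging a b c"
    | (jk) "j = k" "diverging b a d" | (jl) "j = l" "diverging b a c"
    | (sep) "separated (inormal a b) a b c d \<or> separated (inormal c d) a b c d \<or> separated (idiff a b) a b c d"
    using ok unfolding edge_pair_ok.simps by (meson)
  then show ?thesis
  proof cases
    case ik
    then show ?thesis using diverging_imp[OF ik(2) appr(1,2,4)] by auto
  next
    case il
    then show ?thesis
      using diverging_imp[OF il(2) appr(1,2,3)] by (auto simp: closed_segment_commute[of "p k"])
  next
    case jk
    then show ?thesis
      using diverging_imp[OF jk(2) appr(2,1,4)] by (auto simp: closed_segment_commute[of "p i"])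
  next
    case jl
    then show ?thesis
      using diverging_imp[OF jl(2) appr(2,1,3)]
      by (auto simp: closed_segment_commute[of "p i"] closed_segment_commute[of "p k"])
  next
    case sep
    then have "closed_segment (p i) (p j) \<inter> closed_segment (p k) (p l) = {}"
      using separated_imp_disjoint[OF _ appr] by meson
    then show ?thesis by simp
  qed
qed

section \<open>Exact configurations with certified approximations\<close>

definition fixed_x :: "vertex \<Rightarrow> bool" where "fixed_x v \<longleftrightarrow> fst v = (0, [])"
definition fixed_y :: "vertex \<Rightarrow> bool" where "fixed_y v \<longleftrightarrow> snd v = (0, [])"

definition incident :: "(nat \<times> nat) list \<Rightarrow> nat \<Rightarrow> nat" where
  "incident es i = length (filter (\<lambda>e. fst e = i \<or> snd e = i) es)"

text \<open>A vertex with a frozen coordinate has half of its final degree: the other two edges come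
  from a mirror image or, at the apex of a tile, from the neighbouring tile. Ordering the endpoints
  of an edge by \<open>fst e < snd e\<close> makes distinct pairs distinct edges.\<close>

definition graph_check :: "vertex list \<Rightarrow> (nat \<times> nat) list \<Rightarrow> bool" where
  "graph_check vs es \<longleftrightarrow>
    distinct es \<and> list_all (\<lambda>e. fst e < snd e \<and> snd e < length vs) es \<and>
    (let cs = map coarse vs in
     all_pairs ipoint_apart cs \<and>
     all_pairs edge_pair_ok (map (\<lambda>e. ((fst e, cs ! fst e), (snd e, cs ! snd e))) es)) \<and>
    list_all (\<lambda>i. incident es i = (if fixed_x (vs ! i) \<or> fixed_y (vs ! i) then 2 else 4)) [0..<length vs] \<and>
    list_all (\<lambda>v. fixed_y v \<or> 2 < snd (coarse v)) vs \<and>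
    list_all (\<lambda>e. \<not> fixed_y (vs ! fst e) \<or> \<not> fixed_y (vs ! snd e)) es"

text \<open>Collects what the geometry uses about the solution. Unit lengths and zero coordinates
  are exact, as rounded data could not yield them; all strict inequalities come from the
  approximation.\<close>

locale configuration =
  fixes vs :: "vertex list" and es :: "(nat \<times> nat) list" and p :: "nat \<Rightarrow> complex"
  assumes check: "graph_check vs es"
    and approx: "\<And>i. i < length vs \<Longrightarrow> approx (coarse (vs ! i)) (p i)"
    and unit: "\<And>e. e \<in> set es \<Longrightarrow> dist (p (fst e)) (p (snd e)) = 1"
    and fixed_x: "\<And>i. i < length vs \<Longrightarrow> fixed_x (vs ! i) \<Longrightarrow> Re (p i) = 0"
    and fixed_y: "\<And>i. i < length vs \<Longrightarrow> fixed_y (vs ! i) \<Longrightarrow> Im (p i) = 0"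
begin

definition "V = p ` {..<length vs}"
definition "edge e = {p (fst e), p (snd e)}"
definition "E = edge ` set es"

lemma index:
  assumes "e \<in> set es"
  shows "fst e < snd e" "fst e < length vs" "snd e < length vs"
  using check assms unfolding graph_check_def list_all_iff by fastforce+

lemma inj_p: "inj_on p {..<length vs}"
proof -
  have less: "p i \<noteq> p j" if "i < j" "j < length vs" for i j
  proof
    assume eq: "p i = p j"
    have "all_pairs ipoint_apart (map coarse vs)" using check unfolding graph_check_def Let_def by blast
    then have "ipoint_apart (coarse (vs ! i)) (coarse (vs ! j))"
      using all_pairs_nth[of ipoint_apart "map coarse vs" i j] that by simp
    moreover have le: "\<bar>k - l\<bar> \<le> 4"
      if "\<bar>r - real_of_int k\<bar> \<le> 2" "\<bar>r - real_of_int l\<bar> \<le> 2" for k l and r :: real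
    proof -
      have "real_of_int \<bar>k - l\<bar> \<le> real_of_int 4" using that by simp
      then show ?thesis by (simp only: of_int_le_iff)
    qed
    have "approx (coarse (vs ! i)) (p i)" "approx (coarse (vs ! j)) (p i)"
      using approx[of i] approx[of j] that eq by auto
    then have "\<bar>fst (coarse (vs ! i)) - fst (coarse (vs ! j))\<bar> \<le> 4"
      "\<bar>snd (coarse (vs ! i)) - snd (coarse (vs ! j))\<bar> \<le> 4"
      unfolding approx_def by (auto intro: le)
    ultimately show False unfolding ipoint_apart_def by linarith
  qed
  show ?thesis
  proof (rule inj_onI)
    fix i j assume "i \<in> {..<length vs}" "j \<in> {..<length vs}" "p i = p j"
    then show "i = j" using less[of i j] less[of j i] by (cases i j rule: linorder_cases) auto
  qed
qed

lemma p_eq_iff: "i < length vs \<Longrightarrow> j < length vs \<Longrightarrow> p i = p j \<longleftrightarrow> i = j"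
  using inj_p by (auto simp: inj_on_def)

lemma hulls:
  assumes "m < m'" "m' < length es"
  shows "convex hull (edge (es ! m)) \<inter> convex hull (edge (es ! m')) \<subseteq> edge (es ! m) \<inter> edge (es ! m')"
proof -
  let ?f = "\<lambda>e. ((fst e, map coarse vs ! fst e), (snd e, map coarse vs ! snd e))"
  have "all_pairs edge_pair_ok (map ?f es)" using check unfolding graph_check_def Let_def by blast
  then have "edge_pair_ok (?f (es ! m)) (?f (es ! m'))"
    using all_pairs_nth[of edge_pair_ok "map ?f es" m m'] assms by simp
  moreover have "es ! m \<in> set es" "es ! m' \<in> set es" using assms by simp_all
  note i = index[OF this(1)] index[OF this(2)]
  ultimately show ?thesis
    unfolding edge_def segment_convex_hull[symmetric]
    by (intro edge_pair_ok_imp) (auto simp: approx)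
qed

lemma matchstick_graph: "matchstick_graph V E"
  unfolding matchstick_graph_iff
proof (intro conjI ballI impI)
  show "finite V" unfolding V_def by simp
next
  fix e assume "e \<in> E"
  then obtain x where x: "x \<in> set es" "e = edge x" unfolding E_def by blast
  have "p (fst x) \<in> V" "p (snd x) \<in> V" using index[OF x(1)] unfolding V_def by blast+
  then show "\<exists>u v. e = {u, v} \<and> u \<in> V \<and> v \<in> V \<and> dist u v = 1"
    using unit[OF x(1)] x(2) unfolding edge_def by blast
next
  fix e f assume "e \<in> E" "f \<in> E" "e \<noteq> f"
  have nth: "\<exists>m<length es. g = edge (es ! m)" if "g \<in> E" for g
  proof -
    obtain x where "x \<in> set es" "g = edge x" using \<open>g \<in> E\<close> unfolding E_def by blast
    then show ?thesis by (metis in_set_conv_nth)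
  qed
  obtain m where m: "m < length es" "e = edge (es ! m)" using nth[OF \<open>e \<in> E\<close>] by blast
  obtain m' where m': "m' < length es" "f = edge (es ! m')" using nth[OF \<open>f \<in> E\<close>] by blast
  then have "m \<noteq> m'" using \<open>e \<noteq> f\<close> m by blast
  then show "convex hull e \<inter> convex hull f \<subseteq> e \<inter> f"
    using hulls[of m m'] hulls[of m' m] m m' by (cases m m' rule: linorder_cases) auto
qed

lemma degree_p:
  assumes i: "i < length vs"
  shows "degree E (p i) = (if fixed_x (vs ! i) \<or> fixed_y (vs ! i) then 2 else 4)"
proof -
  let ?I = "filter (\<lambda>e. fst e = i \<or> snd e = i) es"
  have "p i \<in> edge e \<longleftrightarrow> fst e = i \<or> snd e = i" if "e \<in> set es" for e
    using p_eq_iff[of i] i index[OF that] unfolding edge_def by auto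
  then have "{e \<in> E. p i \<in> e} = edge ` set ?I" unfolding E_def by auto
  moreover have "inj_on edge (set es)"
  proof (rule inj_onI)
    fix x y assume xy: "x \<in> set es" "y \<in> set es" "edge x = edge y"
    then have "fst x = fst y \<and> snd x = snd y \<or> fst x = snd y \<and> snd x = fst y"
      using index[OF xy(1)] index[OF xy(2)] unfolding edge_def doubleton_eq_iff by (simp add: p_eq_iff)
    then show "x = y" using index[OF xy(1)] index[OF xy(2)] by (auto simp: prod_eq_iff)
  qed
  then have "inj_on edge (set ?I)" by (rule inj_on_subset) simp
  moreover have "distinct ?I" using check unfolding graph_check_def by simp
  ultimately have "degree E (p i) = incident es i"
    unfolding degree_def incident_def by (simp add: card_image distinct_card del: set_filter)
  also have "\<dots> = (if fixed_x (vs ! i) \<or> fixed_y (vs ! i) then 2 else 4)"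
    using check i unfolding graph_check_def list_all_iff by simp
  finally show ?thesis .
qed

lemma Im_p:
  assumes "i < length vs"
  shows "0 \<le> Im (p i)" "Im (p i) = 0 \<longleftrightarrow> fixed_y (vs ! i)"
proof -
  have "fixed_y (vs ! i) \<or> 2 < snd (coarse (vs ! i))"
    using check assms unfolding graph_check_def list_all_iff by simp
  moreover have "0 < Im (p i)" if "2 < snd (coarse (vs ! i))"
    using approx[OF assms] that unfolding approx_def by linarith
  ultimately show "0 \<le> Im (p i)" "Im (p i) = 0 \<longleftrightarrow> fixed_y (vs ! i)"
    using fixed_y[OF assms] by force+
qed

lemma upper_graph: "upper_graph V E"
  unfolding upper_graph_def
proof (intro conjI ballI matchstick_graph)
  fix v assume "v \<in> V"
  then obtain i where i: "i < length vs" "v = p i" unfolding V_def by blast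
  show "0 \<le> Im v" "degree E v \<noteq> 0" unfolding i(2) using Im_p(1)[OF i(1)] degree_p[OF i(1)] by simp_all
next
  fix e assume "e \<in> E"
  then obtain x where x: "x \<in> set es" "e = edge x" unfolding E_def by blast
  then have "\<not> fixed_y (vs ! fst x) \<or> \<not> fixed_y (vs ! snd x)"
    using check unfolding graph_check_def list_all_iff by blast
  then have "0 < Im (p (fst x)) \<or> 0 < Im (p (snd x))"
    using Im_p[OF index(2)[OF x(1)]] Im_p[OF index(3)[OF x(1)]] by force
  then show "\<exists>v\<in>e. 0 < Im v" unfolding x(2) edge_def by blast
qed

lemma card_subset_V:
  assumes "\<And>i. i < length vs \<Longrightarrow> P (p i) \<longleftrightarrow> Q (vs ! i)"
  shows "card {v \<in> V. P v} = length (filter Q vs)"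
proof -
  have "{v \<in> V. P v} = p ` {i. i < length vs \<and> Q (vs ! i)}" unfolding V_def using assms by auto
  moreover have "inj_on p {i. i < length vs \<and> Q (vs ! i)}" by (rule inj_on_subset[OF inj_p]) auto
  ultimately show ?thesis by (simp add: card_image length_filter_conv_card)
qed

lemma card_mirror_V: "card (mirror V) = length vs + length (filter (\<lambda>v. \<not> fixed_y v) vs)"
proof -
  have fin: "finite V" unfolding V_def by simp
  have "card V = length vs" using inj_p unfolding V_def by (simp add: card_image)
  moreover have "card {v \<in> V. Im v \<noteq> 0} = length (filter (\<lambda>v. \<not> fixed_y v) vs)"
    by (rule card_subset_V) (simp add: Im_p(2))
  ultimately show ?thesis
    using card_mirror[OF fin] upper_graph unfolding upper_graph_def by simp
qed

end

lemma ex_configuration: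
  assumes newton: "newton_check vs es" and graph: "graph_check vs es" and len: "length es = CARD('n::finite)"
  shows "\<exists>p. configuration vs es p"
proof -
  obtain y where y: "\<forall>j. \<bar>y j\<bar> \<le> 1 / 10 ^ 6"
      "\<forall>(i, j)\<in>set es. dist (position (vs ! i) y) (position (vs ! j) y) = 1"
    using newton_check_solution[OF newton len] by blast
  have "configuration vs es (\<lambda>i. position (vs ! i) y)"
  proof
    show "graph_check vs es" by (rule graph)
    show "approx (coarse (vs ! i)) (position (vs ! i) y)" if "i < length vs" for i
      using newton that unfolding newton_check_def list_all_iff by (intro approx_position[OF y(1)]) simp_all
    show "dist (position (vs ! fst e) y) (position (vs ! snd e) y) = 1" if "e \<in> set es" for e
      using y(2) that by fastforce
  qed (simp_all add: fixed_x_def fixed_y_def position_def coordinate_def)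
  then show ?thesis by blast
qed

text \<open>The apex of a half-graph is its vertex number 0; the slope \<open>s\<close> is in thousandths.\<close>

definition tile_check :: "int \<Rightarrow> vertex list \<Rightarrow> bool" where
  "tile_check s vs \<longleftrightarrow>
    (let h = snd (coarse (vs ! 0)) in
     2 < h \<and> 0 \<le> s \<and> vs \<noteq> [] \<and> fixed_x (vs ! 0) \<and> \<not> fixed_y (vs ! 0) \<and>
     list_all (\<lambda>v. \<not> fixed_x v \<and>
       1000 * (fst (coarse v) + 2) \<le> s * (h - snd (coarse v) - 4) \<and>
       2 - fst (coarse v) \<le> 10 * (h - snd (coarse v) - 4)) (tl vs))"

context configuration
begin

lemma tile:
  assumes tile: "tile_check s vs"
  shows "tile (real_of_int s / 1000) (length vs + length (filter (\<lambda>v. \<not> fixed_y v) vs))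
    (real_of_int (snd (coarse (vs ! 0)) - 2) / 5000) (real_of_int (snd (coarse (vs ! 0)) + 2) / 5000)"
    (is "tile ?s ?m ?a ?b")
proof -
  define H where "H = snd (coarse (vs ! 0))"
  define h where "h = Im (p 0)"
  have H: "2 < H" "0 \<le> s" and ne: "vs \<noteq> []" and apex: "fixed_x (vs ! 0)" "\<not> fixed_y (vs ! 0)"
    using tile unfolding tile_check_def Let_def H_def by blast+
  have nth: "\<not> fixed_x (vs ! i) \<and> 1000 * (fst (coarse (vs ! i)) + 2) \<le> s * (H - snd (coarse (vs ! i)) - 4) \<and>
       2 - fst (coarse (vs ! i)) \<le> 10 * (H - snd (coarse (vs ! i)) - 4)" if "0 < i" "i < length vs" for i
  proof -
    obtain k where "i = Suc k" using \<open>0 < i\<close> by (cases i) auto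
    then have "vs ! i \<in> set (tl vs)" using that by (metis Suc_less_eq length_tl less_diff_conv nth_mem nth_tl Suc_eq_plus1)
    then show ?thesis using tile unfolding tile_check_def Let_def H_def list_all_iff by blast
  qed
  have n: "0 < length vs" using ne by simp
  have h: "\<bar>10000 * h - real_of_int H\<bar> \<le> 2" using approx[OF n] unfolding approx_def h_def H_def by blast
  have p0: "p 0 = Complex 0 h" using fixed_x[OF n apex(1)] unfolding h_def by (simp add: complex_eq_iff)
  have h0: "0 < h" using abs_le_D2[OF h] H(1) by linarith
  have slopes: "Re (p i) \<le> ?s * (h - Im (p i))" "- Re (p i) \<le> 10 * (h - Im (p i))" if i: "i < length vs" for i
  proof (atomize (full), cases "i = 0")
    case True
    then show "Re (p i) \<le> ?s * (h - Im (p i)) \<and> - Re (p i) \<le> 10 * (h - Im (p i))" by (simp add: p0)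
  next
    case False
    define X Y where "X = fst (coarse (vs ! i))" and "Y = snd (coarse (vs ! i))"
    have appr: "\<bar>10000 * Re (p i) - real_of_int X\<bar> \<le> 2" "\<bar>10000 * Im (p i) - real_of_int Y\<bar> \<le> 2"
      using approx[OF i] unfolding approx_def X_def Y_def by auto
    note XY = abs_le_D1[OF appr(1)] abs_le_D2[OF appr(1)] abs_le_D1[OF appr(2)] abs_le_D2[OF appr(2)]
    have "real_of_int (1000 * (X + 2)) \<le> real_of_int (s * (H - Y - 4))"
      "real_of_int (2 - X) \<le> real_of_int (10 * (H - Y - 4))"
      using nth[of i] False i unfolding X_def Y_def by (simp_all only: of_int_le_iff neq0_conv)
    then have le: "1000 * (real_of_int X + 2) \<le> real_of_int s * (real_of_int H - real_of_int Y - 4)"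
      "2 - real_of_int X \<le> 10 * (real_of_int H - real_of_int Y - 4)" by simp_all
    have d: "real_of_int H - real_of_int Y - 4 \<le> 10000 * (h - Im (p i))" using abs_le_D2[OF h] XY(3) by argo
    have "1000 * (10000 * Re (p i)) \<le> 1000 * (real_of_int X + 2)" using XY(1) by argo
    also have "\<dots> \<le> real_of_int s * (10000 * (h - Im (p i)))"
      using le(1) mult_left_mono[OF d, of "real_of_int s"] H(2) by simp
    also have "\<dots> = 10000000 * (?s * (h - Im (p i)))" by (simp add: algebra_simps)
    finally have "Re (p i) \<le> ?s * (h - Im (p i))" by simp
    moreover have "- Re (p i) \<le> 10 * (h - Im (p i))" using le(2) d XY(2) by argo
    ultimately show "Re (p i) \<le> ?s * (h - Im (p i)) \<and> - Re (p i) \<le> 10 * (h - Im (p i))" by blast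
  qed
  \<comment> \<open>Swaps the coordinates and shifts: \<open>(x, y)\<close> goes to
    \<open>(h + y, x)\<close>. The imaginary axis, which carries both apexes, becomes the line of
    the base from \<open>0\<close> to \<open>2 * h\<close>, and its right side, where the slope
    \<open>s\<close> was checked, becomes the upper side.\<close>
  define f where "f z = complex_of_real h + \<i> * cnj z" for z
  interpret f: plane_isometry f "\<lambda>z. \<i> * cnj z" "complex_of_real h"
    unfolding f_def by (rule plane_isometry_reflection) simp
  let ?R = "tile_region ?s (2 * h)"
  \<comment> \<open>The slopes were checked only as seen from the upper apex. Points of the
    half-graph are at least as far, in height, from the lower apex, so its conditions are weaker;
    for mirror images the two apexes exchange roles.\<close>
  have region: "f w \<in> ?R" if w: "w \<in> mirror V" for w
  proof -
    obtain i where i: "i < length vs" "w = p i \<or> w = cnj (p i)"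
      using w unfolding mirror_def V_def by blast
    have "?s * Im (p i) \<ge> 0" using Im_p(1)[OF i(1)] H(2) by simp
    then have "Re (p i) \<le> ?s * (h + Im (p i))" "- Re (p i) \<le> 10 * (h + Im (p i))"
      using slopes[OF i(1)] Im_p(1)[OF i(1)] by (simp_all add: algebra_simps)
    then show ?thesis using slopes[OF i(1)] i(2) unfolding tile_region_def f_def by auto
  qed
  have hull: "convex hull e \<subseteq> f -` ?R" if "e \<in> mirror_edges E" for e
  proof -
    have "e \<subseteq> mirror V" using matchstick_graph_edge_subset[OF matchstick_graph_mirror[OF upper_graph] that] .
    then have "f ` e \<subseteq> ?R" using region by blast
    then have "convex hull (f ` e) \<subseteq> ?R" by (rule hull_minimal) (rule convex_tile_region)
    then show ?thesis unfolding f.hull_f by blast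
  qed
  have Im0: "Im (p 0) \<noteq> 0" using h0 unfolding h_def by simp
  have ends: "w = p 0 \<or> w = cnj (p 0) \<longleftrightarrow> i = 0" if "i < length vs" "w = p i \<or> w = cnj (p i)" for i w
  proof -
    have "p i \<noteq> cnj (p 0)"
    proof
      assume "p i = cnj (p 0)"
      then have "Im (p i) = - h" by (simp add: h_def)
      then show False using Im_p(1)[OF that(1)] h0 by linarith
    qed
    moreover from this have "cnj (p i) \<noteq> p 0" by (metis complex_cnj_cnj)
    ultimately show ?thesis using that p_eq_iff[OF that(1) n] by (metis complex_cnj_cnj)
  qed
  have deg: "degree (mirror_edges E) w = (if w = cnj (p 0) \<or> w = p 0 then 2 else 4)" if w: "w \<in> mirror V" for w
  proof -
    obtain i where i: "i < length vs" "w = p i \<or> w = cnj (p i)"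
      using w unfolding mirror_def V_def by blast
    have "fixed_x (vs ! i) \<longleftrightarrow> i = 0" using nth[of i] apex(1) i(1) by (cases "i = 0") auto
    then have d: "degree E (p i) = (if i = 0 \<or> fixed_y (vs ! i) then 2 else 4)" using degree_p[OF i(1)] by simp
    have "degree (mirror_edges E) w = (if i = 0 then 2 else 4)"
    proof (cases "fixed_y (vs ! i)")
      case True
      then have "Im (p i) = 0" "i \<noteq> 0" using Im_p(2)[OF i(1)] apex(2) by metis+
      moreover from this have "w = p i" using i(2) by (auto simp: complex_eq_iff)
      ultimately show ?thesis using d True degree_mirror_axis[OF upper_graph, of w] by simp
    next
      case False
      then have "0 < Im (p i)" using Im_p[OF i(1)] by force
      then show ?thesis using d False i(2) degree_mirror_off_axis[OF upper_graph, of "p i"] by auto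
    qed
    then show ?thesis using ends[OF i] by auto
  qed
  have mem: "p 0 \<in> mirror V" "cnj (p 0) \<in> mirror V" using n unfolding mirror_def V_def by auto
  have ne': "cnj (p 0) \<noteq> p 0" using Im0 by (auto simp: complex_eq_iff)
  have L: "link ?m (cnj (p 0)) (p 0) (f -` ?R) (mirror V) (mirror_edges E)"
    unfolding link_def
    using matchstick_graph_mirror[OF upper_graph] card_mirror_V mem ne' deg hull by blast
  have "f (cnj (p 0)) = 0" "f (p 0) = complex_of_real (2 * h)"
    unfolding f_def p0 by (simp_all add: complex_eq_iff)
  then have "link ?m 0 (complex_of_real (2 * h)) (f ` (f -` ?R)) (f ` mirror V) ((`) f ` mirror_edges E)"
    using f.link_image[OF L] by simp
  then have "link ?m 0 (complex_of_real (2 * h)) ?R (f ` mirror V) ((`) f ` mirror_edges E)"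
    by (rule link_mono) blast
  moreover have "0 < ?a" "?a \<le> 2 * h" "2 * h \<le> ?b"
    using abs_le_D1[OF h] abs_le_D2[OF h] H(1) unfolding H_def[symmetric] by simp_all
  ultimately show ?thesis unfolding tile_def by blast
qed

end

section \<open>Quarters reflected in two perpendicular lines\<close>

definition double_mirror_check :: "vertex list \<Rightarrow> (nat \<times> nat) list \<Rightarrow> bool" where
  "double_mirror_check vs es \<longleftrightarrow>
    list_all (\<lambda>v. fixed_x v \<and> \<not> fixed_y v \<or> \<not> fixed_x v \<and> fst (coarse v) < - 2) vs \<and>
    list_all (\<lambda>e. \<not> fixed_x (vs ! fst e) \<or> \<not> fixed_x (vs ! snd e)) es"

context configuration
begin

text \<open>The count is by orbits of the group generated by both reflections. A vertex off the axes
  has four images and is counted by all four terms; a vertex on exactly one axis has two images; no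
  vertex lies on both axes.\<close>

lemma double_mirror:
  assumes double: "double_mirror_check vs es"
  shows "\<exists>W F. matchstick_graph W F \<and> four_regular W F \<and>
    card W = length vs + length (filter (\<lambda>v. \<not> fixed_y v) vs) + length (filter (\<lambda>v. \<not> fixed_x v) vs) +
      length (filter (\<lambda>v. \<not> fixed_x v \<and> \<not> fixed_y v) vs)"
proof -
  have Re_p: "Re (p i) \<le> 0 \<and> (Re (p i) = 0 \<longleftrightarrow> fixed_x (vs ! i)) \<and> \<not> (fixed_x (vs ! i) \<and> fixed_y (vs ! i))"
    if i: "i < length vs" for i
  proof -
    have "fixed_x (vs ! i) \<and> \<not> fixed_y (vs ! i) \<or> \<not> fixed_x (vs ! i) \<and> fst (coarse (vs ! i)) < - 2"
      using double i unfolding double_mirror_check_def list_all_iff by simp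
    moreover have "Re (p i) < 0" if "fst (coarse (vs ! i)) < - 2"
      using approx[OF i] that unfolding approx_def by linarith
    ultimately show ?thesis using fixed_x[OF i] by force
  qed
  have Re_edge: "\<exists>v\<in>e. Re v < 0" if e: "e \<in> E" for e
  proof -
    obtain x where x: "x \<in> set es" "e = edge x" using e unfolding E_def by blast
    then have "\<not> fixed_x (vs ! fst x) \<or> \<not> fixed_x (vs ! snd x)"
      using double unfolding double_mirror_check_def list_all_iff by blast
    then have "Re (p (fst x)) < 0 \<or> Re (p (snd x)) < 0"
      using Re_p[OF index(2)[OF x(1)]] Re_p[OF index(3)[OF x(1)]] by force
    then show ?thesis unfolding x(2) edge_def by blast
  qed
  \<comment> \<open>The quarter turn that carries the left half-plane to the upper one, so that the
    second reflection is again one in the real axis.\<close>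
  define f where "f z = 0 + - \<i> * z" for z
  interpret f: plane_isometry f "\<lambda>z. - \<i> * z" 0
    unfolding f_def by (rule plane_isometry_rotation) simp
  let ?V = "mirror V" and ?E = "mirror_edges E"
  have Im_f: "Im (f z) = - Re z" "Re (f z) = Im z" for z by (simp_all add: f_def)
  have deg: "degree ?E w = (if Re w = 0 then 2 else 4) \<and> Re w \<le> 0" if w: "w \<in> ?V" for w
  proof -
    obtain i where i: "i < length vs" "w = p i \<or> w = cnj (p i)"
      using w unfolding mirror_def V_def by blast
    then have Re: "Re w = Re (p i)" by auto
    have "degree ?E w = (if fixed_x (vs ! i) then 2 else 4)"
    proof (cases "fixed_y (vs ! i)")
      case True
      then have "Im (p i) = 0" using Im_p(2)[OF i(1)] by blast
      moreover from this have "w = p i" using i(2) by (auto simp: complex_eq_iff)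
      ultimately show ?thesis
        using degree_p[OF i(1)] Re_p[OF i(1)] True degree_mirror_axis[OF upper_graph, of w] by simp
    next
      case False
      then have "0 < Im (p i)" using Im_p[OF i(1)] by force
      then show ?thesis
        using degree_p[OF i(1)] False i(2) degree_mirror_off_axis[OF upper_graph, of "p i"] by auto
    qed
    then show ?thesis using Re_p[OF i(1)] unfolding Re by simp
  qed
  have up: "upper_graph (f ` ?V) ((`) f ` ?E)"
    unfolding upper_graph_def
  proof (intro conjI ballI)
    show "matchstick_graph (f ` ?V) ((`) f ` ?E)"
      by (rule f.matchstick_graph_image[OF matchstick_graph_mirror[OF upper_graph]])
  next
    fix v assume "v \<in> f ` ?V"
    then obtain w where w: "w \<in> ?V" "v = f w" by blast
    show "0 \<le> Im v" "degree ((`) f ` ?E) v \<noteq> 0"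
      using deg[OF w(1)] unfolding w(2) f.degree_image Im_f by simp_all
  next
    fix e assume "e \<in> (`) f ` ?E"
    then obtain d where d: "e = f ` d" "d \<in> E \<or> d \<in> (`) cnj ` E" unfolding mirror_edges_def by blast
    have "\<exists>v\<in>d. Re v < 0" using d(2) Re_edge by force
    then show "\<exists>v\<in>e. 0 < Im v" unfolding d(1) using Im_f by force
  qed
  let ?W = "mirror (f ` ?V)" and ?F = "mirror_edges ((`) f ` ?E)"
  have "degree ?F v = 4" if v: "v \<in> ?W" for v
  proof -
    obtain w where w: "w \<in> ?V" "v = f w \<or> v = cnj (f w)" using v unfolding mirror_def[of "f ` ?V"] by blast
    have d: "degree ((`) f ` ?E) (f w) = (if Re w = 0 then 2 else 4)" "Re w \<le> 0"
      using deg[OF w(1)] unfolding f.degree_image by simp_all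
    show ?thesis
    proof (cases "Re w = 0")
      case True
      then have "v = f w" "Im v = 0" using w(2) Im_f by (auto simp: complex_eq_iff)
      then show ?thesis using d True degree_mirror_axis[OF up, of v] by simp
    next
      case False
      then have "0 < Im (f w)" using d(2) Im_f by simp
      then show ?thesis using d False w(2) degree_mirror_off_axis[OF up, of "f w"] by auto
    qed
  qed
  then have reg: "four_regular ?W ?F" unfolding four_regular_def by blast
  have fin: "finite V" unfolding V_def by simp
  have fin': "finite ?V" using fin unfolding mirror_def by simp
  have "card ?W = card (f ` ?V) + card {v \<in> f ` ?V. Im v \<noteq> 0}"
    using card_mirror[of "f ` ?V"] fin' up unfolding upper_graph_def by simp
  moreover have inj: "inj_on f S" for S using f.inj_f by (rule inj_on_subset) simp
  then have "card (f ` ?V) = card ?V" by (simp add: card_image)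
  moreover have "{v \<in> f ` ?V. Im v \<noteq> 0} = f ` {v \<in> ?V. Re v \<noteq> 0}" using Im_f by auto
  then have "card {v \<in> f ` ?V. Im v \<noteq> 0} = card {v \<in> ?V. Re v \<noteq> 0}" using inj by (simp add: card_image)
  moreover have "{v \<in> ?V. Re v \<noteq> 0} = mirror {v \<in> V. Re v \<noteq> 0}" unfolding mirror_def by auto
  then have "card {v \<in> ?V. Re v \<noteq> 0} = card {v \<in> V. Re v \<noteq> 0} + card {v \<in> {v \<in> V. Re v \<noteq> 0}. Im v \<noteq> 0}"
    using card_mirror[of "{v \<in> V. Re v \<noteq> 0}"] fin upper_graph unfolding upper_graph_def by simp
  moreover have "card {v \<in> V. Re v \<noteq> 0} = length (filter (\<lambda>v. \<not> fixed_x v) vs)"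
    using Re_p by (intro card_subset_V) blast
  moreover have "card {v \<in> V. Re v \<noteq> 0 \<and> Im v \<noteq> 0} = length (filter (\<lambda>v. \<not> fixed_x v \<and> \<not> fixed_y v) vs)"
    using Re_p Im_p(2) by (intro card_subset_V) blast
  then have "card {v \<in> {v \<in> V. Re v \<noteq> 0}. Im v \<noteq> 0} = length (filter (\<lambda>v. \<not> fixed_x v \<and> \<not> fixed_y v) vs)"
    by (simp add: conj_assoc)
  ultimately have "card ?W = length vs + length (filter (\<lambda>v. \<not> fixed_y v) vs) + length (filter (\<lambda>v. \<not> fixed_x v) vs) +
      length (filter (\<lambda>v. \<not> fixed_x v \<and> \<not> fixed_y v) vs)"
    using card_mirror_V by simp
  with reg matchstick_graph_mirror[OF up] show ?thesis by blast
qed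

end

lemma tile_of_check:
  assumes "newton_check vs es" "graph_check vs es" "length es = CARD('n::finite)" "tile_check s vs"
    and "length vs + length (filter (\<lambda>v. \<not> fixed_y v) vs) = m" "snd (coarse (vs ! 0)) = h"
  shows "tile (real_of_int s / 1000) m (real_of_int (h - 2) / 5000) (real_of_int (h + 2) / 5000)"
  using ex_configuration[OF assms(1-3)] configuration.tile[OF _ assms(4)] assms(5,6) by blast

lemma double_mirror_of_check:
  assumes "newton_check vs es" "graph_check vs es" "length es = CARD('n::finite)" "double_mirror_check vs es"
    and "length vs + length (filter (\<lambda>v. \<not> fixed_y v) vs) + length (filter (\<lambda>v. \<not> fixed_x v) vs) +
      length (filter (\<lambda>v. \<not> fixed_x v \<and> \<not> fixed_y v) vs) = m"
  shows "\<exists>V E. matchstick_graph V E \<and> four_regular V E \<and> card V = m"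
  using ex_configuration[OF assms(1-3)] configuration.double_mirror[OF _ assms(4)] assms(5) by blast

subsection \<open>The tiles\<close>

definition vertices_22 :: "vertex list" where
  "vertices_22 = [
   ((0, []), (29366815, [8,19,0,0,-23,0,96,-8,-8,0,-33,-23,95,8,0,0,16,96,17,19,16])),
   ((-20759119, [-115,-78,-52,52,43,0,65,33,-19,-52,-26,-10,77,-115,0,0,22,65,2,-120,22]), (9074845,
    [0,99,24,-24,-17,0,0,-42,-17,24,-5,8,16,0,0,0,14,0,-12,8,14])),
   ((-10799645, [-115,-75,47,47,46,0,65,32,-16,-47,-25,-11,74,-115,0,0,19,65,4,-122,19]), (9974220,
    [0,60,33,33,-56,0,0,-25,-59,-33,-18,26,54,0,0,0,48,0,-39,27,48])),
   ((717592, [-115,-39,0,0,-23,58,65,16,16,0,-13,-23,38,-58,58,-58,-8,58,24,-39,50]), (19392596, [0,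
    16,0,0,-25,4,0,-7,-7,0,-33,-25,98,4,4,-4,15,100,18,16,20])),
   ((-24959975, [-115,-103,0,0,7,0,65,-57,-57,0,-38,7,112,-115,0,0,53,65,-23,-103,53]), (0, [])),
   ((-15000501, [-115,-110,-5,5,10,0,65,46,-53,5,-37,5,109,-115,0,0,50,65,-21,-105,50]), (899375,
    [0,77,58,-58,-39,0,0,-32,-41,-58,-13,18,38,0,0,0,34,0,-28,19,34])),
   ((-5041027, [-115,-107,0,0,14,0,65,45,45,0,-36,14,105,-115,0,0,47,65,-18,-107,47]), (1798750, [0,
    38,0,0,-79,0,0,-16,-16,0,-26,-79,76,0,0,0,68,0,-55,38,68])),
   ((4795868, [-115,-113,0,0,28,0,65,48,48,0,70,28,91,-115,0,0,35,65,-8,-113,35]), (0, [])),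
   ((-8279132, [-115,-22,0,0,-13,32,65,9,9,0,-7,-13,21,-32,-32,-32,-4,32,13,-22,28]), (23758253, [0,
    51,0,0,-4,-48,0,-21,-21,0,-22,-4,64,56,48,48,22,48,-3,51,-25])),
   ((-7561540, [-115,-60,0,0,-37,-25,65,25,25,0,-20,-37,59,-90,25,-25,-12,90,37,-60,78]), (13784033,
    [0,48,0,0,-6,-52,0,-20,-20,0,-23,-6,66,52,52,-52,22,52,-2,48,-22])),
   ((1435184, [-115,-77,0,0,-47,0,65,33,33,0,-26,-47,76,-115,0,0,100,65,48,-77,100]), (9418376, [0,
    13,0,0,-27,0,0,-5,-5,0,-34,-27,101,0,0,0,23,0,20,13,23])),
   ((-16558264, [-115,-43,0,0,-26,0,65,18,18,0,-15,-26,43,-115,0,0,-9,65,27,-43,-9]), (18149690, [0,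
    83,0,0,15,0,0,-35,-35,0,-11,15,32,0,0,0,29,0,-23,83,29]))]"

definition edges_22 :: "(nat \<times> nat) list" where
  "edges_22 = [(0,8), (1,4), (1,2), (2,5), (2,11), (3,9), (0,3), (4,5), (5,6), (1,5), (6,7),
    (2,6), (7,10), (8,11), (3,8), (8,9), (9,10), (3,10), (6,10), (1,11), (9,11)]"

lemma newton_22: "newton_check vertices_22 edges_22"
  by code_simp

lemma graph_22: "graph_check vertices_22 edges_22"
  by code_simp

text \<open>Of the 24 coordinates of the 12 vertices three are frozen, one at the apex and two on
  the mirror line. This leaves 21 unknowns, one per edge.\<close>

lemma length_edges_22: "length edges_22 = CARD(21)"
  by (simp add: edges_22_def)

text \<open>All tiles use the same slope, as they share one triangle. The value 0.27 is just above
  the steepest slope that occurs, about 0.266 in the tile with 36 vertices; it asks for angles above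
  roughly 30.2 degrees.\<close>

lemma tile_22: "tile (27 / 100) 22 (587 / 100) (588 / 100)"
proof -
  have check: "tile_check 270 vertices_22" by code_simp
  have m: "length vertices_22 + length (filter (\<lambda>v. \<not> fixed_y v) vertices_22) = 22" by code_simp
  have h: "snd (coarse (vertices_22 ! 0)) = 29366" by code_simp
  show ?thesis
    by (rule tile_weaken[OF tile_of_check[OF newton_22 graph_22 length_edges_22 check m h]]) simp_all
qed

definition vertices_30 :: "vertex list" where
  "vertices_30 = [
   ((0, []), (39484697, [-5,3,17,0,0,99,11,-9,13,-6,2,0,99,19,9,-15,-11,92,-22,8,6,8,-6,6,-25,17,103,2,
    -20])),
   ((-14662473, [35,2,50,0,0,60,-33,-58,-127,13,-115,0,60,-140,-29,12,33,139,-33,-11,-13,-114,13,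
    -13,43,50,106,-115,39]), (2791592, [-18,-83,17,0,0,0,-17,-23,40,-35,0,0,0,74,-15,9,17,36,-9,-49,
    35,5,-35,35,25,17,19,0,-19])),
   ((-8354084, [14,9,91,-28,28,88,21,7,-64,-6,-115,-28,60,-58,18,-19,-21,57,-13,15,6,-71,-6,6,-39,3,
    79,-88,-30]), (24312048, [-13,-2,-33,-51,51,51,0,-13,48,-2,0,-51,0,50,-1,-4,0,60,-14,0,2,46,-2,
    2,-3,15,60,51,-4])),
   ((202925, [9,6,60,58,58,58,14,5,-42,-4,-115,-58,60,-38,12,-12,-14,38,-9,10,4,-47,-4,4,-26,2,52,
    -58,-20]), (29486756, [-4,3,18,1,1,100,12,-9,12,-6,0,-1,0,18,9,-15,-12,93,-22,8,6,7,-6,6,-25,17,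
    104,1,-21])),
   ((-4663386, [35,0,50,0,0,60,-33,42,-126,13,-115,0,60,-139,-29,14,33,138,-33,-12,-13,-114,13,-13,
    44,50,106,-115,39]), (2926724, [-9,6,40,0,0,0,-30,-19,24,-12,0,0,0,36,-35,-87,30,74,-17,18,12,
    12,-12,12,-55,40,44,0,-45])),
   ((-21881287, [28,62,37,0,0,60,-20,-41,-155,-74,-115,0,60,-113,-18,6,20,113,-26,24,-38,-118,38,
    -38,25,37,92,-115,53]), (9711760, [-25,-21,4,0,0,0,-4,-6,10,19,0,0,0,102,-4,2,4,9,-2,-12,9,1,-9,
    9,6,4,5,0,-5])),
   ((-8557009, [5,3,31,30,-30,30,7,2,-22,-2,-115,-30,60,-20,6,-6,-7,20,-5,5,2,-24,-2,2,-13,1,27,-30,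
    -10]), (34309989, [-13,-2,-35,-49,49,49,-1,-13,49,-2,0,49,0,51,-1,-4,1,59,-14,0,2,47,-2,2,-3,15,
    59,52,-4])),
   ((-24264921, [-75,-23,55,0,0,60,-38,-65,-115,3,-115,0,60,-118,-33,15,38,149,-35,-25,-3,-112,3,-3,
    51,55,112,-115,33]), (0, [])),
   ((-6909832, [25,7,91,0,0,60,50,23,-102,0,-115,0,60,-102,-64,-42,-50,102,-24,7,0,-102,0,0,-12,91,
    151,-115,-7]), (12671132, [-11,8,50,0,0,0,-11,-23,30,-15,0,0,0,45,-43,3,11,66,-15,23,15,15,-15,
    15,-68,50,55,0,-56])),
   ((2652295, [28,5,78,0,0,60,59,29,-109,4,-115,0,60,-113,-53,-49,54,113,-26,1,-4,-105,4,-4,5,78,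
    137,-115,7]), (9744408, [-2,1,9,0,0,0,19,-4,6,-3,0,0,0,9,-8,-20,7,102,-24,4,3,3,-3,3,-13,9,10,0,
    -11])),
   ((4898742, [37,-2,37,0,0,60,-23,48,-134,16,-115,0,60,-150,-18,40,23,116,77,-18,-16,-118,16,-16,
    61,37,92,-115,53]), (0, [])),
   ((-12278838, [25,54,32,0,0,60,-15,-35,-167,-64,-115,0,60,-103,-14,3,15,102,-24,38,64,-119,48,-48,
    18,32,87,-115,58]), (12503352, [-16,7,22,0,0,0,-22,-29,50,-16,0,0,0,65,-19,11,22,45,-11,-61,16,
    6,-43,43,32,22,24,0,-24])),
   ((-19497652, [19,34,20,0,0,60,-3,-18,-116,-39,-115,0,60,-76,-3,-4,3,76,-18,73,39,-123,-39,-73,-1,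
    20,73,-115,72]), (19423520, [-23,-14,9,0,0,0,-9,-11,103,10,0,0,0,93,-7,5,9,18,-4,-24,-10,3,10,
    17,13,9,9,0,-10])),
   ((-9895203, [16,26,15,0,0,60,2,-12,-95,-29,-115,0,60,-66,1,-6,-2,65,-15,55,29,-124,-29,29,-8,15,
    68,-115,78]), (22215112, [-14,14,26,0,0,0,-26,-34,32,-24,0,0,0,56,-22,14,26,54,-13,38,24,8,-24,
    24,38,26,29,0,-29])),
   ((405849, [19,11,120,0,0,60,28,9,-85,-9,-115,0,60,-76,24,-25,-28,76,-18,20,9,-93,-9,9,-51,120,
    104,-115,-39]), (19488815, [-4,3,19,0,0,0,12,-9,11,-6,0,0,0,17,10,-15,-12,93,-22,9,6,6,-6,6,-26,
    19,105,0,-21])),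
   ((-17114017, [10,6,2,0,0,60,15,5,-44,-4,-115,0,60,-39,12,-13,-15,39,-9,10,4,-48,-4,4,-26,2,54,
    -115,-20]), (29135280, [-21,-7,13,0,0,0,-13,-17,85,2,0,0,0,84,-11,7,13,27,-6,-9,-2,87,2,-2,19,
    13,14,0,13]))]"

definition edges_30 :: "(nat \<times> nat) list" where
  "edges_30 = [(1,7), (1,11), (2,15), (2,3), (3,6), (3,14), (4,9), (1,4), (5,12), (1,5), (0,6),
    (2,6), (0,3), (5,7), (8,14), (4,8), (8,9), (9,10), (4,10), (11,13), (5,11),
    (12,15), (11,12), (12,13), (8,13), (2,14), (9,14), (6,15), (13,15)]"

lemma newton_30: "newton_check vertices_30 edges_30"
  by code_simp

lemma graph_30: "graph_check vertices_30 edges_30"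
  by code_simp

lemma length_edges_30: "length edges_30 = CARD(29)"
  by (simp add: edges_30_def)

lemma tile_30: "tile (27 / 100) 30 (789 / 100) (790 / 100)"
proof -
  have check: "tile_check 270 vertices_30" by code_simp
  have m: "length vertices_30 + length (filter (\<lambda>v. \<not> fixed_y v) vertices_30) = 30" by code_simp
  have h: "snd (coarse (vertices_30 ! 0)) = 39484" by code_simp
  show ?thesis
    by (rule tile_weaken[OF tile_of_check[OF newton_30 graph_30 length_edges_30 check m h]]) simp_all
qed

definition vertices_31 :: "vertex list" where
  "vertices_31 = [
   ((0, []), (37459908, [87,-1,0,0,7,0,98,-102,140,139,0,120,7,-193,71,3,0,0,-8,98,37,-97,-150,-60,17,
    139,28,3,-1,-8])),
   ((-2665596, [47,-166,0,0,136,0,60,-426,340,570,0,614,136,-628,-17,-115,0,0,-58,60,66,-186,-474,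
    -115,-39,570,-62,-115,-166,-58]), (0, [])),
   ((-21658670, [56,-94,-51,51,82,0,60,-167,90,171,-51,173,31,-215,36,-115,0,0,-11,60,28,-34,-159,
    -21,-34,222,-56,-115,-140,-11]), (18130988, [24,104,27,-27,-31,0,0,85,39,-84,27,-73,-5,48,30,0,
    0,0,27,0,-22,-59,29,-36,56,-110,90,0,15,27])),
   ((-11668640, [55,-91,49,49,83,0,60,-164,88,168,-49,169,29,-210,35,-115,0,0,-12,60,29,-34,-156,
    -21,-34,217,-55,-115,-140,-12]), (18577431, [53,56,31,31,-51,0,0,-1,86,-27,-31,16,34,-63,49,0,0,
    0,44,0,-35,-76,-54,-47,38,4,61,0,25,44])),
   ((264178, [29,-48,0,0,-3,58,60,-87,47,115,0,89,-3,-111,19,-58,58,-58,-25,58,38,-18,-82,-11,-18,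
    115,-29,-115,-48,33]), (27463398, [88,-2,0,0,7,2,0,-104,142,142,0,123,7,-196,71,2,2,-2,-9,100,
    38,-98,-152,-60,17,142,27,0,-2,-7])),
   ((-6450266, [74,-139,0,0,81,0,60,-227,119,301,0,334,81,-385,37,-115,0,0,-11,60,27,-30,-204,-18,
    -55,301,-89,-115,-139,-11]), (9256148, [11,11,0,0,-23,0,0,82,18,-110,0,-114,-23,99,22,0,0,0,20,
    0,-16,64,110,40,-7,-110,-11,0,11,20])),
   ((-16277025, [80,-134,-3,3,66,0,60,-240,130,219,3,248,63,-309,52,-115,0,0,3,60,17,-50,-229,-31,
    -50,319,-80,-115,-132,3]), (9702590, [40,78,58,-58,-42,0,0,39,64,-53,-58,-25,16,-12,40,0,0,0,36,
    0,-29,-68,-16,-42,46,-49,75,0,20,36])),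
   ((-6286995, [79,-132,0,0,67,0,60,-237,128,314,0,244,67,-304,51,-115,0,0,2,60,17,-49,-225,-30,-49,
    314,-79,-115,-132,2]), (10149033, [69,30,0,0,-61,0,0,-48,111,66,0,64,-61,-123,59,0,0,0,53,0,-43,
    -86,-98,-53,28,66,46,0,30,53])),
   ((3458128, [85,-143,0,0,89,0,60,-256,138,340,0,375,89,-329,29,-115,0,0,-18,60,33,-53,-243,-33,
    -53,340,-85,-115,-143,-18]), (7905694, [97,-18,0,0,37,0,0,-132,157,178,0,185,37,-231,-35,0,0,0,
    -32,0,26,-103,-178,-64,11,178,18,0,-18,-32])),
   ((-8525143, [15,-25,0,0,-2,30,60,-45,24,60,0,47,-2,-58,10,-30,-30,-30,-13,30,20,-9,-43,-6,-9,60,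
    -15,-115,-25,17]), (32232868, [62,40,0,0,10,-49,0,-28,101,41,0,44,10,-98,55,52,49,49,13,49,4,
    -82,-80,-51,32,41,52,0,40,-36])),
   ((-8260965, [44,-74,0,0,-5,-28,60,-132,71,175,0,136,-5,-169,28,-88,28,-28,-38,88,58,-27,-125,-17,
    -27,175,-44,-115,-74,50]), (22236359, [63,39,0,0,10,-51,0,-31,102,44,0,47,10,-101,55,51,51,-51,
    13,51,5,-83,-82,-51,32,44,52,0,39,-35])),
   ((528355, [58,-97,0,0,-7,0,60,-173,93,230,0,179,-7,-222,37,-115,0,0,65,60,76,-36,-165,-22,-36,
    230,-58,-115,-97,65]), (17466888, [88,-3,0,0,7,0,0,-107,143,145,0,125,7,-199,72,0,0,0,-6,0,39,
    -98,-154,-61,16,145,26,0,-3,-6])),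
   ((-10234936, [100,-113,0,0,26,0,60,-27,162,31,0,54,26,-142,90,-115,0,0,37,60,-11,-138,65,78,-72,
    31,-116,-115,-113,37]), (0, [])),
   ((-16358660, [78,-135,0,0,73,0,60,-289,125,261,0,293,73,-349,45,-115,0,0,-4,60,22,-32,-165,-20,
    -58,261,-93,-115,-135,-4]), (7905694, [-18,-18,0,0,37,0,0,-203,-29,178,0,185,37,-161,-35,0,0,0,
    -32,0,26,82,-178,50,11,178,18,0,-18,-32])),
   ((-22482384, [55,-158,0,0,120,0,60,-551,89,491,0,532,120,-557,-1,-115,0,0,-45,60,55,73,-395,45,
    -207,491,-70,-115,-158,-45]), (0, [])),
   ((-26267054, [81,-131,0,0,65,0,60,-244,132,222,0,252,65,-314,52,-115,0,0,3,60,16,-50,-232,-31,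
    -50,222,-81,-115,-131,3]), (9256148, [11,11,0,0,-23,0,0,125,18,-110,0,-114,-23,99,22,0,0,0,20,0,
    -16,-50,67,-31,64,-110,103,0,11,20])),
   ((-17050286, [30,-51,0,0,-3,0,60,-91,49,120,0,93,-3,-116,19,-115,0,0,-26,60,40,-19,-86,-12,-19,
    120,-30,-115,-51,-26]), (27005829, [38,82,0,0,13,0,0,46,61,-57,0,-32,13,-3,39,0,0,0,35,0,-28,
    -67,-9,-41,48,-57,77,0,82,35]))]"

definition edges_31 :: "(nat \<times> nat) list" where
  "edges_31 = [(1,8), (2,15), (2,3), (3,6), (3,16), (4,10), (0,4), (5,13), (1,5), (6,7), (2,6),
    (7,8), (3,7), (5,8), (8,11), (9,16), (4,9), (9,10), (10,11), (4,11), (7,11),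
    (5,12), (13,15), (12,13), (13,14), (6,15), (14,15), (0,9), (2,16), (10,16)]"

lemma newton_31: "newton_check vertices_31 edges_31"
  by code_simp

lemma graph_31: "graph_check vertices_31 edges_31"
  by code_simp

lemma length_edges_31: "length edges_31 = CARD(30)"
  by (simp add: edges_31_def)

lemma tile_31: "tile (27 / 100) 31 (749 / 100) (750 / 100)"
proof -
  have check: "tile_check 270 vertices_31" by code_simp
  have m: "length vertices_31 + length (filter (\<lambda>v. \<not> fixed_y v) vertices_31) = 31" by code_simp
  have h: "snd (coarse (vertices_31 ! 0)) = 37459" by code_simp
  show ?thesis
    by (rule tile_weaken[OF tile_of_check[OF newton_31 graph_31 length_edges_31 check m h]]) simp_all
qed

definition vertices_33 :: "vertex list" where
  "vertices_33 = [
   ((0, []), (38601125, [-8,9,34,0,0,94,101,-17,26,7,11,0,94,19,1,-103,66,-11,-19,2,-7,33,7,-7,-50,34,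
    114,45,-136,80,11,-45])),
   ((-19380791, [66,56,69,0,0,67,142,-82,-121,30,-115,0,67,-151,-35,-191,121,11,19,26,-30,-91,30,
    -30,-44,69,131,44,-196,77,-115,-16]), (733163, [-29,-51,26,0,0,0,41,-41,41,-25,0,0,0,66,-21,-69,
    44,11,19,-26,25,16,-25,25,-5,26,29,7,-59,12,0,-30])),
   ((-7205445, [13,-24,90,-24,24,91,46,36,-41,-10,-115,-24,67,-31,28,-12,8,-24,-43,-14,10,-51,-10,
    10,-42,0,73,35,-57,62,-91,-54]), (22850520, [-15,20,-7,-53,53,53,80,-33,45,11,0,-53,0,33,-12,
    -98,62,0,0,9,-11,56,11,-11,-31,34,81,29,-110,52,53,-21])),
   ((944085, [8,-15,57,57,57,57,29,23,-26,-6,-115,-57,67,-19,18,-8,5,-15,-27,-9,6,-32,-6,6,-27,0,46,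
    22,-36,39,-57,-34]), (28645790, [-8,8,39,5,5,100,104,-15,24,6,0,-5,0,17,3,-104,66,-12,-22,1,-6,
    30,6,-6,-53,34,119,47,-139,84,5,-49])),
   ((-14298237, [23,-36,76,0,0,67,83,56,-70,-18,-115,0,67,-52,-41,-124,8,-49,-87,-18,18,-87,-18,18,
    -6,76,139,68,-102,120,-115,-23]), (9345227, [-3,3,22,0,0,0,76,-6,11,3,0,0,0,8,-18,-109,110,46,
    81,0,-3,13,3,-3,-28,22,25,-7,-115,-13,0,-26])),
   ((-25002273, [48,98,47,0,0,67,108,-48,-155,-53,-115,0,67,-111,-18,-134,85,2,3,47,-51,-104,51,-51,
    -40,47,107,38,-148,67,-115,9]), (9003529, [-41,-22,11,0,0,0,18,-18,18,39,0,0,0,94,-9,-30,19,5,8,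
    -11,11,7,-11,11,-2,11,13,3,-26,5,0,-13])),
   ((-8149531, [5,-9,33,33,-33,33,17,13,-15,-4,-115,-33,67,-11,10,-4,3,-9,-16,-5,4,-19,-4,4,-15,0,
    27,13,-21,23,-33,-20]), (32805855, [-15,21,-13,-47,47,47,78,-35,47,12,0,47,0,35,-13,-97,61,2,3,
    9,-12,59,12,-12,-28,34,76,27,-106,48,58,-17])),
   ((-29353879, [-36,52,71,0,0,67,145,-85,-118,28,-115,0,67,-147,-37,-196,124,11,20,24,-28,-90,28,
    -28,-44,71,133,44,-201,78,-115,-18]), (0, [])),
   ((-4425516, [24,-37,66,0,0,67,81,59,-75,-19,-115,0,67,-56,-33,-25,16,-41,-72,-18,19,-93,-19,19,7,
    66,127,61,-101,108,-115,-12]), (10935626, [-13,12,85,0,0,0,88,-24,40,11,0,0,0,29,-69,-97,61,-5,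
    -10,1,-11,51,11,-11,-104,85,95,36,-118,64,0,-98])),
   ((-4425516, [24,-37,66,0,0,67,138,59,-75,-19,-115,0,67,-56,-33,-75,-41,-51,-91,-18,19,-93,-19,19,
    7,66,127,71,-50,126,-115,-12]), (7754828, [6,-6,-40,0,0,0,-208,11,-19,-5,0,0,0,-14,32,193,-196,
    33,58,-1,5,-24,-5,5,49,-40,-44,13,203,24,0,46])),
   ((-10739202, [32,-44,17,0,0,67,-118,72,-98,-25,-115,0,67,-73,7,162,-282,-169,-19,-19,25,-123,-25,
    25,67,17,73,87,200,155,-115,45]), (0, [])),
   ((-15029186, [47,94,45,0,0,67,105,-45,-158,-51,-115,0,67,-107,-16,-129,82,1,1,49,51,-106,53,-53,
    -39,45,105,37,-143,66,-115,12]), (9736692, [-20,42,38,0,0,0,59,-59,59,14,0,0,0,45,-31,-99,63,15,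
    27,-37,-14,23,-36,36,-7,38,42,10,-84,17,0,-44])),
   ((-20650667, [29,40,23,0,0,67,71,-11,-97,-30,-115,0,67,-67,2,-71,45,-8,-14,71,30,-119,-30,-74,
    -35,23,80,32,-95,57,-115,37]), (18007057, [-32,6,23,0,0,0,36,-36,101,28,0,0,0,72,-19,-60,38,9,
    17,-22,-28,14,28,22,-4,23,26,6,-51,10,0,-26])),
   ((-10677580, [28,36,21,0,0,67,68,-8,-92,-28,-115,0,67,-63,3,-66,42,-9,-16,64,28,-120,-28,28,-35,
    21,78,31,-90,56,-115,39]), (18740220, [-10,70,49,0,0,0,77,-77,27,3,0,0,0,24,-40,-130,82,20,36,
    67,-3,29,3,-3,-9,49,55,13,-110,22,0,-57])),
   ((1888171, [17,-30,114,0,0,67,58,45,-52,-13,-115,0,67,-39,36,-15,10,-30,-54,-17,13,-64,-13,13,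
    -53,114,93,44,-72,79,-115,-68]), (18690454, [-7,6,45,0,0,0,107,-12,21,6,0,0,0,16,5,-104,66,-14,
    -24,1,-6,27,6,-6,-55,45,123,49,-142,87,0,-52])),
   ((1888171, [17,-30,114,0,0,67,394,45,-52,-13,-115,0,67,-39,-72,-313,200,-91,-162,-17,13,-64,-13,
    13,-53,114,182,213,-300,97,-115,-68]), (0, [])),
   ((5447206, [26,-38,56,0,0,67,86,62,-79,-20,-115,0,67,-59,-24,-27,18,-43,-76,-18,20,-99,-20,20,19,
    56,116,64,1,113,-115]), (9345227, [-3,3,22,0,0,0,117,-6,11,3,0,0,0,8,-18,-109,69,-18,-33,0,-3,
    13,3,-3,-28,22,25,57,-115,101,0,-26])),
   ((-16299061, [10,-18,0,0,0,67,34,26,-30,-7,-115,0,67,-23,21,-9,6,-18,-31,-10,7,-37,-7,7,-31,0,54,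
    26,-42,46,-115,-40]), (27010586, [-22,34,34,0,0,0,54,-54,68,17,0,0,0,51,-28,-91,57,14,25,17,-17,
    86,17,-17,-6,34,38,9,-77,16,0,10]))]"

definition edges_33 :: "(nat \<times> nat) list" where
  "edges_33 = [(1,7), (1,11), (2,17), (2,3), (3,6), (3,14), (4,9), (1,4), (5,12), (1,5), (0,6),
    (2,6), (0,3), (5,7), (8,14), (4,8), (9,16), (9,10), (4,10), (11,13), (5,11),
    (12,17), (11,12), (12,13), (8,13), (2,14), (14,16), (9,15), (8,16), (15,16),
    (6,17), (13,17)]"

lemma newton_33: "newton_check vertices_33 edges_33"
  by code_simp

lemma graph_33: "graph_check vertices_33 edges_33"
  by code_simp

lemma length_edges_33: "length edges_33 = CARD(32)"
  by (simp add: edges_33_def)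

text \<open>The certified length lies between 7.7198 and 7.7206. This straddles 7.72, hence an
  interval two hundredths wide.\<close>

lemma tile_33: "tile (27 / 100) 33 (771 / 100) (773 / 100)"
proof -
  have check: "tile_check 270 vertices_33" by code_simp
  have m: "length vertices_33 + length (filter (\<lambda>v. \<not> fixed_y v) vertices_33) = 33" by code_simp
  have h: "snd (coarse (vertices_33 ! 0)) = 38601" by code_simp
  show ?thesis
    by (rule tile_weaken[OF tile_of_check[OF newton_33 graph_33 length_edges_33 check m h]]) simp_all
qed

definition vertices_34 :: "vertex list" where
  "vertices_34 = [
   ((0, []), (35520517, [51,13,0,0,-104,0,114,479,147,-452,0,-482,-104,390,218,-43,0,0,112,114,-55,0,2,
    479,0,0,-79,-452,-79,-43,13,112,2])),
   ((-15641090, [-61,-41,0,0,-107,0,17,745,227,-652,0,-647,-107,607,179,-107,0,0,148,17,-115,0,4,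
    745,0,0,-179,-652,-179,-107,-41,148,4]), (0, [])),
   ((-27535185, [13,-25,-37,37,19,0,17,125,38,-132,-37,-126,-18,102,57,-107,0,0,39,17,-26,0,1,125,0,
    0,-46,-95,-46,-107,-102,39,1]), (26327112, [12,87,45,-45,-49,0,0,105,33,-122,45,-104,-4,83,47,0,
    0,0,42,0,-34,0,-1,105,0,0,60,-167,60,0,24,42,-1])),
   ((-18182285, [18,-34,57,57,-4,0,17,173,52,-189,-57,-175,-20,142,79,-107,0,0,59,17,-42,0,1,173,0,
    0,-64,-132,-64,-107,-91,59,1]), (22788289, [25,62,9,9,-109,0,0,232,72,-273,-9,-232,-10,187,105,
    0,0,0,94,0,-76,0,0,232,0,0,13,-264,13,0,53,94])),
   ((-3708805, [13,-25,0,0,-45,54,17,126,38,-96,0,-128,-45,103,57,-54,54,-54,13,54,6,0,1,126,0,0,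
    -47,-96,-47,-107,-25,66,1]), (26233711, [46,23,0,0,-86,-21,0,429,132,-413,0,-431,-86,348,195,
    -21,-21,21,107,93,-58,0,1,429,0,0,-60,-413,-60,0,23,86,1])),
   ((-18141090, [37,-90,0,0,-6,0,17,252,106,-159,0,-135,-6,95,81,-107,0,0,61,17,-44,0,3,252,0,0,
    -131,-159,-131,-107,-90,61,3]), (9682458, [25,-13,0,0,26,0,0,-127,72,127,0,132,26,-132,-25,0,0,
    0,-23,0,18,0,0,-127,0,0,13,127,13,0,-13,-23])),
   ((-25923445, [28,-51,20,-20,-44,0,17,259,79,-291,-20,-262,-24,212,118,-107,0,0,94,17,-71,0,2,259,
    0,0,-96,-197,-96,-107,-71,94,2]), (16457851, [14,83,54,-54,-59,0,0,127,40,-148,-54,-126,-5,101,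
    57,0,0,0,51,0,-42,0,-1,127,0,0,52,-184,52,0,29,51,-1])),
   ((-16570545, [33,-61,0,0,-67,0,17,308,93,-234,0,-310,-67,251,140,-107,0,0,113,17,-86,0,2,308,0,0,
    -114,-234,-114,-107,-61,113,2]), (12919029, [28,58,0,0,-119,0,0,254,79,-280,0,-254,-119,205,115,
    0,0,0,103,0,-83,0,0,254,0,0,5,-280,5,0,58,103])),
   ((-8505835, [41,-76,0,0,-34,0,17,388,117,-295,0,-277,-34,317,108,-107,0,0,85,17,-64,0,3,388,0,0,
    -144,-295,-144,-107,-76,85,3]), (7006293, [39,36,0,0,-74,0,0,364,112,-364,0,-377,-74,295,72,0,0,
    0,64,0,-52,0,1,364,0,0,-36,-364,-36,0,36,64,1])),
   ((-9897012, [2,-4,0,0,-7,8,17,19,6,-15,0,-20,-7,16,9,-8,-8,-8,2,8,1,0,0,19,0,0,-7,-15,-7,-107,-4,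
    10]), (34089033, [37,40,0,0,-57,-57,0,345,106,-349,0,-346,-57,280,157,14,57,57,99,57,-62,0,1,
    345,0,0,-29,-349,-29,0,40,42,1])),
   ((-13605817, [15,-29,0,0,-51,-45,17,146,44,-111,0,-147,-51,119,66,-62,45,-45,15,62,7,0,1,146,0,0,
    -54,-111,-54,-107,-29,76,1]), (24802227, [32,50,0,0,-39,-36,0,294,91,-311,0,-295,-39,238,134,36,
    36,-36,94,36,-65,0,0,294,0,0,-10,-311,-10,0,50,15])),
   ((-7417610, [27,-50,0,0,-89,0,17,253,77,-192,0,-255,-89,207,115,-107,0,0,132,17,13,0,2,253,0,0,
    -94,-192,-94,-107,-50,132,2]), (16946905, [41,33,0,0,-68,0,0,379,116,-375,0,-380,-68,307,172,0,
    0,0,59,0,-61,0,1,379,0,0,-42,-375,-42,0,33,59,1])),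
   ((-26891090, [44,-93,0,0,1,0,17,188,126,-123,0,-99,1,58,74,-107,0,0,54,17,-39,28,-84,216,28,-28,
    -155,-123,-127,-107,-93,54,3]), (4841229, [13,-6,0,0,13,0,0,-13,36,64,0,66,13,-66,-13,0,0,0,-11,
    0,9,-51,-50,-64,-51,51,57,64,6,0,-6,-11,-1])),
   ((-26708717, [30,-86,0,0,-14,0,17,203,85,-196,0,-174,-14,134,89,-107,0,0,67,17,-49,-30,-28,289,
    30,30,-104,-196,-134,-107,-86,67,2]), (14839566, [13,-6,0,0,13,0,0,-13,37,65,0,68,13,-68,-13,0,
    0,0,-12,0,9,-49,-51,-65,49,49,56,65,6,0,-6,-12,-1])),
   ((-35458717, [37,-90,0,0,-7,0,17,196,105,-161,0,-138,-7,97,82,-107,0,0,61,17,-44,-58,-55,254,58,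
    -58,-129,-161,-131,-107,-90,61,3]), (9998337, [0,0,0,0,0,0,0,0,1,1,0,1,0,-1,0,0,0,0,0,0,0,1,-1,
    -1,-1,1,100,1,0,0,0,0,-2])),
   ((-35276345, [22,-82,0,0,-22,0,17,211,64,-234,0,-213,-22,173,96,-107,0,0,74,17,-55,0,2,211,0,0,
    -78,-234,-78,-107,-82,74,2]), (19996674, [1,0,0,0,1,0,0,-1,2,3,0,3,1,-3,-1,0,0,0,0,0,0,0,-2,-1,
    0,0,99,3,99,0,0,0,-2])),
   ((-19794025, [4,-8,0,0,-14,0,17,39,12,-30,0,-39,-14,32,18,-107,0,0,4,17,2,0,0,39,0,0,-14,-30,-14,
    -107,-8,4]), (32657549, [23,66,0,0,-9,0,0,210,65,-247,0,-210,-9,169,95,0,0,0,85,0,-69,0,0,210,0,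
    0,21,-247,21,0,66,85])),
   ((-35641090, [51,-97,0,0,8,0,17,181,146,-88,0,-62,8,22,67,-107,0,0,48,17,-34,0,-112,181,0,0,-124,
    -88,-124,-107,-97,48,-112]), (0, []))]"

definition edges_34 :: "(nat \<times> nat) list" where
  "edges_34 = [(1,8), (2,15), (2,3), (3,6), (3,16), (4,10), (0,4), (5,13), (1,5), (6,7), (2,6),
    (7,8), (3,7), (5,8), (8,11), (9,16), (4,9), (9,10), (10,11), (4,11), (7,11),
    (12,14), (5,12), (13,15), (12,13), (13,14), (14,17), (6,15), (14,15), (0,9),
    (2,16), (10,16), (12,17)]"

lemma newton_34: "newton_check vertices_34 edges_34"
  by code_simp

lemma graph_34: "graph_check vertices_34 edges_34"
  by code_simp

lemma length_edges_34: "length edges_34 = CARD(33)"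
  by (simp add: edges_34_def)

lemma tile_34: "tile (27 / 100) 34 (710 / 100) (711 / 100)"
proof -
  have check: "tile_check 270 vertices_34" by code_simp
  have m: "length vertices_34 + length (filter (\<lambda>v. \<not> fixed_y v) vertices_34) = 34" by code_simp
  have h: "snd (coarse (vertices_34 ! 0)) = 35520" by code_simp
  show ?thesis
    by (rule tile_weaken[OF tile_of_check[OF newton_34 graph_34 length_edges_34 check m h]]) simp_all
qed

definition vertices_35 :: "vertex list" where
  "vertices_35 = [
   ((0, []), (34403292, [649,394,-307,0,0,-4,-95,-85,190,215,-74,0,0,-46,111,346,27,95,-4,1,115,0,-330,
    -74,87,0,-580,-46,115,-35,-307,-99,-4,87])),
   ((-18512296, [286,233,-123,0,0,-93,-49,-32,71,52,1,0,0,-106,49,212,23,49,-93,14,14,0,-98,1,53,0,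
    -217,-106,14,-39,-123,-141,-93,53]), (9908394, [23,-47,39,0,0,-4,12,11,-8,-39,8,0,0,0,4,-41,-3,
    -12,-4,1,0,0,41,8,-7,0,75,0,0,6,39,8,-4,-7])),
   ((-26417990, [310,237,-244,-22,22,-53,-53,-41,106,151,-35,-22,0,-106,53,212,20,53,-53,8,14,0,
    -212,-13,85,0,-278,-106,14,-65,-151,-106,-75,85]), (16032119, [202,53,-51,-53,53,72,-19,-26,38,
    -2,-39,-53,0,0,35,41,-2,19,72,-11,0,0,-25,14,34,0,-181,0,0,-27,-89,53,19,34])),
   ((-27768444, [143,109,-105,-35,-35,-24,-24,-19,49,70,24,35,0,-106,24,98,9,24,-24,4,14,0,-98,-11,
    34,0,-128,-106,14,-23,-70,-49,-103,34]), (25940513, [179,36,-32,46,46,76,-15,-23,30,-14,-31,-46,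
    0,0,31,25,-4,15,76,-11,0,0,-10,15,27,0,-160,0,0,-22,-78,61,15,27])),
   ((-29118898, [517,-204,276,0,0,-132,26,-68,-8,-347,83,0,0,-106,88,-202,-37,-26,-88,13,14,0,316,
    83,-17,0,-463,-106,14,18,276,-62,-132,-17]), (3784670, [156,-226,270,0,0,-27,-27,-20,-53,-270,
    55,0,0,0,27,-280,-97,27,80,-12,0,0,280,55,-48,0,-140,0,0,39,270,53,-27,-48])),
   ((-9256148, [478,365,-233,0,0,-82,-82,-62,93,233,-21,0,0,-106,82,327,31,82,-82,12,14,0,-212,-21,
    73,0,-427,-106,14,-55,-233,-163,-82,73]), (6123724, [492,275,-230,0,0,23,-68,-64,46,139,-47,0,0,
    0,84,239,17,68,23,-3,0,0,-239,-47,41,0,-440,0,0,-33,-230,-46,23,41])),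
   ((-18512296, [207,158,-158,-57,57,-35,-35,-27,71,101,1,57,0,-106,35,141,14,35,-35,5,14,0,-141,
    -12,53,0,-185,-106,14,-39,-101,-71,-93,53]), (22155843, [336,156,-162,-8,8,50,-42,-44,83,63,-86,
    8,0,0,57,132,6,42,50,-7,0,0,-117,13,75,0,-300,0,0,-60,-154,8,42,75])),
   ((-9931375, [20,15,-10,0,0,-3,-3,-3,7,10,-5,0,-7,-7,3,14,1,3,-3,0,14,7,-14,-5,1,-7,-18,-106,7,1,
    -10,-7,-3,8]), (33233764, [481,266,-225,0,0,25,-67,-63,133,133,-30,0,57,12,82,231,16,67,25,-4,0,
    -57,-216,-30,77,57,-430,0,57,-45,-225,-42,25,20])),
   ((-17161842, [859,578,-411,0,0,-64,-135,-112,128,341,-58,0,0,-106,20,512,44,135,-64,9,14,0,-397,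
    -58,105,0,-768,-106,14,-80,-411,-199,-64,105]), (0, [])),
   ((-27768444, [350,39,-13,0,0,-103,-60,-46,49,-58,24,0,0,-106,60,98,23,60,-60,9,14,0,17,24,34,0,
    -313,-106,14,-23,-13,-120,-103,34]), (13693064, [179,-259,309,0,0,-31,-15,-23,-61,-309,63,0,0,0,
    31,-321,-4,15,76,-11,0,0,321,63,-55,0,-160,0,0,44,309,61,-31,-55])),
   ((-37024592, [414,-54,98,0,0,-114,-71,-54,27,-168,47,0,0,-106,71,-17,27,-44,-71,10,14,0,131,47,
    14,0,-370,-106,14,-7,98,-98,-114,14]), (9908394, [23,-33,39,0,0,-4,12,-3,-8,-39,8,0,0,0,4,-41,
    -14,4,103,-15,0,0,41,8,-7,0,-20,0,0,6,39,8,-4,-7])),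
   ((-38375046, [581,-296,386,0,0,-143,15,-76,-30,-457,106,0,0,-106,99,-316,-76,-15,-56,-100,14,0,
    431,106,-37,0,-520,-106,14,34,386,-41,-143,-37]), (0, [])),
   ((-3952847, [155,119,-76,0,0,-27,-27,-20,53,76,-40,0,53,-53,27,106,10,27,-27,4,14,53,-106,-40,9,
    -53,-139,-106,53,9,-76,-53,-27,62]), (25217705, [582,343,-274,0,0,8,-84,-76,168,183,-56,0,-23,
    -23,99,300,22,84,8,-1,0,-23,-285,-56,83,23,-520,0,92,-39,-274,-76,8,61])),
   ((-17161842, [374,286,-183,0,0,-64,-64,-49,128,183,-58,0,0,-106,64,256,24,64,-64,9,14,0,-256,-58,
    105,0,-335,-106,14,-80,-183,-128,-64,105]), (12247449, [358,173,-165,0,0,46,-46,-47,91,74,-94,0,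
    0,0,61,148,8,46,46,-7,0,0,-132,-94,82,0,-321,0,0,-66,-165,0,46,82])),
   ((-13884222, [175,134,-85,0,0,-30,-30,-23,60,85,-45,0,46,-60,30,120,11,30,-30,4,14,-46,-120,-45,
    10,-46,-157,-106,60,10,-85,-60,-30,70]), (24048178, [414,215,-192,0,0,36,-55,-54,110,101,-13,0,
    35,35,71,186,11,55,36,-5,0,-35,-170,-13,74,-35,-370,0,35,-49,-192,-19,36,-7])),
   ((-19862750, [453,-111,166,0,0,-121,37,49,14,-237,60,0,0,-106,77,-87,3,-37,-121,18,14,0,202,60,2,
    0,-406,-106,14,2,166,-84,-121,2]), (0, [])),
   ((-7905694, [310,237,-151,0,0,-53,-53,-41,106,151,-80,0,0,-106,53,212,20,53,-53,8,14,0,-212,-80,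
    124,0,-278,-106,14,18,-151,-106,-53,124]), (16032119, [515,292,-241,0,0,19,-72,-67,145,150,-39,
    0,0,0,88,255,18,72,19,-3,0,0,-239,-39,34,0,-461,0,0,-43,-241,-53,19,34])),
   ((-35674138, [247,188,-191,0,0,-86,-42,-32,84,120,-13,0,0,-106,42,168,16,42,-42,6,14,0,-168,-13,
    66,0,-220,-106,14,-49,-191,-84,-86,66]), (19816788, [46,-66,79,0,0,-8,8,-6,-16,-79,16,0,0,0,8,
    -66,-13,-8,99,-14,0,0,82,16,-14,0,-41,0,0,11,79,107,-8,-14])),
   ((-19862750, [40,30,-19,0,0,-7,-7,-5,14,19,-10,0,0,-106,7,27,3,7,-7,1,14,0,-27,-10,2,0,-35,-106,
    14,2,-19,-14,-7,2]), (32064237, [313,138,-143,0,0,53,-38,-41,76,52,13,0,0,0,53,117,5,38,53,-8,0,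
    0,-101,13,68,0,-280,0,0,-55,-143,16,53,68]))]"

definition edges_35 :: "(nat \<times> nat) list" where
  "edges_35 = [(1,8), (1,9), (2,13), (2,3), (3,6), (3,17), (4,10), (4,15), (5,16), (1,5), (6,
    18), (2,6), (7,12), (7,18), (5,8), (9,17), (4,9), (9,10), (10,11), (4,11),
    (0,12), (12,14), (5,13), (6,13), (14,16), (7,14), (1,15), (0,7), (12,16),
    (13,16), (2,17), (10,17), (3,18), (14,18)]"

lemma newton_35: "newton_check vertices_35 edges_35"
  by code_simp

lemma graph_35: "graph_check vertices_35 edges_35"
  by code_simp

lemma length_edges_35: "length edges_35 = CARD(34)"
  by (simp add: edges_35_def)

lemma tile_35: "tile (27 / 100) 35 (688 / 100) (689 / 100)"
proof -
  have check: "tile_check 270 vertices_35" by code_simp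
  have m: "length vertices_35 + length (filter (\<lambda>v. \<not> fixed_y v) vertices_35) = 35" by code_simp
  have h: "snd (coarse (vertices_35 ! 0)) = 34403" by code_simp
  show ?thesis
    by (rule tile_weaken[OF tile_of_check[OF newton_35 graph_35 length_edges_35 check m h]]) simp_all
qed

definition vertices_36 :: "vertex list" where
  "vertices_36 = [
   ((0, []), (38702131, [0,3,0,28,0,-10,-21,-3,0,3,82,0,30,82,82,-1,82,0,5,3,-5,0,-3,0,0,28,29,0,-10,0,
    -6,29,-19,-10,-10])),
   ((-4514930, [-51,-66,61,-49,0,16,-12,-41,-46,-96,81,-61,-112,47,92,44,142,51,-13,-48,-2,-5,48,5,
    5,-43,-48,0,22,0,3,-48,38,22,16]), (21980427, [14,-39,43,41,0,-14,-17,8,12,29,0,-43,0,70,57,-13,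
    43,-14,9,16,-5,2,-16,-2,-1,40,42,0,-16,0,-7,42,-30,-16,-14])),
   ((-7084605, [-21,-62,-21,-20,0,7,-5,-17,-19,-41,81,21,-112,20,39,19,60,21,-5,-20,-1,-2,20,2,2,
    -18,-20,0,9,0,1,-20,16,9,7]), (31644627, [22,65,22,49,0,-17,-16,14,19,44,0,-22,0,62,43,-20,22,
    -22,11,23,-4,3,-23,-3,-2,46,50,0,-20,0,-7,50,-36,-20,-17])),
   ((-19297047, [6,-16,6,-101,11,-62,-26,4,9,-22,81,-6,-112,104,94,-11,88,-6,-30,-30,26,-4,30,4,3,
    -98,-107,-11,24,11,29,-96,-35,14,36]), (1826796, [8,-8,8,8,-57,-47,-7,8,11,-16,0,-8,0,28,17,-12,
    8,-8,-29,-25,26,-3,26,3,3,11,85,57,-39,-57,29,28,-19,17,-29])),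
   ((496677, [5,-15,5,-102,0,35,-25,-7,8,-21,81,-5,-112,102,92,-10,87,-5,-20,-28,14,-4,28,4,2,-99,
    -104,0,38,0,18,-104,71,38,35]), (2782625, [25,-23,25,24,0,-9,-21,-90,33,-48,0,-25,0,84,50,-35,
    25,-25,-3,-76,-25,-8,78,8,8,32,28,0,0,0,-17,28,-7,0,-9])),
   ((-1945255, [31,-39,31,-77,0,26,-19,-65,-72,-70,81,-31,-112,75,144,70,113,-31,-20,-75,-4,-8,76,8,
    8,-69,-76,0,35,0,5,-76,60,35,26]), (12316226, [36,-32,36,34,0,-12,-19,1,5,-68,0,-36,0,77,71,-7,
    36,-36,7,9,-5,1,-9,-1,-1,33,35,0,-13,0,-6,35,-24,-13,-12])),
   ((2569675, [-29,-85,82,-28,0,9,-7,-24,-26,-56,81,29,-112,27,53,26,82,29,-7,-28,-1,-3,28,3,3,-25,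
    -28,0,13,0,2,-28,22,13,9]), (29037931, [-8,-20,22,21,0,-7,-22,-10,-7,-12,0,8,0,90,96,5,104,8,3,
    -4,-6,0,4,0,1,21,22,0,-7,0,-5,22,-14,-7,-7])),
   ((10101727, [-2,-9,-2,-109,0,38,85,19,-1,-7,81,2,-112,77,78,0,80,2,-19,-6,21,-1,5,1,0,-108,-112,
    0,38,0,23,-112,73,38,38]), (0, [])),
   ((7709026, [24,-32,24,-84,0,28,-20,-71,32,-55,81,-24,-112,82,129,77,105,-24,-22,-83,-4,-9,84,9,8,
    -75,-84,0,39,0,5,-84,66,39,28]), (9709530, [6,-6,6,6,0,-2,-26,-22,8,-12,0,-6,0,104,13,19,6,-6,
    -1,-19,-6,-2,19,2,2,8,7,0,0,0,-4,7,-2,0,-2])),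
   ((5139351, [53,-58,53,-56,0,19,-14,-48,-53,-111,81,-53,-112,55,106,51,134,59,-15,-55,-3,-6,56,6,
    6,-50,-56,0,26,0,4,-56,44,26,19]), (19373731, [14,-13,14,13,0,-5,-24,-16,-14,-27,0,-14,0,97,110,
    12,14,16,1,-12,-6,-1,12,1,1,15,14,0,-3,0,-5,14,-8,-3,-5])),
   ((-3730042, [-2,-8,-2,-109,0,26,-19,-4,-2,-6,81,2,-112,76,77,0,79,2,35,-5,84,-1,4,1,0,-108,-78,0,
    -34,0,85,-78,-16,-34,26]), (11845453, [22,-20,22,21,0,-14,-18,22,29,-41,0,-22,0,72,43,-30,22,
    -22,23,-65,7,-7,66,7,7,28,40,0,-33,0,14,40,-48,-33,-14])),
   ((-13095597, [-5,-6,-5,-112,0,23,-16,-7,-6,0,81,5,-112,66,71,4,76,5,27,25,-24,-20,-5,-20,19,-92,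
    -68,0,-25,0,69,-68,-10,-25,23]), (15350648, [14,-12,14,13,0,-23,-11,14,18,-26,0,-14,0,45,27,-19,
    14,-14,2,13,3,-58,42,-50,59,72,67,0,-11,0,-28,67,-30,-11,-23])),
   ((-5377231, [-11,-1,-11,-117,0,17,-12,-13,-13,10,81,11,-112,48,60,12,71,11,13,4,-15,-55,-22,55,
    54,-62,-49,0,-10,0,41,-49,2,-10,17]), (21708858, [20,-18,20,19,0,-15,-17,20,27,-38,0,-20,0,67,
    40,-28,20,-20,19,38,-9,-16,62,16,16,35,45,0,-29,0,7,45,-45,-29,-15])),
   ((-14742786, [-14,2,-14,-120,0,13,-9,-16,-17,16,81,14,-112,38,54,16,68,14,5,-7,-9,-34,-31,34,-41,
    -46,-39,0,-1,0,25,-39,9,-1,13]), (25214054, [12,-11,12,12,0,-24,-10,12,16,-23,0,-12,0,41,24,-17,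
    12,-12,-2,8,6,41,38,-41,49,79,72,0,-7,0,-35,72,-27,-7,-24])),
   ((-25794961, [0,-10,0,-107,-54,-26,-21,-2,1,-10,81,0,-112,83,81,-3,81,0,-8,-11,6,-2,10,2,1,-106,
    -85,-54,54,54,7,-118,-21,0,29]), (9427922, [3,-3,3,3,19,-16,-2,3,4,-5,0,-3,0,9,6,-4,3,-3,-10,-9,
    9,-1,9,1,1,4,104,19,-13,-19,10,10,-6,6,-35])),
   ((-15963236, [-2,-9,-2,-108,-44,-17,-19,-4,-1,-7,81,2,-112,78,78,0,80,2,-3,-6,1,-1,6,1,0,-108,
    -79,44,62,44,2,-123,-17,-3,27]), (11254718, [11,-10,11,11,-38,-63,-9,11,15,-21,0,-11,0,37,22,
    -15,11,-11,-38,-34,35,-4,34,4,4,14,75,38,-53,38,38,38,-25,23,-26])),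
   ((-22461151, [-8,-3,-8,-115,0,19,-14,-10,-10,5,81,8,-112,56,65,8,73,8,20,13,-19,1,-14,-1,-2,-116,
    -57,0,-17,0,-20,-57,-3,-17,19]), (18855843, [6,-5,6,5,0,-32,-5,6,7,-11,0,-6,0,19,11,-8,6,-6,-19,
    -17,18,-2,17,2,2,7,94,0,12,0,19,94,-13,12,-32])),
   ((-9465322, [5,-15,5,-102,0,34,-25,3,7,-19,81,-5,-112,99,91,-9,86,-5,-25,-26,21,-3,26,3,2,-100,
    -101,0,31,0,24,-101,-32,31,34]), (3653593, [17,-15,17,16,0,-19,-14,17,22,-32,0,-17,0,56,33,-23,
    17,-17,-57,-50,52,-5,51,5,6,21,57,0,-79,0,57,57,-37,-79,-19])),
   ((-29128772, [8,-18,8,-99,0,-71,-27,6,11,-25,81,-8,-112,109,97,-14,89,-8,-35,-35,30,-4,35,4,3,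
    -96,-91,0,17,0,35,-91,-39,17,-71]), (0, []))]"

definition edges_36 :: "(nat \<times> nat) list" where
  "edges_36 = [(1,9), (1,2), (2,6), (2,13), (3,14), (3,17), (4,7), (4,10), (5,8), (1,5), (0,6),
    (1,6), (0,2), (7,8), (8,9), (4,8), (6,9), (5,9), (10,17), (10,12), (10,11),
    (11,13), (5,12), (11,12), (12,13), (13,16), (14,18), (14,15), (15,16), (3,
    15), (11,16), (14,16), (4,17), (15,17), (3,18)]"

lemma newton_36: "newton_check vertices_36 edges_36"
  by code_simp

lemma graph_36: "graph_check vertices_36 edges_36"
  by code_simp

lemma length_edges_36: "length edges_36 = CARD(35)"
  by (simp add: edges_36_def)

text \<open>The extreme case for the slope: the edges \<open>(0,6)\<close>, \<open>(6,9)\<close> and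
  \<open>(8,9)\<close> run down from the apex in practically one direction, with slope about 0.266
  against the base.\<close>

lemma tile_36: "tile (27 / 100) 36 (773 / 100) (775 / 100)"
proof -
  have check: "tile_check 270 vertices_36" by code_simp
  have m: "length vertices_36 + length (filter (\<lambda>v. \<not> fixed_y v) vertices_36) = 36" by code_simp
  have h: "snd (coarse (vertices_36 ! 0)) = 38702" by code_simp
  show ?thesis
    by (rule tile_weaken[OF tile_of_check[OF newton_36 graph_36 length_edges_36 check m h]]) simp_all
qed

definition vertices_37 :: "vertex list" where
  "vertices_37 = [
   ((0, []), (37977633, [115,-52,39,-7,16,-43,1,1,-15,-15,-38,-38,0,0,0,-35,-29,0,0,-2,0,113,54,54,0,
    41,-2,114,-35,0,0,20,113,19,-29,20])),
   ((-6438149, [97,-44,34,-4,9,-38,6,6,-95,-95,-37,-37,0,0,0,-110,-119,0,0,49,0,25,116,116,0,149,49,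
    36,-110,0,0,14,25,-4,-119,14]), (8926636, [94,-42,31,-6,14,-35,0,0,6,6,-30,-30,0,0,0,0,-3,0,0,6,
    0,0,29,29,0,30,6,-6,0,0,0,-5,0,4,-3,-5])),
   ((-1930915, [132,40,-28,8,-19,31,7,7,-108,-108,22,22,0,0,0,-110,-113,0,0,38,0,25,60,60,0,90,38,
    47,-110,0,0,24,25,-12,-113,24]), (0, [])),
   ((-11915226, [136,-61,-30,8,-17,27,7,7,-107,-107,19,19,0,0,0,-110,-114,0,0,38,0,25,63,63,0,94,38,
    46,-110,0,0,24,25,-11,-114,24]), (559939, [68,-31,-46,-14,31,-76,-1,-1,14,14,-66,-66,0,0,0,0,-6,
    0,0,13,0,0,63,63,0,66,13,-13,0,0,0,-11,0,9,-6,-11])),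
   ((-21899537, [140,-63,-33,-93,-15,22,7,7,-106,-106,15,15,0,0,0,-110,-114,0,0,39,0,25,67,67,0,98,
    39,46,-110,0,0,23,25,-11,-114,23]), (0, [])),
   ((-17392302, [79,-36,8,-24,53,-12,8,8,-119,-119,74,74,0,0,0,-110,-109,0,0,27,0,25,10,10,0,39,27,
    57,-110,0,0,33,25,-19,-109,33]), (8926636, [31,-14,-21,-35,77,18,0,0,6,6,-30,-30,0,0,0,0,-3,0,0,
    6,0,0,29,29,0,30,6,-6,0,0,0,-5,0,4,-3,-5])),
   ((-35289653, [94,-43,-2,-42,92,-4,-104,-104,-115,-115,59,59,0,0,0,-110,-110,0,0,30,0,25,25,25,0,
    54,30,54,-110,0,0,30,25,-17,-110,30]), (0, [])),
   ((-34071672, [60,-27,21,-3,6,-23,4,4,-59,-59,-23,-23,0,0,0,-110,-107,0,0,24,0,25,-7,-7,0,21,24,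
    60,-110,0,0,36,25,-22,-107,36]), (19962879, [2,-1,-1,-2,5,1,-7,-7,97,97,5,5,0,0,0,0,0,0,0,0,0,0,
    2,2,0,2])),
   ((-26340978, [87,-39,3,-33,73,-8,-80,10,-143,-117,67,41,26,-26,26,-110,-109,0,0,29,0,25,17,17,0,
    46,29,55,-110,0,0,32,25,-18,-109,32]), (4463318, [15,-7,-10,-17,39,9,-48,-4,55,3,-15,37,-52,52,
    -52,0,-1,0,0,3,0,0,14,14,0,15,3,-3,0,0,0,-3,0,2,-1,-3])),
   ((-34680662, [77,-35,10,-22,49,-14,-50,8,-113,-119,76,18,-58,-58,58,-110,-108,0,0,27,0,25,9,9,0,
    37,27,57,-110,0,0,33,25,-19,-108,33]), (9981439, [1,0,-1,-1,3,1,-3,-7,100,0,-1,3,4,4,-4,0,0,0,0,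
    0,0,0,1,1,0,1])),
   ((-25731987, [69,-31,15,-13,30,-18,-26,6,-89,-121,83,0,-32,32,32,-110,-108,0,0,26,0,25,1,1,0,30,
    26,59,-110,0,0,35,25,-20,-108,35]), (14444757, [16,-7,-11,-19,41,9,-52,-4,52,3,-16,39,-48,48,48,
    0,-2,0,0,3,0,0,15,15,0,16,3,-3,0,0,0,-3,0,2,-2,-3])),
   ((-26804641, [37,-17,13,-2,4,-14,2,2,-36,-36,-14,-14,0,0,0,-110,-46,-40,40,48,0,25,45,5,-40,13,8,
    37,-110,0,0,16,25,-5,-118,16]), (26832396, [26,-12,7,-3,8,-8,-5,-5,73,73,-4,-4,0,0,0,0,81,42,
    -42,-25,0,0,-53,-11,42,10,17,24,0,0,0,21,0,-17,12,21])),
   ((-17221949, [47,-21,17,-2,4,-18,3,3,-46,-46,-18,-18,0,0,0,-110,-57,56,56,38,0,25,56,0,-56,16,15,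
    47,-110,0,0,24,25,-12,-114,24]), (23973721, [58,-26,19,-5,11,-21,-3,-3,42,42,-16,-16,0,0,0,0,41,
    13,13,-58,0,0,-15,-28,-13,21,39,56,0,0,0,50,0,-41,28,50])),
   ((-3032961, [32,-14,11,-1,3,-12,2,2,-31,-31,-12,-12,0,0,0,-110,-39,0,0,-18,55,25,38,38,0,11,-18,
    32,-55,55,-55,-11,55,26,-39,44]), (28448670, [105,-48,35,-7,15,-39,0,0,-5,-5,-34,-34,0,0,0,0,
    -17,0,0,3,-18,0,42,42,0,38,3,104,-18,-18,18,24,95,10,-17,6])),
   ((-24488980, [69,-31,25,-3,7,-27,5,5,-68,-68,-26,-26,0,0,0,-110,-86,17,-17,14,0,25,83,-12,-17,24,
    30,70,-110,0,0,45,25,-28,-102,45]), (17104204, [34,-15,10,-4,8,-11,-4,-4,65,65,-7,-7,0,0,0,0,71,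
    55,-55,-33,0,0,-44,-15,-55,13,23,32,0,0,0,28,0,-23,16,28])),
   ((-14906288, [79,-36,28,-3,8,-31,5,5,-78,-78,-30,-30,0,0,0,-110,-97,0,0,4,0,25,95,95,0,27,4,79,
    -110,0,0,53,25,-35,-97,53]), (14245529, [66,-30,21,-5,11,-24,-2,-2,34,34,-19,-19,0,0,0,0,32,0,0,
    -66,0,0,-5,-5,0,24,-66,64,0,0,0,57,0,-46,32,57])),
   ((-9768805, [7,-3,3,0,1,-3,0,0,-7,-7,-3,-3,0,0,0,-110,-9,0,0,-4,12,25,9,9,0,2,-4,7,-12,-12,-12,
    -3,12,6,-9,10]), (35839773, [83,-37,27,-6,13,-30,-1,-1,17,17,-26,-26,0,0,0,0,11,0,0,16,-56,0,15,
    15,0,30,16,81,21,56,56,32,56,-8,11,-25])),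
   ((-12801766, [39,-18,14,-2,4,-15,3,3,-38,-38,-15,-15,0,0,0,-110,-48,0,0,-22,-43,25,47,47,0,13,
    -22,39,-67,43,-43,-14,67,32,-48,54]), (26310810, [73,-33,24,-5,12,-26,-2,-2,27,27,-22,-22,0,0,0,
    0,23,0,0,22,-39,0,3,3,0,27,22,71,39,39,-39,35,39,-16,23,-39])),
   ((-6065922, [63,-29,23,-3,6,-25,4,4,-62,-62,-24,-24,0,0,0,-110,-78,0,0,-35,0,25,76,76,0,22,-35,
    64,-110,0,0,87,25,52,-78,87]), (18919706, [95,-43,32,-6,14,-35,0,0,5,5,-30,-30,0,0,0,0,-4,0,0,9,
    0,0,30,30,0,34,9,93,0,0,0,-8,0,2,-4,-8])),
   ((-19537610, [14,-6,5,-1,1,-6,1,1,-14,-14,-5,-5,0,0,0,-110,-18,0,0,-8,0,25,17,17,0,5,-8,14,-110,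
    0,0,-5,25,12,-18,-5]), (33701913, [50,-23,16,-4,10,-18,-3,-3,49,49,-13,-13,0,0,0,0,51,0,0,34,0,
    0,-24,-24,0,19,34,48,0,0,0,43,0,-35,51,43]))]"

definition edges_37 :: "(nat \<times> nat) list" where
  "edges_37 = [(1,2), (2,3), (1,3), (3,4), (4,5), (3,5), (5,8), (6,8), (6,9), (7,9), (7,10),
    (5,10), (8,9), (9,10), (8,10), (0,16), (7,11), (11,12), (12,14), (12,19),
    (13,17), (0,13), (7,14), (14,15), (11,14), (1,15), (12,15), (1,18), (16,19),
    (13,16), (16,17), (17,18), (13,18), (15,18), (11,19), (17,19)]"

lemma newton_37: "newton_check vertices_37 edges_37"
  by code_simp

lemma graph_37: "graph_check vertices_37 edges_37"
  by code_simp

lemma length_edges_37: "length edges_37 = CARD(36)"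
  by (simp add: edges_37_def)

lemma tile_37: "tile (27 / 100) 37 (759 / 100) (760 / 100)"
proof -
  have check: "tile_check 270 vertices_37" by code_simp
  have m: "length vertices_37 + length (filter (\<lambda>v. \<not> fixed_y v) vertices_37) = 37" by code_simp
  have h: "snd (coarse (vertices_37 ! 0)) = 37977" by code_simp
  show ?thesis
    by (rule tile_weaken[OF tile_of_check[OF newton_37 graph_37 length_edges_37 check m h]]) simp_all
qed

section \<open>A quarter with three vertices on the second mirror line\<close>

definition vertices_70 :: "vertex list" where
  "vertices_70 = [
   ((-21207109, [49,26,-145,-16,-163,-3,-18,0,56,26,-2,45,-171,-26,-18,153,0,211,-142,0,-26,-145,51,30,
    -120,23,76,105,29,-102,-72,121,-142,211,-113]), (19034812, [172,4,-278,45,-221,109,-10,0,17,4,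
    69,-40,-137,-4,-10,226,0,288,-116,0,-4,-134,55,13,-130,47,93,214,-25,-209,-44,93,-116,288,
    -69])),
   ((-7947346, [24,-2,257,32,155,-160,-35,0,-4,-2,-102,103,14,2,-35,-208,0,-205,25,0,2,11,-4,-2,9,
    -2,-31,-8,65,200,-8,23,25,-205,-13]), (6718483, [111,-12,23,21,18,-9,-98,0,-17,-12,-6,3,-32,12,
    -98,-129,0,-24,10,0,12,-44,24,-5,-56,33,73,149,2,17,4,105,10,-24,6])),
   ((-9230076, [-16,1,-119,-20,-98,-13,22,0,3,1,-8,-65,-9,-1,22,132,0,130,-16,0,-1,-7,3,2,-6,1,20,5,
    -41,-127,5,-14,-16,130,8]), (16635872, [106,-12,75,14,-14,10,-90,0,-16,-12,6,-18,-35,12,-90,-85,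
    0,19,4,0,12,-47,25,-5,-58,33,80,151,-12,-25,5,101,4,19,8])),
   ((-18519132, [-35,3,36,-45,-20,-74,50,-31,6,3,-47,71,-19,-3,-34,7,31,55,-67,-31,-3,-16,6,3,-13,3,
    44,12,45,34,-43,-32,-36,24,-68]), (21851709, [107,-12,-102,16,-81,40,-93,-49,-17,-12,25,-15,-34,
    12,-39,83,49,154,-43,-49,12,-46,24,-5,-57,33,78,151,-9,-77,-16,102,6,106,-25])),
   ((-25415005, [134,-53,-282,6,-272,51,-23,0,18,51,33,26,-239,53,-23,264,0,353,-200,0,-51,-292,102,
    61,-240,46,122,210,16,-205,-93,166,-200,353,-147]), (9963229, [133,40,-215,35,-170,84,-7,0,-75,
    -8,53,-31,-106,-40,-7,174,0,222,-90,0,8,-66,31,-1,-74,36,71,165,-20,-161,-34,72,-90,222,-53])),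
   ((0, []), (12788054, [143,-15,360,63,221,-219,-144,0,-23,-15,26,138,-14,15,-144,-401,0,-293,43,0,
    15,-29,18,-8,-44,30,32,139,88,279,-7,135,43,-293,-11])),
   ((0, []), (20483689, [68,-8,-209,-35,-250,-21,-37,0,-10,-8,-13,85,-56,8,-37,231,0,332,-34,0,8,
    -64,31,-1,-73,36,127,164,-111,-329,18,66,-34,332,28])),
   ((-31167278, [58,-77,-158,-14,-174,3,-18,0,61,28,2,43,-177,-28,-18,164,0,225,-148,0,-28,-160,56,
    33,-132,25,81,115,28,-112,-74,125,-148,225,-116]), (18143165, [79,24,-128,21,-101,50,-4,0,-45,
    -25,32,-18,-63,25,-4,103,0,132,-53,0,25,28,-1,-20,3,22,42,98,-12,-96,-20,43,-53,132,-32])),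
   ((-10078883, [-42,3,93,-54,25,-96,60,0,8,3,-61,80,-23,-3,60,-39,0,-35,-43,0,-3,-20,7,4,-16,3,53,
    14,50,76,-34,-38,-43,-35,-54]), (16488669, [96,-11,-13,2,-10,5,-77,0,-15,-11,3,-2,-40,11,-77,10,
    0,13,-5,0,11,-51,26,-4,-62,34,92,154,-1,-10,-2,92,-5,13,-3])),
   ((-9654480, [-29,2,-13,-37,-59,-54,41,58,5,2,-34,64,-16,-2,-16,46,58,79,-87,-58,-2,-13,5,3,-11,2,
    36,10,41,-3,-51,-26,-30,74,-80]), (26479659, [96,-11,-8,1,-7,3,-76,-2,-15,-11,2,-1,-40,11,-74,7,
    -2,108,-3,2,11,-51,26,-4,-62,34,92,155,-1,-6,-1,91,-6,9,-2])),
   ((-18094729, [-22,2,-70,-28,-104,-32,31,27,4,2,-20,56,-12,-2,4,92,-27,106,-111,-27,-2,-10,4,2,-8,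
    2,28,7,36,-46,-60,-20,-22,133,-94]), (31842699, [107,-12,-98,16,-77,38,-92,-51,-17,-12,24,-14,
    -34,12,-41,79,51,152,-41,51,12,-46,24,-5,-58,33,78,151,-9,-73,-15,102,6,101,-24])),
   ((-35375174, [143,-51,-296,8,-283,57,-23,0,13,-51,36,24,-245,51,-23,275,0,367,-205,0,-54,-296,
    107,64,-252,48,127,220,15,-215,-95,171,-205,367,-150]), (9071583, [39,12,-64,10,-50,25,-2,0,-22,
    12,16,-9,-31,-12,-2,52,0,66,-27,0,37,-19,-25,-34,59,11,21,49,-6,-48,-10,21,-27,66,-16])),
   ((-29622901, [219,-27,-420,28,-381,105,-27,0,-30,-27,67,6,-306,27,-27,376,0,495,-257,0,27,-334,
    153,-3,-361,69,168,316,4,-308,-115,212,-257,495,-181]), (891647, [93,28,-151,24,-120,59,-5,0,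
    -53,28,38,-22,-74,-28,-5,122,0,156,-63,0,-28,-46,7,-81,-18,25,50,116,-14,-113,-24,50,-63,156,
    -38])),
   ((-39583070, [228,-25,-433,30,-392,111,-28,0,-35,-25,70,4,-313,25,-28,387,0,509,-263,0,25,-338,
    53,-10,-363,72,172,326,2,-319,-117,217,-263,509,-185]), (0, [])),
   ((-19662732, [211,-30,-406,26,-370,100,-27,0,-26,-30,63,8,-300,30,-27,365,0,481,-252,0,30,-330,
    152,4,-360,167,163,305,5,-298,-113,208,-252,481,-178]), (0, [])),
   ((-17474344, [4,0,206,-73,114,-140,-6,0,-1,0,-89,96,2,0,-6,-131,0,-152,4,0,0,2,-1,0,2,0,-40,-1,
    61,162,-16,4,4,-152,-26]), (9757610, [46,-7,-137,22,-109,54,-5,0,-6,-7,34,-20,-68,7,-5,111,0,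
    142,-57,0,7,-74,34,1,-81,38,46,171,-13,-103,-22,46,-57,142,-34])),
   ((-7947346, [24,-2,187,32,225,20,-35,0,-4,-2,13,-77,14,2,-35,-208,0,-205,25,0,2,11,-4,-2,9,-2,
    -31,-8,-49,200,-8,23,25,-205,-13]), (26553261, [101,-11,36,7,45,6,-83,0,-15,-11,4,-17,-38,11,
    -83,-41,0,63,-1,0,11,-49,25,-4,-60,34,87,153,-11,-67,7,96,-1,63,11])),
   ((0, []), (32622832, [133,-14,281,49,339,32,-129,0,-21,-14,20,-118,-20,14,-129,-313,0,-206,32,0,
    14,-34,20,-7,-48,31,46,142,-75,195,161,125,32,-206,-6])),
   ((-26959382, [-28,2,-21,-36,-65,-51,-14,0,5,2,-32,63,-15,-2,-14,52,0,82,-91,0,-2,-13,5,3,-11,2,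
    35,9,40,-9,-52,-26,-91,82,-82]), (27214748, [118,-13,-191,31,-151,75,-7,0,-19,-13,48,-28,-28,13,
    -7,155,0,198,-80,0,13,-41,22,-6,-53,32,64,147,-17,-144,-30,112,-80,198,-48])),
   ((-9230076, [-16,1,-119,-20,-143,-13,22,0,3,1,-8,49,-9,-1,22,132,0,130,-16,0,-1,-7,3,2,-6,1,20,5,
    31,-82,-67,-14,-16,130,-106]), (36470649, [95,-11,-4,1,-3,1,-75,0,-14,-11,1,-1,-41,11,-75,3,0,
    106,-6,0,11,-51,26,-4,-62,34,93,155,0,-3,-1,91,-6,106,-1]))]"

definition edges_70 :: "(nat \<times> nat) list" where
  "edges_70 = [(0,15), (0,7), (1,2), (1,15), (2,16), (2,5), (3,18), (3,9), (0,4), (4,11), (1,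
    5), (2,6), (7,18), (4,7), (3,8), (1,8), (9,10), (8,9), (10,19), (3,10), (11,
    12), (7,11), (12,13), (4,12), (11,13), (12,14), (8,15), (14,15), (6,16),
    (16,19), (16,17), (0,18), (10,18), (9,19), (17,19)]"

lemma newton_70: "newton_check vertices_70 edges_70"
  by code_simp

lemma graph_70: "graph_check vertices_70 edges_70"
  by code_simp

lemma length_edges_70: "length edges_70 = CARD(35)"
  by (simp add: edges_70_def)

text \<open>In this half-graph only the apex is on the second mirror line. The result consists of
  two tiles with 34 vertices that share both ends, and \<open>2 * 34 - 2 = 66\<close>. All other
  vertices lie strictly to the left of that line, which is more than the slope condition for tiles
  demands.\<close>

lemma ex_graph_66: "\<exists>V E. matchstick_graph V E \<and> four_regular V E \<and> card V = 66"
proof (rule double_mirror_of_check[OF newton_34 graph_34 length_edges_34])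
  show "double_mirror_check vertices_34 edges_34" by code_simp
  show "length vertices_34 + length (filter (\<lambda>v. \<not> fixed_y v) vertices_34) +
      length (filter (\<lambda>v. \<not> fixed_x v) vertices_34) +
      length (filter (\<lambda>v. \<not> fixed_x v \<and> \<not> fixed_y v) vertices_34) = 66" by code_simp
qed

lemma ex_graph_68: "\<exists>V E. matchstick_graph V E \<and> four_regular V E \<and> card V = 68"
proof (rule double_mirror_of_check[OF newton_35 graph_35 length_edges_35])
  show "double_mirror_check vertices_35 edges_35" by code_simp
  show "length vertices_35 + length (filter (\<lambda>v. \<not> fixed_y v) vertices_35) +
      length (filter (\<lambda>v. \<not> fixed_x v) vertices_35) +
      length (filter (\<lambda>v. \<not> fixed_x v \<and> \<not> fixed_y v) vertices_35) = 68" by code_simp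
qed

text \<open>The quarter has 20 vertices, two on the real and three on the imaginary axis, so there
  are \<open>15 * 4 + 5 * 2 = 70\<close> images.\<close>

lemma ex_graph_70: "\<exists>V E. matchstick_graph V E \<and> four_regular V E \<and> card V = 70"
proof (rule double_mirror_of_check[OF newton_70 graph_70 length_edges_70])
  show "double_mirror_check vertices_70 edges_70" by code_simp
  show "length vertices_70 + length (filter (\<lambda>v. \<not> fixed_y v) vertices_70) +
      length (filter (\<lambda>v. \<not> fixed_x v) vertices_70) +
      length (filter (\<lambda>v. \<not> fixed_x v \<and> \<not> fixed_y v) vertices_70) = 70" by code_simp
qed

section \<open>Two tiles in a row as one side\<close>

lemma tile_22_22: "tile (27 / 100) 43 (1174 / 100) (1176 / 100)"
  using tile_chain[OF tile_22 tile_22] by simp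

lemma tile_22_34: "tile (27 / 100) 55 (1297 / 100) (1299 / 100)"
  using tile_chain[OF tile_22 tile_34] by simp

lemma tile_22_35: "tile (27 / 100) 56 (1275 / 100) (1277 / 100)"
  using tile_chain[OF tile_22 tile_35] by simp

subsection \<open>Four-regular matchstick graphs with 63 to 120 vertices\<close>

theorem theorem4p1:
  fixes n :: int
  assumes "62 < n" and "n < 121" and "n \<notin> {64, 65, 67, 69, 73, 74}"
  shows "\<exists>(V :: complex set) (E :: complex set set).
           matchstick_graph V E \<and> four_regular V E \<and> int (card V) = n"
proof -
  define G where "G m \<longleftrightarrow> (\<exists>V E. matchstick_graph V E \<and> four_regular V E \<and> card V = m)" for m
  note G = ex_triangle_of_tiles[folded G_def]
  have G63: "G 63" using G[OF tile_22 tile_22 tile_22] by (simp add: power2_eq_square)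
  \<comment> \<open>Three tiles share three vertices. With the tile sizes 22 and then 30 or more,
    triangles give 63 and next 71, which leaves these three numbers to the double
    reflections.\<close>
  have G66: "G 66" using ex_graph_66 unfolding G_def .
  have G68: "G 68" using ex_graph_68 unfolding G_def .
  have G70: "G 70" using ex_graph_70 unfolding G_def .
  have G71: "G 71" using G[OF tile_22 tile_22 tile_30] by (simp add: power2_eq_square)
  have G72: "G 72" using G[OF tile_22 tile_22 tile_31] by (simp add: power2_eq_square)
  have G75: "G 75" using G[OF tile_22 tile_22 tile_34] by (simp add: power2_eq_square)
  have G76: "G 76" using G[OF tile_22 tile_22 tile_35] by (simp add: power2_eq_square)
  have G77: "G 77" using G[OF tile_22 tile_22 tile_36] by (simp add: power2_eq_square)
  have G78: "G 78" using G[OF tile_22 tile_22 tile_37] by (simp add: power2_eq_square)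
  have G79: "G 79" using G[OF tile_22 tile_30 tile_30] by (simp add: power2_eq_square)
  have G80: "G 80" using G[OF tile_22 tile_30 tile_31] by (simp add: power2_eq_square)
  have G81: "G 81" using G[OF tile_22 tile_31 tile_31] by (simp add: power2_eq_square)
  have G82: "G 82" using G[OF tile_22 tile_30 tile_33] by (simp add: power2_eq_square)
  have G83: "G 83" using G[OF tile_22 tile_30 tile_34] by (simp add: power2_eq_square)
  have G84: "G 84" using G[OF tile_22 tile_31 tile_34] by (simp add: power2_eq_square)
  have G85: "G 85" using G[OF tile_22 tile_31 tile_35] by (simp add: power2_eq_square)
  have G86: "G 86" using G[OF tile_22 tile_33 tile_34] by (simp add: power2_eq_square)
  have G87: "G 87" using G[OF tile_30 tile_30 tile_30] by (simp add: power2_eq_square)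
  have G88: "G 88" using G[OF tile_30 tile_30 tile_31] by (simp add: power2_eq_square)
  have G89: "G 89" using G[OF tile_30 tile_31 tile_31] by (simp add: power2_eq_square)
  have G90: "G 90" using G[OF tile_30 tile_30 tile_33] by (simp add: power2_eq_square)
  have G91: "G 91" using G[OF tile_30 tile_31 tile_33] by (simp add: power2_eq_square)
  have G92: "G 92" using G[OF tile_31 tile_31 tile_33] by (simp add: power2_eq_square)
  have G93: "G 93" using G[OF tile_30 tile_33 tile_33] by (simp add: power2_eq_square)
  have G94: "G 94" using G[OF tile_30 tile_30 tile_37] by (simp add: power2_eq_square)
  have G95: "G 95" using G[OF tile_30 tile_31 tile_37] by (simp add: power2_eq_square)
  have G96: "G 96" using G[OF tile_33 tile_33 tile_33] by (simp add: power2_eq_square)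
  have G97: "G 97" using G[OF tile_30 tile_33 tile_37] by (simp add: power2_eq_square)
  have G98: "G 98" using G[OF tile_31 tile_33 tile_37] by (simp add: power2_eq_square)
  have G99: "G 99" using G[OF tile_34 tile_34 tile_34] by (simp add: power2_eq_square)
  have G100: "G 100" using G[OF tile_33 tile_33 tile_37] by (simp add: power2_eq_square)
  have G101: "G 101" using G[OF tile_30 tile_37 tile_37] by (simp add: power2_eq_square)
  have G102: "G 102" using G[OF tile_31 tile_37 tile_37] by (simp add: power2_eq_square)
  have G103: "G 103" using G[OF tile_34 tile_35 tile_37] by (simp add: power2_eq_square)
  have G104: "G 104" using G[OF tile_33 tile_37 tile_37] by (simp add: power2_eq_square)
  have G105: "G 105" using G[OF tile_34 tile_37 tile_37] by (simp add: power2_eq_square)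
  have G106: "G 106" using G[OF tile_35 tile_37 tile_37] by (simp add: power2_eq_square)
  have G107: "G 107" using G[OF tile_36 tile_37 tile_37] by (simp add: power2_eq_square)
  have G108: "G 108" using G[OF tile_37 tile_37 tile_37] by (simp add: power2_eq_square)
  \<comment> \<open>Three single tiles reach at most \<open>3 * 37 - 3 = 108\<close>, so from here
    on one side is a row of two tiles. The other two sides have at least 30 vertices; they are long
    enough for the angles at the ends of the long side to stay above the bound.\<close>
  have G109: "G 109" using G[OF tile_34 tile_35 tile_22_22] by (simp add: power2_eq_square)
  have G110: "G 110" using G[OF tile_33 tile_37 tile_22_22] by (simp add: power2_eq_square)
  have G111: "G 111" using G[OF tile_34 tile_37 tile_22_22] by (simp add: power2_eq_square)
  have G112: "G 112" using G[OF tile_35 tile_37 tile_22_22] by (simp add: power2_eq_square)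
  have G113: "G 113" using G[OF tile_30 tile_30 tile_22_35] by (simp add: power2_eq_square)
  have G114: "G 114" using G[OF tile_37 tile_37 tile_22_22] by (simp add: power2_eq_square)
  have G115: "G 115" using G[OF tile_30 tile_33 tile_22_34] by (simp add: power2_eq_square)
  have G116: "G 116" using G[OF tile_30 tile_33 tile_22_35] by (simp add: power2_eq_square)
  have G117: "G 117" using G[OF tile_31 tile_33 tile_22_35] by (simp add: power2_eq_square)
  have G118: "G 118" using G[OF tile_33 tile_33 tile_22_34] by (simp add: power2_eq_square)
  have G119: "G 119" using G[OF tile_33 tile_33 tile_22_35] by (simp add: power2_eq_square)
  have G120: "G 120" using G[OF tile_30 tile_37 tile_22_35] by (simp add: power2_eq_square)
  have "n \<in> {63, 66, 68, 70, 71, 72, 75, 76, 77, 78, 79, 80, 81, 82, 83, 84, 85, 86, 87, 88,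
    89, 90, 91, 92, 93, 94, 95, 96, 97, 98, 99, 100, 101, 102, 103, 104, 105,
    106, 107, 108, 109, 110, 111, 112, 113, 114, 115, 116, 117, 118, 119, 120}"
    using assms by (simp; presburger)
  then have "G (nat n)"
    by (elim insertE emptyE; simp only: nat_numeral G63  G66  G68  G70  G71  G72  G75  G76  G77  G78  G79  G80  G81  G82  G83  G84 
    G85  G86  G87  G88  G89  G90  G91  G92  G93  G94  G95  G96  G97  G98  G99 
    G100  G101  G102  G103  G104  G105  G106  G107  G108  G109  G110  G111 
    G112  G113  G114  G115  G116  G117  G118  G119  G120)
  then obtain V E where "matchstick_graph V E" "four_regular V E" "card V = nat n"
    unfolding G_def by blast
  then show ?thesis using assms(1) by (intro exI[of _ V] exI[of _ E]) simp
qed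

end
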